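(* Let $E$ be a connected $f_s$-BC and $e\in E$. Then there is an isomorphism $\Pi(E,e)\cong\Pi(Q_E,I_E)$, where $\Pi(E,e)$ and $\Pi(Q_E,I_E)$ denote the fundamental group of $E$ and the fundamental group of the quiver with relations $(Q_E,I_E)$ respectively. Moreover, $\Pi(E,e)$ is also isomorphic to the fundamental group $\Pi(Q'_E,I'_E)$ of the associated quiver with admissible relations $(Q'_E,I'_E)$.
   Context: $k$ is a fixed field; paths in quivers are written from right to left, with source $s$ and terminal $t$. Let $G=\langle g\rangle$ be a fixed infinite cyclic group. A fractional Brauer configuration (f-BC) is a quadruple $E=(E,P,L,d)$, where $E$ is a $G$-set, $P$ and $L$ are two partitions of $E$ (write $P(e)$, $L(e)$ for the classes containing $e\in E$), and $d:E\to\mathbb{Z}_{>0}$ is a function, such that: (f1) $L(e)\subseteq P(e)$ and $P(e)$ is a finite set for each $e\in E$; (f2) if $L(e_1)=L(e_2)$, then $P(g\cdot e_1)=P(g\cdot e_2)$; (f3) if $e_1,e_2$ belong to the same $G$-orbit, then $d(e_1)=d(e_2)$; (f4) $P(e_1)=P(e_2)$ if and only if $P(g^{d(e_1)}\cdot e_1)=P(g^{d(e_2)}\cdot e_2)$; (f5) $L(e_1)=L(e_2)$ if and only if $L(g^{d(e_1)}\cdot e_1)=L(g^{d(e_2)}\cdot e_2)$; (f6) the sequence $L(g^{d(e)-1}\cdot e)\cdots L(g\cdot e)L(e)$ is not a proper subsequence (block of consecutive terms) of $L(g^{d(h)-1}\cdot h)\cdots L(g\cdot h)L(h)$ for all $e,h\in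 E$. Type S. A standard sequence of $E$ is $p=(g^{n-1}\cdot e,\ldots,g\cdot e,e)$ with $e\in E$, $0\le n\le d(e)$ (for $n=0$ the trivial sequence $()_e$). Put ${}^{\wedge}p=(g^{d(e)-1}\cdot e,\ldots,g^{n+1}\cdot e,g^n\cdot e)$ and $p^{\wedge}=(g^{-1}\cdot e,g^{-2}\cdot e,\ldots,g^{n-d(e)}\cdot e)$ (so ${}^\wedge p$ is $()_{g^{d(e)}\cdot e}$ and $p^\wedge$ is $()_e$ when $n=d(e)$), and $L(p)=L(g^{n-1}\cdot e)\cdots L(g\cdot e)L(e)$ as a formal sequence ($L(()_e)=1_{P(e)}$). Write $p\equiv q$ if $L(p)=L(q)$; $[p]=\{q\mid q\equiv p\}$; for a set $\mathscr{X}$ of standard sequences, $[\mathscr{X}]=\bigcup_{p\in\mathscr{X}}[p]$, ${}^\wedge\mathscr{X}=\{{}^\wedge p\mid p\in\mathscr{X}\}$, $\mathscr{X}^\wedge=\{p^\wedge\mid p\in\mathscr{X}\}$. $E$ is of type S (an $f_s$-BC) if: (f7) for standard sequences $p\equiv q$, $[[{}^\wedge p]^\wedge]=[[{}^\wedge q]^\wedge]$ or $[{}^\wedge[p^\wedge]]=[{}^\wedge[q^\wedge]]$. Walks. A walk of $E$ is a sequence $w=(e_n|\delta_n|e_{n-1})\cdots(e_1|\delta_1|e_0)$ with $e_i\in E$, $\delta_i\in\{g,g^{-1},\tau\}$, such that $e_i=g\cdot e_{i-1}$ if $\delta_i=g$, $e_i=g^{-1}\cdot e_{i-1}$ if $\delta_i=g^{-1}$,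 $P(e_i)=P(e_{i-1})$ if $\delta_i=\tau$; abbreviated $(e_n|\delta_n\cdots\delta_1|e_0)$; $(e||e)$ is the trivial walk. Composition $uv$ is concatenation when the terminal of $v$ is the source of $u$. $E$ is connected if any two elements can be connected by a walk. Homotopy $\sim$ is the smallest equivalence relation on walks with: (h1) $(e|g^{-1}g|e)\sim(e|gg^{-1}|e)\sim(e|\tau|e)\sim(e||e)$; (h2) $(e_2|\tau|e_1)(e_1|\tau|e_0)\sim(e_2|\tau|e_0)$; (h3) $(g^{d(h)}\cdot h|\tau|g^{d(e)}\cdot e)(g^{d(e)}\cdot e|g^{d(e)}|e)\sim(g^{d(h)}\cdot h|g^{d(h)}|h)(h|\tau|e)$ whenever $P(e)=P(h)$; (h4) $(g\cdot h|\tau|g\cdot e)(g\cdot e|g|e)\sim(g\cdot h|g|h)(h|\tau|e)$ whenever $L(e)=L(h)$; (h5) compatibility with composition on both sides. $\Pi(E,e)$ is the group of homotopy classes of closed walks at $e$. The quiver with relations $(Q_E,I_E)$: $(Q_E)_0=\{P(e)\mid e\in E\}$, $(Q_E)_1=\{L(e)\mid e\in E\}$ with $s(L(e))=P(e)$, $t(L(e))=P(g\cdot e)$. $I_E$ is the ideal of the path category $kQ_E$ generated by: (fR1) $L(g^{d(e)-1-j}\cdot e)\cdots L(g\cdot e)L(e)-L(g^{d(h)-1-j}\cdot h)\cdots L(g\cdot h)L(h)$, where $j\ge 0$ (both expressions being paths), $P(e)=P(h)$ and $L(g^{d(e)-i}\cdot e)=L(g^{d(h)-i}\cdot h)$ for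 $1\le i\le j$; (fR2) paths $L(e_n)\cdots L(e_2)L(e_1)$ with $n>1$ and $\bigcap_{i=1}^n g^{n-i}\cdot L(e_i)=\emptyset$; (fR3) paths $L(g^{n-1}\cdot e)\cdots L(g\cdot e)L(e)$ with $n>d(e)$. $\Lambda_E=kQ_E/I_E$. The pair $(Q'_E,I'_E)$ for an $f_s$-BC $E$: let $\mathscr{E}=\{L(p)\mid p\text{ a standard sequence of }E\}$, a set of paths of $Q_E$; for $u,v\in\mathscr{E}$ write $uRv$ if there are standard sequences $p,q$ with $u=L(p)$, $v=L(q)$, ${}^\wedge p\equiv{}^\wedge q$ (this is an equivalence relation when $E$ is of type S). An arrow $\alpha$ from $x$ to $y$ of $Q_E$ is reduced if $\alpha Rp$ for some path $p\in\mathscr{E}$ from $x$ to $y$ of length $\ge 2$. Let $\mathscr{N}$ be a complete set of representatives of the non-reduced arrows under $R$. $Q'_E$ is the subquiver of $Q_E$ with $(Q'_E)_0=(Q_E)_0$, $(Q'_E)_1=\mathscr{N}$, and $I'_E$ is the kernel of the natural functor $kQ'_E\to\Lambda_E$ (an admissible ideal with $kQ'_E/I'_E\cong\Lambda_E$). Fundamental group of a quiver with relations. Let $Q$ be a connected locally finite quiver and $I$ an ideal of $kQ$ (not necessarily admissible). A minimal relation of $I$ is $\rho=\sum_{i=1}^n\lambda_iu_i\in I(x,y)$ with $n\ge 2$, $\lambda_i\in k^*$, $u_i$ pairwise distinct paths from $x$ to $y$, such that $\sum_{i\in K}\lambda_iu_i\notin I(x,y)$ for every non-empty proper subset $K\subset\{1,\ldots,n\}$;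 $m(I)$ is the set of these. A walk of $Q$ is a composable sequence of arrows and formal inverses of arrows; $\Pi(Q,x)$ is the group of closed walks at $x$ modulo the congruence generated by $\alpha^{-1}\alpha\sim1_{s(\alpha)}$, $\alpha\alpha^{-1}\sim1_{t(\alpha)}$, and $[w]$ is the class of $w$. $\Pi(Q,I):=\Pi(Q,x)/N(Q,m(I),x)$, where $N(Q,m(I),x)$ is the normal subgroup generated by all $[\gamma^{-1}u^{-1}v\gamma]$ with $\gamma$ a walk of $Q$ from $x$ to $y$ and $u,v$ paths from $y$ to $z$ such that some $\rho=\sum_i\lambda_ip_i\in m(I)$ has $u=p_1$, $v=p_2$. Up to isomorphism this does not depend on $x$. *)

theory Defs
  imports
    "HOL-Algebra.Group_Action"
    "HOL-Algebra.Elementary_Groups"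
    "HOL-Library.Disjoint_Sets"
    "HOL-Library.Sublist"
    "HOL-Library.Poly_Mapping"
    "Graph_Theory.Digraph"
begin

section \<open>Fractional Brauer configurations\<close>

text \<open>The infinite cyclic group \<open>\<langle>g\<rangle>\<close> is \<^const>\<open>integer_group\<close>, with \<open>g = 1\<close>; thus
  \<open>act E n e\<close> is \<open>g\<^sup>n \<cdot> e\<close>.\<close>

record 'e frac_conf =
  elts :: "'e set"
  act :: "int \<Rightarrow> 'e \<Rightarrow> 'e"
  Ppart :: "'e set set"
  Lpart :: "'e set set"
  deg :: "'e \<Rightarrow> nat"

definition part_class :: "'e set set \<Rightarrow> 'e \<Rightarrow> 'e set" where
  "part_class \<P> e = (THE X. X \<in> \<P> \<and> e \<in> X)"

definition Pc :: "'e frac_conf \<Rightarrow> 'e \<Rightarrow> 'e set" where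
  "Pc E e = part_class (Ppart E) e"

definition Lc :: "'e frac_conf \<Rightarrow> 'e \<Rightarrow> 'e set" where
  "Lc E e = part_class (Lpart E) e"

text \<open>Paths and sequences are written from right to left: \<open>[x\<^sub>n, \<dots>, x\<^sub>1]\<close> stands for
  \<open>x\<^sub>n \<cdots> x\<^sub>1\<close>, the head of the list is the last term, and \<open>u @ v\<close> is the composition \<open>uv\<close>.
  \<open>Lseq E e n\<close> is \<open>L(g\<^sup>n\<^sup>-\<^sup>1 \<cdot> e) \<cdots> L(g \<cdot> e) L(e)\<close>.\<close>

definition Lseq :: "'e frac_conf \<Rightarrow> 'e \<Rightarrow> nat \<Rightarrow> 'e set list" where
  "Lseq E e n = map (\<lambda>i. Lc E (act E (int i) e)) (rev [0..<n])"

locale fbc = group_action integer_group "elts E" "act E" for E :: "'e frac_conf" +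
  assumes P_partition: "partition_on (elts E) (Ppart E)"
    and L_partition: "partition_on (elts E) (Lpart E)"
    and d_pos: "e \<in> elts E \<Longrightarrow> deg E e > 0"
    and f1: "e \<in> elts E \<Longrightarrow> Lc E e \<subseteq> Pc E e \<and> finite (Pc E e)"
    and f2: "\<lbrakk>e1 \<in> elts E; e2 \<in> elts E; Lc E e1 = Lc E e2\<rbrakk>
      \<Longrightarrow> Pc E (act E 1 e1) = Pc E (act E 1 e2)"
    and f3: "\<lbrakk>e1 \<in> elts E; e2 \<in> elts E; e2 \<in> orbit integer_group (act E) e1\<rbrakk>
      \<Longrightarrow> deg E e1 = deg E e2"
    and f4: "\<lbrakk>e1 \<in> elts E; e2 \<in> elts E\<rbrakk>
      \<Longrightarrow> Pc E e1 = Pc E e2 \<longleftrightarrow>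
          Pc E (act E (int (deg E e1)) e1) = Pc E (act E (int (deg E e2)) e2)"
    and f5: "\<lbrakk>e1 \<in> elts E; e2 \<in> elts E\<rbrakk>
      \<Longrightarrow> Lc E e1 = Lc E e2 \<longleftrightarrow>
          Lc E (act E (int (deg E e1)) e1) = Lc E (act E (int (deg E e2)) e2)"
    and f6: "\<lbrakk>e \<in> elts E; h \<in> elts E\<rbrakk>
      \<Longrightarrow> \<not> strict_sublist (Lseq E e (deg E e)) (Lseq E h (deg E h))"


subsection \<open>Standard sequences and type S\<close>

text \<open>The standard sequence \<open>(g\<^sup>n\<^sup>-\<^sup>1 \<cdot> e, \<dots>, g \<cdot> e, e)\<close> is encoded by \<open>(e, n)\<close>, which it
  determines; \<open>(e, 0)\<close> is the trivial sequence at \<open>e\<close>.\<close>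

definition std_seqs :: "'e frac_conf \<Rightarrow> ('e \<times> nat) set" where
  "std_seqs E = {(e, n). e \<in> elts E \<and> n \<le> deg E e}"

fun lhat :: "'e frac_conf \<Rightarrow> 'e \<times> nat \<Rightarrow> 'e \<times> nat" where
  "lhat E (e, n) = (act E (int n) e, deg E e - n)"

fun rhat :: "'e frac_conf \<Rightarrow> 'e \<times> nat \<Rightarrow> 'e \<times> nat" where
  "rhat E (e, n) = (act E (int n - int (deg E e)) e, deg E e - n)"

text \<open>A path standing on its own is a pair of its source and its list of arrows, so that trivial
  paths at different vertices are different.\<close>

fun Lpath :: "'e frac_conf \<Rightarrow> 'e \<times> nat \<Rightarrow> 'e set \<times> 'e set list" where
  "Lpath E (e, n) = (Pc E e, Lseq E e n)"

definition seq_equiv :: "'e frac_conf \<Rightarrow> 'e \<times> nat \<Rightarrow> 'e \<times> nat \<Rightarrow> bool" where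
  "seq_equiv E p q \<longleftrightarrow> Lpath E p = Lpath E q"

definition seq_class :: "'e frac_conf \<Rightarrow> ('e \<times> nat) set \<Rightarrow> ('e \<times> nat) set" where
  "seq_class E X = (\<Union>p\<in>X. {q \<in> std_seqs E. seq_equiv E q p})"

locale fs_bc = fbc +
  assumes f7: "\<lbrakk>p \<in> std_seqs E; q \<in> std_seqs E; seq_equiv E p q\<rbrakk> \<Longrightarrow>
      seq_class E (rhat E ` seq_class E {lhat E p}) = seq_class E (rhat E ` seq_class E {lhat E q})
    \<or> seq_class E (lhat E ` seq_class E {rhat E p}) = seq_class E (lhat E ` seq_class E {rhat E q})"


subsection \<open>Walks, homotopy and the fundamental group\<close>

text \<open>\<open>Fwd\<close>, \<open>Bwd\<close>, \<open>Tau\<close> are \<open>g\<close>, \<open>g\<^sup>-\<^sup>1\<close>, \<open>\<tau>\<close>.\<close>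

datatype dir = Fwd | Bwd | Tau

fun fstep :: "'e frac_conf \<Rightarrow> 'e \<times> dir \<times> 'e \<Rightarrow> bool" where
  "fstep E (y, Fwd, x) \<longleftrightarrow> x \<in> elts E \<and> y \<in> elts E \<and> y = act E 1 x"
| "fstep E (y, Bwd, x) \<longleftrightarrow> x \<in> elts E \<and> y \<in> elts E \<and> y = act E (-1) x"
| "fstep E (y, Tau, x) \<longleftrightarrow> x \<in> elts E \<and> y \<in> elts E \<and> Pc E y = Pc E x"

text \<open>\<open>fwalk E a w b\<close>: \<open>w\<close> is a walk from \<open>a\<close> to \<open>b\<close>.  The list
  \<open>[(e\<^sub>n, \<delta>\<^sub>n, e\<^sub>n\<^sub>-\<^sub>1), \<dots>, (e\<^sub>1, \<delta>\<^sub>1, e\<^sub>0)]\<close> is \<open>(e\<^sub>n|\<delta>\<^sub>n|e\<^sub>n\<^sub>-\<^sub>1) \<cdots> (e\<^sub>1|\<delta>\<^sub>1|e\<^sub>0)\<close>, and \<open>[]\<close> is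
  the trivial walk at \<open>a = b\<close>.\<close>

fun fwalk :: "'e frac_conf \<Rightarrow> 'e \<Rightarrow> ('e \<times> dir \<times> 'e) list \<Rightarrow> 'e \<Rightarrow> bool" where
  "fwalk E a [] b \<longleftrightarrow> a \<in> elts E \<and> a = b"
| "fwalk E a ((y, \<delta>, x) # w) b \<longleftrightarrow> fstep E (y, \<delta>, x) \<and> y = b \<and> fwalk E a w x"

definition fbc_connected :: "'e frac_conf \<Rightarrow> bool" where
  "fbc_connected E \<longleftrightarrow> (\<forall>a\<in>elts E. \<forall>b\<in>elts E. \<exists>w. fwalk E a w b)"

text \<open>The walk \<open>(g\<^sup>n \<cdot> e|g\<^sup>n|e)\<close>.\<close>

definition gwalk :: "'e frac_conf \<Rightarrow> 'e \<Rightarrow> nat \<Rightarrow> ('e \<times> dir \<times> 'e) list" where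
  "gwalk E e n = map (\<lambda>i. (act E (int i + 1) e, Fwd, act E (int i) e)) (rev [0..<n])"

text \<open>\<open>fhomotopic E a b u v\<close>: \<open>u\<close> and \<open>v\<close> are homotopic walks from \<open>a\<close> to \<open>b\<close>.\<close>

inductive fhomotopic ::
  "'e frac_conf \<Rightarrow> 'e \<Rightarrow> 'e \<Rightarrow> ('e \<times> dir \<times> 'e) list \<Rightarrow> ('e \<times> dir \<times> 'e) list \<Rightarrow> bool"
  for E :: "'e frac_conf" where
  refl: "fwalk E a u b \<Longrightarrow> fhomotopic E a b u u"
| sym: "fhomotopic E a b u v \<Longrightarrow> fhomotopic E a b v u"
| trans: "\<lbrakk>fhomotopic E a b u v; fhomotopic E a b v w\<rbrakk> \<Longrightarrow> fhomotopic E a b u w"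
| h1_left: "e \<in> elts E \<Longrightarrow>
    fhomotopic E e e [(e, Bwd, act E 1 e), (act E 1 e, Fwd, e)] []"
| h1_right: "e \<in> elts E \<Longrightarrow>
    fhomotopic E e e [(e, Fwd, act E (-1) e), (act E (-1) e, Bwd, e)] []"
| h1_tau: "e \<in> elts E \<Longrightarrow> fhomotopic E e e [(e, Tau, e)] []"
| h2: "\<lbrakk>e0 \<in> elts E; e1 \<in> elts E; e2 \<in> elts E; Pc E e1 = Pc E e0; Pc E e2 = Pc E e1\<rbrakk> \<Longrightarrow>
    fhomotopic E e0 e2 [(e2, Tau, e1), (e1, Tau, e0)] [(e2, Tau, e0)]"
| h3: "\<lbrakk>e \<in> elts E; h \<in> elts E; Pc E e = Pc E h;
        e' = act E (int (deg E e)) e; h' = act E (int (deg E h)) h\<rbrakk> \<Longrightarrow>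
    fhomotopic E e h' ([(h', Tau, e')] @ gwalk E e (deg E e))
                      (gwalk E h (deg E h) @ [(h, Tau, e)])"
| h4: "\<lbrakk>e \<in> elts E; h \<in> elts E; Lc E e = Lc E h; e' = act E 1 e; h' = act E 1 h\<rbrakk> \<Longrightarrow>
    fhomotopic E e h' [(h', Tau, e'), (e', Fwd, e)] [(h', Fwd, h), (h, Tau, e)]"
| h5_left: "\<lbrakk>fhomotopic E a b u v; fwalk E b w c\<rbrakk> \<Longrightarrow> fhomotopic E a c (w @ u) (w @ v)"
| h5_right: "\<lbrakk>fhomotopic E b c u v; fwalk E a w b\<rbrakk> \<Longrightarrow> fhomotopic E a c (u @ w) (v @ w)"

definition fbc_fund_group :: "'e frac_conf \<Rightarrow> 'e \<Rightarrow> ('e \<times> dir \<times> 'e) list set monoid" where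
  "fbc_fund_group E e =
    \<lparr>carrier = {Collect (fhomotopic E e e w) | w. fwalk E e w e},
     monoid.mult = (\<lambda>A B. \<Union>u\<in>A. \<Union>v\<in>B. Collect (fhomotopic E e e (u @ v))),
     one = Collect (fhomotopic E e e [])\<rparr>"


section \<open>Quivers with relations\<close>

text \<open>A quiver is a directed multigraph with loops allowed; \<^const>\<open>tail\<close> and \<^const>\<open>head\<close> are the
  source and the terminal of an arrow.  \<open>qpath Q x p y\<close>: \<open>p\<close> is a path from \<open>x\<close> to \<open>y\<close>.\<close>

fun qpath :: "('v, 'a) pre_digraph \<Rightarrow> 'v \<Rightarrow> 'a list \<Rightarrow> 'v \<Rightarrow> bool" where
  "qpath Q x [] y \<longleftrightarrow> x \<in> verts Q \<and> x = y"
| "qpath Q x (a # p) y \<longleftrightarrow> a \<in> arcs Q \<and> head Q a = y \<and> qpath Q x p (tail Q a)"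

text \<open>Morphisms \<open>x \<rightarrow> y\<close> of the path category \<open>kQ\<close>, and their composition.\<close>

definition khom :: "('v, 'a) pre_digraph \<Rightarrow> 'v \<Rightarrow> 'v \<Rightarrow> ('a list \<Rightarrow>\<^sub>0 'k::field) set" where
  "khom Q x y = {f. \<forall>p \<in> Poly_Mapping.keys f. qpath Q x p y}"

definition kcomp :: "('a list \<Rightarrow>\<^sub>0 'k::field) \<Rightarrow> ('a list \<Rightarrow>\<^sub>0 'k) \<Rightarrow> ('a list \<Rightarrow>\<^sub>0 'k)" where
  "kcomp f h = (\<Sum>u \<in> Poly_Mapping.keys f. \<Sum>v \<in> Poly_Mapping.keys h.
     Poly_Mapping.single (u @ v) (Poly_Mapping.lookup f u * Poly_Mapping.lookup h v))"

type_synonym ('v, 'a, 'k) cat_ideal = "'v \<Rightarrow> 'v \<Rightarrow> ('a list \<Rightarrow>\<^sub>0 'k) set"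

text \<open>The ideal of \<open>kQ\<close> generated by \<open>S\<close>, where \<open>S x y f\<close> says that \<open>f : x \<rightarrow> y\<close> is one of the
  generators.  Closure under scalars is closure under composition with \<open>c \<cdot> 1\<^sub>y\<close>.\<close>

inductive in_gen_ideal ::
  "('v, 'a) pre_digraph \<Rightarrow> ('v \<Rightarrow> 'v \<Rightarrow> ('a list \<Rightarrow>\<^sub>0 'k::field) \<Rightarrow> bool) \<Rightarrow>
    'v \<Rightarrow> 'v \<Rightarrow> ('a list \<Rightarrow>\<^sub>0 'k) \<Rightarrow> bool"
  for Q :: "('v, 'a) pre_digraph" and S :: "'v \<Rightarrow> 'v \<Rightarrow> ('a list \<Rightarrow>\<^sub>0 'k::field) \<Rightarrow> bool" where
  gen: "S x y f \<Longrightarrow> in_gen_ideal Q S x y f"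
| zero: "\<lbrakk>x \<in> verts Q; y \<in> verts Q\<rbrakk> \<Longrightarrow> in_gen_ideal Q S x y 0"
| add: "\<lbrakk>in_gen_ideal Q S x y f; in_gen_ideal Q S x y h\<rbrakk> \<Longrightarrow> in_gen_ideal Q S x y (f + h)"
| comp_left: "\<lbrakk>in_gen_ideal Q S x y f; h \<in> khom Q y z\<rbrakk> \<Longrightarrow> in_gen_ideal Q S x z (kcomp h f)"
| comp_right: "\<lbrakk>in_gen_ideal Q S y z f; h \<in> khom Q x y\<rbrakk> \<Longrightarrow> in_gen_ideal Q S x z (kcomp f h)"

definition gen_ideal ::
  "('v, 'a) pre_digraph \<Rightarrow> ('v \<Rightarrow> 'v \<Rightarrow> ('a list \<Rightarrow>\<^sub>0 'k::field) \<Rightarrow> bool) \<Rightarrow> ('v, 'a, 'k) cat_ideal"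
  where "gen_ideal Q S x y = {f. in_gen_ideal Q S x y f}"

text \<open>The class of \<open>f\<close> in \<open>(kQ/I)(x, y)\<close>, and the kernel of \<open>kQ' \<rightarrow> kQ \<rightarrow> kQ/I\<close> for a subquiver
  \<open>Q'\<close> of \<open>Q\<close>.\<close>

definition quot_class ::
  "('v, 'a) pre_digraph \<Rightarrow> ('v, 'a, 'k::field) cat_ideal \<Rightarrow> 'v \<Rightarrow> 'v \<Rightarrow>
    ('a list \<Rightarrow>\<^sub>0 'k) \<Rightarrow> ('a list \<Rightarrow>\<^sub>0 'k) set" where
  "quot_class Q I x y f = {h \<in> khom Q x y. h - f \<in> I x y}"

definition sub_kernel ::
  "('v, 'a) pre_digraph \<Rightarrow> ('v, 'a) pre_digraph \<Rightarrow> ('v, 'a, 'k::field) cat_ideal \<Rightarrow>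
    ('v, 'a, 'k) cat_ideal" where
  "sub_kernel Q' Q I x y = {f \<in> khom Q' x y. quot_class Q I x y f = quot_class Q I x y 0}"


subsection \<open>The fundamental group of a quiver with relations\<close>

definition kpart :: "'p set \<Rightarrow> ('p \<Rightarrow>\<^sub>0 'k::field) \<Rightarrow> ('p \<Rightarrow>\<^sub>0 'k)" where
  "kpart K f = (\<Sum>p\<in>K. Poly_Mapping.single p (Poly_Mapping.lookup f p))"

definition minimal_relation ::
  "('v, 'a, 'k::field) cat_ideal \<Rightarrow> 'v \<Rightarrow> 'v \<Rightarrow> ('a list \<Rightarrow>\<^sub>0 'k) \<Rightarrow> bool" where
  "minimal_relation I x y \<rho> \<longleftrightarrow>
     \<rho> \<in> I x y \<and> card (Poly_Mapping.keys \<rho>) \<ge> 2 \<and>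
     (\<forall>K. K \<noteq> {} \<and> K \<subset> Poly_Mapping.keys \<rho> \<longrightarrow> kpart K \<rho> \<notin> I x y)"

text \<open>Letters of walks of a quiver: arrows and their formal inverses.\<close>

datatype 'a letter = Arr 'a | Inv 'a

fun qwalk :: "('v, 'a) pre_digraph \<Rightarrow> 'v \<Rightarrow> 'a letter list \<Rightarrow> 'v \<Rightarrow> bool" where
  "qwalk Q x [] y \<longleftrightarrow> x \<in> verts Q \<and> x = y"
| "qwalk Q x (Arr a # w) y \<longleftrightarrow> a \<in> arcs Q \<and> head Q a = y \<and> qwalk Q x w (tail Q a)"
| "qwalk Q x (Inv a # w) y \<longleftrightarrow> a \<in> arcs Q \<and> tail Q a = y \<and> qwalk Q x w (head Q a)"

fun inv_letter :: "'a letter \<Rightarrow> 'a letter" where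
  "inv_letter (Arr a) = Inv a"
| "inv_letter (Inv a) = Arr a"

definition inv_walk :: "'a letter list \<Rightarrow> 'a letter list" where
  "inv_walk w = rev (map inv_letter w)"

inductive qhomotopic ::
  "('v, 'a) pre_digraph \<Rightarrow> 'v \<Rightarrow> 'v \<Rightarrow> 'a letter list \<Rightarrow> 'a letter list \<Rightarrow> bool"
  for Q :: "('v, 'a) pre_digraph" where
  refl: "qwalk Q x u y \<Longrightarrow> qhomotopic Q x y u u"
| sym: "qhomotopic Q x y u v \<Longrightarrow> qhomotopic Q x y v u"
| trans: "\<lbrakk>qhomotopic Q x y u v; qhomotopic Q x y v w\<rbrakk> \<Longrightarrow> qhomotopic Q x y u w"
| cancel_left: "a \<in> arcs Q \<Longrightarrow> qhomotopic Q (tail Q a) (tail Q a) [Inv a, Arr a] []"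
| cancel_right: "a \<in> arcs Q \<Longrightarrow> qhomotopic Q (head Q a) (head Q a) [Arr a, Inv a] []"
| comp_left: "\<lbrakk>qhomotopic Q x y u v; qwalk Q y w z\<rbrakk> \<Longrightarrow> qhomotopic Q x z (w @ u) (w @ v)"
| comp_right: "\<lbrakk>qhomotopic Q y z u v; qwalk Q x w y\<rbrakk> \<Longrightarrow> qhomotopic Q x z (u @ w) (v @ w)"

definition quiver_group :: "('v, 'a) pre_digraph \<Rightarrow> 'v \<Rightarrow> 'a letter list set monoid" where
  "quiver_group Q x =
    \<lparr>carrier = {Collect (qhomotopic Q x x w) | w. qwalk Q x w x},
     monoid.mult = (\<lambda>A B. \<Union>u\<in>A. \<Union>v\<in>B. Collect (qhomotopic Q x x (u @ v))),
     one = Collect (qhomotopic Q x x [])\<rparr>"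

text \<open>The terms of a sum may be numbered arbitrarily, so \<open>u = p\<^sub>1\<close> and \<open>v = p\<^sub>2\<close> below are any two
  distinct paths occurring in \<open>\<rho>\<close>.\<close>

definition relators ::
  "('v, 'a) pre_digraph \<Rightarrow> ('v, 'a, 'k::field) cat_ideal \<Rightarrow> 'v \<Rightarrow> 'a letter list set set" where
  "relators Q I x =
    {Collect (qhomotopic Q x x (inv_walk \<gamma> @ inv_walk (map Arr u) @ map Arr v @ \<gamma>)) |
       \<gamma> u v y z \<rho>. qwalk Q x \<gamma> y \<and> qpath Q y u z \<and> qpath Q y v z \<and>
         minimal_relation I y z \<rho> \<and> u \<in> Poly_Mapping.keys \<rho> \<and> v \<in> Poly_Mapping.keys \<rho> \<and> u \<noteq> v}"

definition normal_closure :: "('g, 'b) monoid_scheme \<Rightarrow> 'g set \<Rightarrow> 'g set" where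
  "normal_closure H S = \<Inter>{K. K \<lhd> H \<and> S \<subseteq> K}"

definition fund_group ::
  "('v, 'a) pre_digraph \<Rightarrow> ('v, 'a, 'k::field) cat_ideal \<Rightarrow> 'v \<Rightarrow> 'a letter list set set monoid"
  where
  "fund_group Q I x = quiver_group Q x Mod normal_closure (quiver_group Q x) (relators Q I x)"


section \<open>The quivers with relations of a fractional Brauer configuration\<close>

text \<open>By (f1) and (f2) the classes \<open>P(e)\<close> and \<open>P(g \<cdot> e)\<close> depend only on \<open>L(e)\<close>.\<close>

definition fbc_quiver :: "'e frac_conf \<Rightarrow> ('e set, 'e set) pre_digraph" where
  "fbc_quiver E =
    \<lparr>verts = Ppart E, arcs = Lpart E,
     tail = (\<lambda>l. THE X. \<exists>e\<in>l. X = Pc E e),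
     head = (\<lambda>l. THE X. \<exists>e\<in>l. X = Pc E (act E 1 e))\<rparr>"

text \<open>In (fR2) the entry of \<open>L(e\<^sub>n) \<cdots> L(e\<^sub>1)\<close> at list position \<open>m\<close> is \<open>L(e\<^sub>n\<^sub>-\<^sub>m)\<close>, which is to be
  shifted by \<open>g\<^sup>m\<close>.\<close>

inductive fbc_rel ::
  "'e frac_conf \<Rightarrow> 'e set \<Rightarrow> 'e set \<Rightarrow> ('e set list \<Rightarrow>\<^sub>0 'k::field) \<Rightarrow> bool"
  for E :: "'e frac_conf" where
  fR1: "\<lbrakk>e \<in> elts E; h \<in> elts E; Pc E e = Pc E h; j \<le> deg E e; j \<le> deg E h;
         \<forall>i\<in>{1..j}. Lc E (act E (int (deg E e - i)) e) = Lc E (act E (int (deg E h - i)) h)\<rbrakk> \<Longrightarrow>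
    fbc_rel E (Pc E e) (Pc E (act E (int (deg E e - j)) e))
      (Poly_Mapping.single (Lseq E e (deg E e - j)) 1
        - Poly_Mapping.single (Lseq E h (deg E h - j)) 1)"
| fR2: "\<lbrakk>qpath (fbc_quiver E) x p y; length p > 1;
         (\<Inter>m<length p. act E (int m) ` (p ! m)) = {}\<rbrakk> \<Longrightarrow>
    fbc_rel E x y (Poly_Mapping.single p 1)"
| fR3: "\<lbrakk>e \<in> elts E; n > deg E e\<rbrakk> \<Longrightarrow>
    fbc_rel E (Pc E e) (Pc E (act E (int n) e)) (Poly_Mapping.single (Lseq E e n) 1)"

definition fbc_ideal :: "'e frac_conf \<Rightarrow> ('e set, 'e set, 'k::field) cat_ideal" where
  "fbc_ideal E = gen_ideal (fbc_quiver E) (fbc_rel E)"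

definition std_paths :: "'e frac_conf \<Rightarrow> ('e set \<times> 'e set list) set" where
  "std_paths E = Lpath E ` std_seqs E"

definition R_rel :: "'e frac_conf \<Rightarrow> 'e set \<times> 'e set list \<Rightarrow> 'e set \<times> 'e set list \<Rightarrow> bool" where
  "R_rel E u v \<longleftrightarrow> (\<exists>p\<in>std_seqs E. \<exists>q\<in>std_seqs E.
     u = Lpath E p \<and> v = Lpath E q \<and> seq_equiv E (lhat E p) (lhat E q))"

definition arrow_path :: "'e frac_conf \<Rightarrow> 'e set \<Rightarrow> 'e set \<times> 'e set list" where
  "arrow_path E \<alpha> = (tail (fbc_quiver E) \<alpha>, [\<alpha>])"

definition reduced_arrow :: "'e frac_conf \<Rightarrow> 'e set \<Rightarrow> bool" where
  "reduced_arrow E \<alpha> \<longleftrightarrow> \<alpha> \<in> arcs (fbc_quiver E) \<and>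
    (\<exists>x y p. x = tail (fbc_quiver E) \<alpha> \<and> y = head (fbc_quiver E) \<alpha> \<and>
       qpath (fbc_quiver E) x p y \<and> (x, p) \<in> std_paths E \<and> length p \<ge> 2 \<and>
       R_rel E (arrow_path E \<alpha>) (x, p))"

definition nonreduced_arrows :: "'e frac_conf \<Rightarrow> 'e set set" where
  "nonreduced_arrows E = {\<alpha> \<in> arcs (fbc_quiver E). \<not> reduced_arrow E \<alpha>}"

definition arrow_reps :: "'e frac_conf \<Rightarrow> 'e set set \<Rightarrow> bool" where
  "arrow_reps E N \<longleftrightarrow> N \<subseteq> nonreduced_arrows E \<and>
    (\<forall>\<alpha>\<in>nonreduced_arrows E. \<exists>!\<beta>. \<beta> \<in> N \<and> R_rel E (arrow_path E \<alpha>) (arrow_path E \<beta>))"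

definition fbc_quiver' :: "'e frac_conf \<Rightarrow> 'e set set \<Rightarrow> ('e set, 'e set) pre_digraph" where
  "fbc_quiver' E N = (fbc_quiver E)\<lparr>arcs := N\<rparr>"

definition fbc_ideal' :: "'e frac_conf \<Rightarrow> 'e set set \<Rightarrow> ('e set, 'e set, 'k::field) cat_ideal" where
  "fbc_ideal' E N = sub_kernel (fbc_quiver' E N) (fbc_quiver E) (fbc_ideal E)"

end

theory Submission
  imports Defs
begin

text \<open>The ideal \<open>I\<^sub>E\<close> is generated by paths and by differences of two paths, so a minimal relation
  is supported on one class of nonzero paths for the congruence generated by (fR1), and \<open>\<Pi>(Q\<^sub>E, I\<^sub>E)\<close>
  is the fundamental group of \<open>Q\<^sub>E\<close> modulo this congruence on nonzero paths.  Sending an arrow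
  \<open>L(e)\<close> to \<open>(e'|\<tau>|g \<cdot> e)(g \<cdot> e|g|e)(e|\<tau>|e'')\<close>, with \<open>e'\<close>, \<open>e''\<close> fixed representatives of
  \<open>P(g \<cdot> e)\<close>, \<open>P(e)\<close>, turns (fR1) into (h3) with a common left factor cancelled.  The inverse deletes
  all \<open>\<tau>\<close>; it respects (h3) only because full standard sequences are nonzero in \<open>\<Lambda>\<^sub>E\<close>: by (f7), the
  congruence permutes the full standard sequences at a vertex, and none of these has a factor in
  (fR2) or, by (f6), in (fR3).  For \<open>Q'\<^sub>E\<close> the same argument applies, because each arrow of \<open>Q\<^sub>E\<close> is
  congruent to a path of \<open>Q'\<^sub>E\<close>.\<close>

section \<open>Groups of homotopy classes of walks\<close>

text \<open>The obstacle is an asymmetry: homotopy of walks identifies congruent paths even if they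
  are zero in \<open>\<Lambda>_E\<close>, whereas minimal relations relate only nonzero paths. Hence
  the map from quiver walks to walks of \<open>E\<close> respects all of \<open>path_cong\<close>,
  but no inverse homomorphism is built. Instead, a closed quiver walk with trivial image is shown to
  have its class in every normal subgroup \<open>M\<close> that contains the relators, by pushing
  each generating homotopy through \<open>word\<close> modulo \<open>M\<close>; nonvanishing of
  standard paths enters there. Ideals are linked to paths by linear functionals: if a set of paths
  is closed under \<open>path_cong\<close> and no member has a zero factor, then the sum of
  coefficients over this set vanishes on \<open>fbc_ideal\<close>. This confines the support of a
  minimal relation to one class and also shows that a nonzero path is outside the ideal. Both
  isomorphisms are instances of one argument about a subquiver with arrow set \<open>N\<close> and a
  path \<open>\<phi> l\<close> in it congruent to each arrow \<open>l\<close>; for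
  \<open>Q_E\<close> itself, \<open>\<phi> l = [l]\<close>.\<close>

locale walk_groupoid =
  fixes walk :: "'o \<Rightarrow> 'l list \<Rightarrow> 'o \<Rightarrow> bool"
    and hom :: "'o \<Rightarrow> 'o \<Rightarrow> 'l list \<Rightarrow> 'l list \<Rightarrow> bool"
  assumes walk_append: "\<lbrakk>walk a u b; walk b v c\<rbrakk> \<Longrightarrow> walk a (v @ u) c"
    and walk_source: "walk a w b \<Longrightarrow> walk a [] a"
    and hom_walk: "hom a b u v \<Longrightarrow> walk a u b \<and> walk a v b"
    and hom_refl: "walk a u b \<Longrightarrow> hom a b u u"
    and hom_sym: "hom a b u v \<Longrightarrow> hom a b v u"
    and hom_trans [trans]: "\<lbrakk>hom a b u v; hom a b v w\<rbrakk> \<Longrightarrow> hom a b u w"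
    and hom_left: "\<lbrakk>hom a b u v; walk b w c\<rbrakk> \<Longrightarrow> hom a c (w @ u) (w @ v)"
    and hom_right: "\<lbrakk>hom b c u v; walk a w b\<rbrakk> \<Longrightarrow> hom a c (u @ w) (v @ w)"
    and walk_inverse: "walk a w b \<Longrightarrow>
      \<exists>w'. walk b w' a \<and> hom a a (w' @ w) [] \<and> hom b b (w @ w') []"
begin

definition cl :: "'o \<Rightarrow> 'l list \<Rightarrow> 'l list set" where
  "cl a w = Collect (hom a a w)"

text \<open>The product is a union over representatives, the shape shared by
  \<open>quiver_group\<close> and \<open>fbc_fund_group\<close>, so that both become instances by
  unfolding.\<close>

definition wgroup :: "'o \<Rightarrow> 'l list set monoid" where
  "wgroup a = \<lparr>carrier = {cl a w | w. walk a w a},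
     monoid.mult = (\<lambda>A B. \<Union>u\<in>A. \<Union>v\<in>B. cl a (u @ v)),
     one = cl a []\<rparr>"

lemma hom_append: "\<lbrakk>hom a b u u'; hom b c v v'\<rbrakk> \<Longrightarrow> hom a c (v @ u) (v' @ u')"
  by (meson hom_left hom_right hom_trans hom_walk)

lemma hom_cancel_middle:
  assumes "hom b b u []" "walk a w b" "walk b v c"
  shows "hom a c (v @ u @ w) (v @ w)"
  using hom_left[OF hom_right[OF assms(1,2)] assms(3)] by simp

text \<open>Used because (h3) compares full sequences only, while (fR1) also relates their
  right-hand parts.\<close>

lemma hom_left_cancel:
  assumes "hom a c (w @ u) (w @ v)" "walk a u b" "walk a v b" "walk b w c"
  shows "hom a b u v"
proof -
  obtain w' where w': "walk c w' b" "hom b b (w' @ w) []"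
    using walk_inverse[OF assms(4)] by blast
  have "hom a b ([] @ u) ((w' @ w) @ u)"
    by (rule hom_right[OF hom_sym[OF w'(2)] assms(2)])
  also have "hom a b ((w' @ w) @ u) ((w' @ w) @ v)"
    using hom_left[OF assms(1) w'(1)] by simp
  also have "hom a b ((w' @ w) @ v) ([] @ v)"
    by (rule hom_right[OF w'(2) assms(3)])
  finally show ?thesis by simp
qed

lemma hom_context:
  "\<lbrakk>hom b c u v; walk a w b; walk c w' d\<rbrakk> \<Longrightarrow> hom a d (w' @ u @ w) (w' @ v @ w)"
  by (rule hom_left[OF hom_right])

text \<open>Both walks reduce to \<open>v' @ u @ u'\<close>: a left inverse of \<open>v\<close> and
  a right inverse of \<open>u\<close> are enough.\<close>

lemma hom_inverse:
  assumes "hom a b u v" "walk b u' a" "walk b v' a" "hom a a (v' @ v) []" "hom b b (u @ u') []"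
  shows "hom b a u' v'"
proof -
  have "hom b a ([] @ u') ((v' @ v) @ u')"
    by (rule hom_right[OF hom_sym[OF assms(4)] assms(2)])
  also have "hom b a ((v' @ v) @ u') (v' @ u @ u')"
    using hom_context[OF hom_sym[OF assms(1)] assms(2,3)] by simp
  also have "hom b a (v' @ u @ u') (v' @ [])"
    by (rule hom_left[OF assms(5,3)])
  finally show ?thesis by simp
qed

lemma cl_eqI: "hom a a u v \<Longrightarrow> cl a u = cl a v"
  unfolding cl_def using hom_sym hom_trans by blast

lemma cl_eq_iff: "walk a u a \<Longrightarrow> cl a u = cl a v \<longleftrightarrow> hom a a u v"
  using cl_eqI hom_refl hom_sym unfolding cl_def by blast

lemma mem_cl: "u \<in> cl a w \<longleftrightarrow> hom a a w u"
  by (simp add: cl_def)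

lemma carrier_wgroup: "carrier (wgroup a) = {cl a w | w. walk a w a}"
  by (simp add: wgroup_def)

lemma cl_in_carrier: "walk a w a \<Longrightarrow> cl a w \<in> carrier (wgroup a)"
  by (auto simp: carrier_wgroup)

lemma one_wgroup: "\<one>\<^bsub>wgroup a\<^esub> = cl a []"
  by (simp add: wgroup_def)

lemma mult_cl:
  assumes "walk a u a" "walk a v a"
  shows "cl a u \<otimes>\<^bsub>wgroup a\<^esub> cl a v = cl a (u @ v)"
proof -
  have "cl a (u' @ v') = cl a (u @ v)" if "u' \<in> cl a u" "v' \<in> cl a v" for u' v'
    using that by (intro cl_eqI hom_append) (auto simp: mem_cl intro: hom_sym)
  moreover have "u \<in> cl a u" "v \<in> cl a v"
    using assms by (auto simp: mem_cl intro: hom_refl)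
  ultimately have "(\<Union>u'\<in>cl a u. \<Union>v'\<in>cl a v. cl a (u' @ v')) = cl a (u @ v)"
    by blast
  then show ?thesis
    by (simp add: wgroup_def)
qed

lemma group_wgroup:
  assumes "walk a [] a"
  shows "group (wgroup a)"
proof (rule groupI)
  fix x y assume "x \<in> carrier (wgroup a)" "y \<in> carrier (wgroup a)"
  then show "x \<otimes>\<^bsub>wgroup a\<^esub> y \<in> carrier (wgroup a)"
    by (auto simp: carrier_wgroup mult_cl intro: walk_append)
next
  show "\<one>\<^bsub>wgroup a\<^esub> \<in> carrier (wgroup a)"
    using assms by (simp add: one_wgroup cl_in_carrier)
next
  fix x y z
  assume "x \<in> carrier (wgroup a)" "y \<in> carrier (wgroup a)" "z \<in> carrier (wgroup a)"
  then show "x \<otimes>\<^bsub>wgroup a\<^esub> y \<otimes>\<^bsub>wgroup a\<^esub> z = x \<otimes>\<^bsub>wgroup a\<^esub> (y \<otimes>\<^bsub>wgroup a\<^esub> z)"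
    by (auto simp: carrier_wgroup mult_cl walk_append)
next
  fix x assume "x \<in> carrier (wgroup a)"
  then show "\<one>\<^bsub>wgroup a\<^esub> \<otimes>\<^bsub>wgroup a\<^esub> x = x"
    using assms by (auto simp: carrier_wgroup one_wgroup mult_cl)
next
  fix x assume "x \<in> carrier (wgroup a)"
  then obtain w where w: "walk a w a" "x = cl a w"
    by (auto simp: carrier_wgroup)
  obtain w' where w': "walk a w' a" "hom a a (w' @ w) []"
    using walk_inverse[OF w(1)] by blast
  show "\<exists>y\<in>carrier (wgroup a). y \<otimes>\<^bsub>wgroup a\<^esub> x = \<one>\<^bsub>wgroup a\<^esub>"
    using w w' by (intro bexI[of _ "cl a w'"])
      (simp_all add: mult_cl one_wgroup cl_in_carrier cl_eqI)
qed

text \<open>Comparing left cosets, instead of testing whether the class of \<open>u\<^sup>-\<^sup>1v\<close> is in \<open>M\<close>, keeps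
  inverses out of the congruence laws.\<close>

definition coset_cong :: "'o \<Rightarrow> 'l list set set \<Rightarrow> 'o \<Rightarrow> 'o \<Rightarrow> 'l list \<Rightarrow> 'l list \<Rightarrow> bool" where
  "coset_cong r M x y u v \<longleftrightarrow> walk x u y \<and> walk x v y \<and>
     (\<forall>\<gamma> \<delta>. walk r \<gamma> x \<longrightarrow> walk y \<delta> r \<longrightarrow>
        cl r (\<delta> @ u @ \<gamma>) <#\<^bsub>wgroup r\<^esub> M = cl r (\<delta> @ v @ \<gamma>) <#\<^bsub>wgroup r\<^esub> M)"

lemma coset_cong_hom:
  assumes "hom x y u v"
  shows "coset_cong r M x y u v"
proof -
  have "cl r (\<delta> @ u @ \<gamma>) = cl r (\<delta> @ v @ \<gamma>)" if "walk r \<gamma> x" "walk y \<delta> r" for \<gamma> \<delta>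
    by (intro cl_eqI hom_left[OF hom_right[OF assms that(1)] that(2)])
  then show ?thesis
    using hom_walk[OF assms] unfolding coset_cong_def by metis
qed

lemma coset_cong_sym: "coset_cong r M x y u v \<Longrightarrow> coset_cong r M x y v u"
  by (auto simp: coset_cong_def)

lemma coset_cong_trans [trans]:
  "\<lbrakk>coset_cong r M x y u v; coset_cong r M x y v w\<rbrakk> \<Longrightarrow> coset_cong r M x y u w"
  by (auto simp: coset_cong_def)

lemma coset_cong_left:
  assumes "coset_cong r M x y u v" "walk y w z"
  shows "coset_cong r M x z (w @ u) (w @ v)"
  unfolding coset_cong_def
proof (intro conjI allI impI)
  fix \<gamma> \<delta> assume "walk r \<gamma> x" "walk z \<delta> r"
  moreover have "walk y (\<delta> @ w) r"
    by (rule walk_append) fact+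
  ultimately show "cl r (\<delta> @ (w @ u) @ \<gamma>) <#\<^bsub>wgroup r\<^esub> M = cl r (\<delta> @ (w @ v) @ \<gamma>) <#\<^bsub>wgroup r\<^esub> M"
    using assms(1) unfolding coset_cong_def by (metis append_assoc)
qed (use assms in \<open>auto simp: coset_cong_def intro: walk_append\<close>)

lemma coset_cong_right:
  assumes "coset_cong r M y z u v" "walk x w y"
  shows "coset_cong r M x z (u @ w) (v @ w)"
  unfolding coset_cong_def
proof (intro conjI allI impI)
  fix \<gamma> \<delta> assume "walk r \<gamma> x" "walk z \<delta> r"
  moreover have "walk r (w @ \<gamma>) y"
    by (rule walk_append) fact+
  ultimately show "cl r (\<delta> @ (u @ w) @ \<gamma>) <#\<^bsub>wgroup r\<^esub> M = cl r (\<delta> @ (v @ w) @ \<gamma>) <#\<^bsub>wgroup r\<^esub> M"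
    using assms(1) unfolding coset_cong_def by (metis append_assoc)
qed (use assms in \<open>auto simp: coset_cong_def intro: walk_append\<close>)

lemma coset_cong_append:
  assumes "coset_cong r M x y u u'" "coset_cong r M y z v v'"
  shows "coset_cong r M x z (v @ u) (v' @ u')"
proof -
  have "coset_cong r M x z (v @ u) (v' @ u)"
    using assms by (intro coset_cong_right) (auto simp: coset_cong_def)
  also have "coset_cong r M x z (v' @ u) (v' @ u')"
    using assms by (intro coset_cong_left) (auto simp: coset_cong_def)
  finally show ?thesis .
qed

lemma coset_cong_inverse:
  assumes "coset_cong r M a b u v" "walk b u' a" "walk b v' a" "hom a a (v' @ v) []" "hom b b (u @ u') []"
  shows "coset_cong r M b a u' v'"
proof -
  have "coset_cong r M b a ([] @ u') ((v' @ v) @ u')"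
    by (rule coset_cong_hom[OF hom_right[OF hom_sym[OF assms(4)] assms(2)]])
  also have "coset_cong r M b a ((v' @ v) @ u') (v' @ u @ u')"
    using coset_cong_left[OF coset_cong_right[OF coset_cong_sym[OF assms(1)] assms(2)] assms(3)] by simp
  also have "coset_cong r M b a (v' @ u @ u') (v' @ [])"
    by (rule coset_cong_hom[OF hom_left[OF assms(5,3)]])
  finally show ?thesis by simp
qed

text \<open>At trivial \<open>\<gamma>\<close> and \<open>\<delta>\<close> the congruence says that
  the coset of \<open>w\<close> is \<open>M\<close> itself.\<close>

lemma coset_cong_closed:
  assumes "coset_cong r M r r w []" "subgroup M (wgroup r)"
  shows "cl r w \<in> M"
proof -
  have r: "walk r [] r" "walk r w r" using assms by (auto simp: coset_cong_def)
  interpret group "wgroup r" using group_wgroup r by simp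
  interpret M: subgroup M "wgroup r" by fact
  have "cl r ([] @ w @ []) <#\<^bsub>wgroup r\<^esub> M = cl r ([] @ [] @ []) <#\<^bsub>wgroup r\<^esub> M"
    using assms(1) r(1) unfolding coset_cong_def by blast
  then have "cl r w <#\<^bsub>wgroup r\<^esub> M = \<one>\<^bsub>wgroup r\<^esub> <#\<^bsub>wgroup r\<^esub> M"
    by (simp add: one_wgroup)
  also have "\<dots> = M" by (rule lcos_mult_one[OF M.subset])
  finally have eq: "cl r w <#\<^bsub>wgroup r\<^esub> M = M" .
  have "cl r w \<otimes>\<^bsub>wgroup r\<^esub> \<one>\<^bsub>wgroup r\<^esub> \<in> cl r w <#\<^bsub>wgroup r\<^esub> M"
    unfolding l_coset_def by (rule UN_I[OF M.one_closed]) simp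
  then have "cl r w \<otimes>\<^bsub>wgroup r\<^esub> \<one>\<^bsub>wgroup r\<^esub> \<in> M" unfolding eq .
  then show ?thesis unfolding r_one[OF cl_in_carrier[OF r(2)]] .
qed

text \<open>Right multiplication of the class of \<open>\<delta> @ u @ \<gamma>\<close> by that of
  \<open>\<gamma>' @ u' @ v @ \<gamma>\<close> gives the class of
  \<open>\<delta> @ v @ \<gamma>\<close>. The second factor lies in \<open>M\<close>, so the left
  coset does not change.\<close>

lemma coset_cong_relator:
  assumes "walk y u z" "walk y v z" "walk z u' y" "hom z z (u @ u') []"
    and M: "subgroup M (wgroup r)"
    and rel: "\<And>\<gamma>. walk r \<gamma> y \<Longrightarrow>
      \<exists>\<gamma>'. walk y \<gamma>' r \<and> hom y y (\<gamma> @ \<gamma>') [] \<and> cl r (\<gamma>' @ u' @ v @ \<gamma>) \<in> M"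
  shows "coset_cong r M y z u v"
  unfolding coset_cong_def
proof (intro conjI allI impI)
  fix \<gamma> \<delta> assume g: "walk r \<gamma> y" and d: "walk z \<delta> r"
  have r: "walk r [] r" using walk_source g by blast
  interpret group "wgroup r" using group_wgroup[OF r] .
  interpret M: subgroup M "wgroup r" by fact
  obtain \<gamma>' where g': "walk y \<gamma>' r" "hom y y (\<gamma> @ \<gamma>') []"
    and m: "cl r (\<gamma>' @ u' @ v @ \<gamma>) \<in> M" using rel[OF g] by blast
  have w: "walk r (\<delta> @ u @ \<gamma>) r" "walk r (\<gamma>' @ u' @ v @ \<gamma>) r" "walk r (v @ \<gamma>) z"
    "walk r (u' @ v @ \<gamma>) y" "walk y (\<delta> @ u) r"
    using walk_append[OF walk_append[OF g assms(1)] d] walk_append[OF g assms(2)] walk_append[OF assms(1) d]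
      walk_append[OF walk_append[OF walk_append[OF g assms(2)] assms(3)] g'(1)]
      walk_append[OF walk_append[OF g assms(2)] assms(3)] by simp_all
  have "hom r r ((\<delta> @ u) @ (\<gamma> @ \<gamma>') @ (u' @ v @ \<gamma>)) ((\<delta> @ u) @ (u' @ v @ \<gamma>))"
    by (rule hom_cancel_middle[OF g'(2) w(4,5)])
  also have "hom r r ((\<delta> @ u) @ (u' @ v @ \<gamma>)) (\<delta> @ v @ \<gamma>)"
    using hom_cancel_middle[OF assms(4) w(3) d] by simp
  finally have "cl r (\<delta> @ u @ \<gamma>) \<otimes>\<^bsub>wgroup r\<^esub> cl r (\<gamma>' @ u' @ v @ \<gamma>) = cl r (\<delta> @ v @ \<gamma>)"
    using w by (simp add: mult_cl cl_eqI)
  then have "cl r (\<delta> @ v @ \<gamma>) <#\<^bsub>wgroup r\<^esub> M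
      = cl r (\<delta> @ u @ \<gamma>) <#\<^bsub>wgroup r\<^esub> (cl r (\<gamma>' @ u' @ v @ \<gamma>) <#\<^bsub>wgroup r\<^esub> M)"
    using w by (metis cl_in_carrier lcos_m_assoc M.subset)
  also have "cl r (\<gamma>' @ u' @ v @ \<gamma>) <#\<^bsub>wgroup r\<^esub> M = M"
    using coset_join3[OF _ M m] w cl_in_carrier by blast
  finally show "cl r (\<delta> @ u @ \<gamma>) <#\<^bsub>wgroup r\<^esub> M = cl r (\<delta> @ v @ \<gamma>) <#\<^bsub>wgroup r\<^esub> M"
    by simp
qed (use assms in auto)

end

text \<open>The first isomorphism theorem, with the kernel squeezed from both sides:
  \<open>S\<close> has trivial image, and every normal \<open>M\<close> containing \<open>S\<close>
  contains the kernel. The second condition speaks of an arbitrary \<open>M\<close> because the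
  normal closure is an intersection of such subgroups.\<close>

lemma iso_quotient_normal_closure:
  assumes A: "walk_groupoid W H" and B: "walk_groupoid W' H'"
    and x: "W x [] x" and e: "W' e [] e"
    and F_walk: "\<And>u. W x u x \<Longrightarrow> W' e (F u) e"
    and F_hom: "\<And>u v. H x x u v \<Longrightarrow> H' e e (F u) (F v)"
    and F_append: "\<And>u v. \<lbrakk>W x u x; W x v x\<rbrakk> \<Longrightarrow> H' e e (F (u @ v)) (F u @ F v)"
    and F_surj: "\<And>v. W' e v e \<Longrightarrow> \<exists>u. W x u x \<and> H' e e (F u) v"
    and S: "S \<subseteq> {walk_groupoid.cl H x w | w. W x w x \<and> H' e e (F w) []}"
    and kernel: "\<And>M w. \<lbrakk>M \<lhd> walk_groupoid.wgroup W H x; S \<subseteq> M; W x w x; H' e e (F w) []\<rbrakk>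
      \<Longrightarrow> walk_groupoid.cl H x w \<in> M"
  shows "walk_groupoid.wgroup W' H' e \<cong>
    walk_groupoid.wgroup W H x Mod normal_closure (walk_groupoid.wgroup W H x) S"
proof -
  interpret A: walk_groupoid W H by fact
  interpret B: walk_groupoid W' H' by fact
  interpret GA: group "A.wgroup x" by (rule A.group_wgroup[OF x])
  interpret GB: group "B.wgroup e" by (rule B.group_wgroup[OF e])
  \<comment> \<open>All members of a class have homotopic images, so the union collapses to one
    class and no representative has to be chosen.\<close>
  define h where "h X = (\<Union>u\<in>X. B.cl e (F u))" for X
  have h: "h (A.cl x u) = B.cl e (F u)" if "W x u x" for u
  proof -
    have "u \<in> A.cl x u" using that by (simp add: A.mem_cl A.hom_refl)
    moreover have "B.cl e (F u') = B.cl e (F u)" if "u' \<in> A.cl x u" for u'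
      using that by (auto simp: A.mem_cl intro!: B.cl_eqI F_hom intro: A.hom_sym)
    ultimately show ?thesis unfolding h_def by blast
  qed
  interpret h: group_hom "A.wgroup x" "B.wgroup e" h
  proof (unfold_locales, rule homI)
    fix X assume "X \<in> carrier (A.wgroup x)"
    then show "h X \<in> carrier (B.wgroup e)"
      by (auto simp: A.carrier_wgroup h B.cl_in_carrier F_walk)
  next
    fix X Y assume "X \<in> carrier (A.wgroup x)" "Y \<in> carrier (A.wgroup x)"
    then obtain u v where uv: "W x u x" "X = A.cl x u" "W x v x" "Y = A.cl x v"
      by (auto simp: A.carrier_wgroup)
    show "h (X \<otimes>\<^bsub>A.wgroup x\<^esub> Y) = h X \<otimes>\<^bsub>B.wgroup e\<^esub> h Y"
      using uv B.cl_eqI[OF F_append[OF uv(1,3)]] A.walk_append[OF uv(3,1)]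
      by (simp add: h F_walk A.mult_cl B.mult_cl)
  qed
  have surj: "h ` carrier (A.wgroup x) = carrier (B.wgroup e)"
  proof (intro equalityI subsetI)
    fix Y assume "Y \<in> carrier (B.wgroup e)"
    then obtain v where v: "W' e v e" "Y = B.cl e v" by (auto simp: B.carrier_wgroup)
    obtain u where u: "W x u x" "H' e e (F u) v" using F_surj[OF v(1)] by blast
    then show "Y \<in> h ` carrier (A.wgroup x)"
      using v by (metis A.cl_in_carrier B.cl_eqI h imageI)
  qed (auto simp: h.hom_closed)
  have ker: "kernel (A.wgroup x) (B.wgroup e) h = {A.cl x w | w. W x w x \<and> H' e e (F w) []}"
  proof -
    have "h X = \<one>\<^bsub>B.wgroup e\<^esub> \<longleftrightarrow> H' e e (F w) []" if "W x w x" "X = A.cl x w" for X w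
      unfolding B.one_wgroup that(2) h[OF that(1)] by (rule B.cl_eq_iff[OF F_walk[OF that(1)]])
    then show ?thesis
      unfolding kernel_def A.carrier_wgroup by blast
  qed
  have normal_closure: "normal_closure (A.wgroup x) S = kernel (A.wgroup x) (B.wgroup e) h"
    unfolding normal_closure_def
  proof (intro equalityI subsetI InterI)
    fix X assume "X \<in> \<Inter> {K. K \<lhd> A.wgroup x \<and> S \<subseteq> K}"
    then show "X \<in> kernel (A.wgroup x) (B.wgroup e) h"
      using h.normal_kernel S ker by auto
  next
    fix X M assume "X \<in> kernel (A.wgroup x) (B.wgroup e) h" "M \<in> {K. K \<lhd> A.wgroup x \<and> S \<subseteq> K}"
    then show "X \<in> M" using kernel ker by auto
  qed
  have "A.wgroup x Mod normal_closure (A.wgroup x) S \<cong> B.wgroup e"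
    using h.FactGroup_iso[OF surj] normal_closure by simp
  moreover have "group (A.wgroup x Mod normal_closure (A.wgroup x) S)"
    using h.normal_kernel normal_closure by (simp add: normal.factorgroup_is_group)
  ultimately show ?thesis by (rule group.iso_sym[rotated])
qed

section \<open>Paths and ideals of path categories\<close>

lemma qpath_append: "qpath Q x (u @ v) z \<longleftrightarrow> (\<exists>y. qpath Q x v y \<and> qpath Q y u z)"
  if "wf_digraph Q"
  using that
proof (induction u arbitrary: z)
  case Nil
  have "z \<in> verts Q" if "qpath Q x v z"
    using that Nil by (cases v) (auto simp: wf_digraph_def)
  then show ?case by auto
qed auto

lemma qpath_source: "qpath Q x u y \<Longrightarrow> x \<in> verts Q"
  by (induction Q x u y rule: qpath.induct) auto

lemma qpath_target: "\<lbrakk>wf_digraph Q; qpath Q x u y\<rbrakk> \<Longrightarrow> y \<in> verts Q"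
  by (cases u) (auto simp: wf_digraph_def)

text \<open>A linear functional used as a certificate: with \<open>C\<close> a congruence class of
  nonzero paths, a nonzero value shows that \<open>f\<close> is not in the ideal.\<close>

definition coeff_sum :: "'p set \<Rightarrow> ('p \<Rightarrow>\<^sub>0 'k::field) \<Rightarrow> 'k" where
  "coeff_sum C f = (\<Sum>p\<in>Poly_Mapping.keys f. if p \<in> C then Poly_Mapping.lookup f p else 0)"

lemma coeff_sum_superset:
  assumes "finite A" "Poly_Mapping.keys f \<subseteq> A"
  shows "coeff_sum C f = (\<Sum>p\<in>A. if p \<in> C then Poly_Mapping.lookup f p else 0)"
  unfolding coeff_sum_def
  by (intro sum.mono_neutral_left) (use assms in \<open>auto simp: in_keys_iff\<close>)

lemma coeff_sum_zero [simp]: "coeff_sum C 0 = 0"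
  by (simp add: coeff_sum_def)

lemma coeff_sum_add: "coeff_sum C (f + h) = coeff_sum C f + coeff_sum C h"
proof -
  let ?A = "Poly_Mapping.keys f \<union> Poly_Mapping.keys h"
  have "Poly_Mapping.keys (f + h) \<subseteq> ?A" by (rule keys_add)
  then show ?thesis
    by (auto simp: coeff_sum_superset[of ?A] lookup_add sum.distrib[symmetric] intro: sum.cong)
qed

lemma coeff_sum_uminus: "coeff_sum C (- f) = - coeff_sum C f"
  using coeff_sum_add[of C f "- f"] by (simp add: eq_neg_iff_add_eq_0 add.commute)

lemma coeff_sum_diff: "coeff_sum C (f - h) = coeff_sum C f - coeff_sum C h"
  using coeff_sum_add[of C f "- h"] by (simp add: coeff_sum_uminus)

lemma coeff_sum_single [simp]: "coeff_sum C (Poly_Mapping.single p c) = (if p \<in> C then c else 0)"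
  by (subst coeff_sum_superset[of "{p}"]) (auto simp: lookup_single)

lemma coeff_sum_sum: "coeff_sum C (\<Sum>i\<in>A. f i) = (\<Sum>i\<in>A. coeff_sum C (f i))"
  by (induction A rule: infinite_finite_induct) (auto simp: coeff_sum_add)

text \<open>Composition is moved from \<open>f\<close> to \<open>C\<close>: the functional of
  \<open>C\<close> becomes a combination of functionals of the sets
  \<open>{v. u @ v \<in> C}\<close>. This drives the induction over the generated ideal.\<close>

lemma coeff_sum_kcomp_left:
  "coeff_sum C (kcomp h f)
    = (\<Sum>u\<in>Poly_Mapping.keys h. Poly_Mapping.lookup h u * coeff_sum {v. u @ v \<in> C} f)"
  unfolding kcomp_def coeff_sum_sum
  by (auto simp: coeff_sum_def sum_distrib_left intro!: sum.cong)

lemma coeff_sum_kcomp_right: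
  "coeff_sum C (kcomp f h)
    = (\<Sum>v\<in>Poly_Mapping.keys h. Poly_Mapping.lookup h v * coeff_sum {u. u @ v \<in> C} f)"
  unfolding kcomp_def coeff_sum_sum
  by (subst sum.swap) (auto simp: coeff_sum_def sum_distrib_left mult.commute intro!: sum.cong)

lemma kcomp_superset:
  assumes "finite A" "Poly_Mapping.keys f \<subseteq> A" "finite B" "Poly_Mapping.keys h \<subseteq> B"
  shows "kcomp f h = (\<Sum>u\<in>A. \<Sum>v\<in>B.
    Poly_Mapping.single (u @ v) (Poly_Mapping.lookup f u * Poly_Mapping.lookup h v))"
proof -
  have "kcomp f h = (\<Sum>u\<in>Poly_Mapping.keys f. \<Sum>v\<in>B.
    Poly_Mapping.single (u @ v) (Poly_Mapping.lookup f u * Poly_Mapping.lookup h v))"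
    unfolding kcomp_def
    by (intro sum.cong refl sum.mono_neutral_left) (use assms in \<open>auto simp: in_keys_iff\<close>)
  also have "\<dots> = (\<Sum>u\<in>A. \<Sum>v\<in>B.
    Poly_Mapping.single (u @ v) (Poly_Mapping.lookup f u * Poly_Mapping.lookup h v))"
    by (intro sum.mono_neutral_left) (use assms in \<open>auto simp: in_keys_iff\<close>)
  finally show ?thesis .
qed

lemma kcomp_single:
  "kcomp (Poly_Mapping.single u c) (Poly_Mapping.single v d) = Poly_Mapping.single (u @ v) (c * d)"
  by (subst kcomp_superset[of "{u}" _ "{v}"]) (auto simp: lookup_single)

lemma kcomp_diff_left: "kcomp (f - g) h = kcomp f h - kcomp g h"
proof -
  let ?A = "Poly_Mapping.keys f \<union> Poly_Mapping.keys g" and ?B = "Poly_Mapping.keys h"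
  have "Poly_Mapping.keys (f - g) \<subseteq> ?A" by (rule keys_diff)
  then show ?thesis
    by (simp add: kcomp_superset[of ?A _ ?B] lookup_minus sum_subtractf[symmetric]
        single_diff[symmetric] left_diff_distrib)
qed

lemma kcomp_diff_right: "kcomp h (f - g) = kcomp h f - kcomp h g"
proof -
  let ?A = "Poly_Mapping.keys f \<union> Poly_Mapping.keys g" and ?B = "Poly_Mapping.keys h"
  have "Poly_Mapping.keys (f - g) \<subseteq> ?A" by (rule keys_diff)
  then show ?thesis
    by (simp add: kcomp_superset[of ?B _ ?A] lookup_minus sum_subtractf[symmetric]
        single_diff[symmetric] right_diff_distrib)
qed

lemma single_in_khom: "qpath Q x u y \<Longrightarrow> Poly_Mapping.single u c \<in> khom Q x y"
  by (auto simp: khom_def)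

lemma in_gen_ideal_khom:
  assumes Q: "wf_digraph Q" and S: "\<And>x y f. S x y f \<Longrightarrow> f \<in> khom Q x y"
    and "in_gen_ideal Q S x y f"
  shows "f \<in> khom Q x y"
proof -
  have kcomp: "kcomp h f \<in> khom Q x z" if "f \<in> khom Q x y" "h \<in> khom Q y z" for x y z
    and f h :: "'b list \<Rightarrow>\<^sub>0 'c"
  proof -
    have "qpath Q x p z" if p: "p \<in> Poly_Mapping.keys (kcomp h f)" for p
    proof -
      obtain u where u: "u \<in> Poly_Mapping.keys h" "p \<in> Poly_Mapping.keys (\<Sum>v\<in>Poly_Mapping.keys f.
          Poly_Mapping.single (u @ v) (Poly_Mapping.lookup h u * Poly_Mapping.lookup f v))"
        using subsetD[OF keys_sum p[unfolded kcomp_def]] by blast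
      then obtain v where "v \<in> Poly_Mapping.keys f"
        "p \<in> Poly_Mapping.keys (Poly_Mapping.single (u @ v) (Poly_Mapping.lookup h u * Poly_Mapping.lookup f v))"
        using subsetD[OF keys_sum u(2)] by blast
      then show ?thesis
        using u \<open>f \<in> _\<close> \<open>h \<in> _\<close> by (auto simp: khom_def qpath_append[OF Q] split: if_splits)
    qed
    then show ?thesis by (auto simp: khom_def)
  qed
  from assms(3) show ?thesis
  proof induction
    case (add x y f h)
    then show ?case using keys_add[of f h] by (auto simp: khom_def)
  qed (auto simp: S kcomp, auto simp: khom_def)
qed

text \<open>The support has only the two singletons as nonempty proper subsets; the coefficient
  \<open>- 1\<close> is the one that \<open>v\<close> has in the difference.\<close>

lemma minimal_relation_single_diff:
  assumes "Poly_Mapping.single u 1 - Poly_Mapping.single v (1 :: 'k::field) \<in> I x y" "u \<noteq> v"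
    and "Poly_Mapping.single u (1::'k) \<notin> I x y" "Poly_Mapping.single v (- 1 :: 'k) \<notin> I x y"
  shows "minimal_relation I x y (Poly_Mapping.single u 1 - Poly_Mapping.single v (1 :: 'k))"
    and "Poly_Mapping.keys (Poly_Mapping.single u 1 - Poly_Mapping.single v (1 :: 'k)) = {u, v}"
proof -
  let ?\<rho> = "Poly_Mapping.single u 1 - Poly_Mapping.single v (1 :: 'k)"
  have lookup: "Poly_Mapping.lookup ?\<rho> w = (if w = u then 1 else if w = v then - 1 else 0)" for w
    using \<open>u \<noteq> v\<close> by (auto simp: lookup_minus lookup_single when_def)
  then show keys: "Poly_Mapping.keys ?\<rho> = {u, v}"
    by (auto simp: in_keys_iff split: if_splits)
  have "kpart K ?\<rho> \<notin> I x y" if "K \<noteq> {}" "K \<subset> {u, v}" for K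
  proof -
    from that consider "K = {u}" | "K = {v}" by blast
    then show ?thesis
      using assms(3,4) \<open>u \<noteq> v\<close> by cases (simp_all add: kpart_def lookup)
  qed
  then show "minimal_relation I x y ?\<rho>"
    using assms(1) \<open>u \<noteq> v\<close> by (simp add: minimal_relation_def keys)
qed

section \<open>Walks in quivers\<close>

lemma qwalk_append: "qwalk Q x (u @ v) z \<longleftrightarrow> (\<exists>y. qwalk Q x v y \<and> qwalk Q y u z)"
  if "wf_digraph Q"
proof (induction u arbitrary: z)
  case Nil
  have "z \<in> verts Q" if "qwalk Q x v z"
    using that \<open>wf_digraph Q\<close> by (induction Q x v z rule: qwalk.induct) (auto simp: wf_digraph_def)
  then show ?case by auto
next
  case (Cons a u)
  then show ?case by (cases a) auto
qed

lemma qwalk_source: "qwalk Q x u y \<Longrightarrow> x \<in> verts Q"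
  by (induction Q x u y rule: qwalk.induct) auto

lemma qwalk_Arr: "qwalk Q x (map Arr u) y \<longleftrightarrow> qpath Q x u y"
  by (induction Q x u y rule: qpath.induct) auto

lemma inv_walk_simps [simp]:
  "inv_walk [] = []" "inv_walk (a # w) = inv_walk w @ [inv_letter a]"
  "inv_walk (u @ v) = inv_walk v @ inv_walk u"
  by (simp_all add: inv_walk_def)

lemma inv_walk_inv_walk [simp]: "inv_walk (inv_walk w) = w"
proof -
  have "inv_letter (inv_letter a) = a" for a :: "'a letter" by (cases a) auto
  then show ?thesis by (simp add: inv_walk_def rev_map comp_def)
qed

lemma qwalk_inv_walk: "\<lbrakk>wf_digraph Q; qwalk Q x w y\<rbrakk> \<Longrightarrow> qwalk Q y (inv_walk w) x"
  by (induction Q x w y rule: qwalk.induct)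
    (auto simp: qwalk_append wf_digraph_def)

lemma qhomotopic_qwalk:
  assumes Q: "wf_digraph Q" and "qhomotopic Q x y u v"
  shows "qwalk Q x u y \<and> qwalk Q x v y"
  using assms(2) by induction (use Q in \<open>auto simp: qwalk_append wf_digraph_def\<close>)

lemma qhomotopic_inv_walk:
  assumes Q: "wf_digraph Q" and "qwalk Q x w y"
  shows "qhomotopic Q x x (inv_walk w @ w) []"
  using assms(2)
proof (induction w arbitrary: y)
  case (Cons a w)
  then obtain z where z: "qwalk Q z [a] y" "qwalk Q x w z"
    using qwalk_append[OF Q, of x "[a]" w y] by auto
  have "qhomotopic Q z z [inv_letter a, a] []"
    using z(1) by (cases a) (auto intro: qhomotopic.intros)
  then have "qhomotopic Q x x (inv_walk w @ [inv_letter a, a] @ w) (inv_walk w @ [] @ w)"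
    using z(2) qwalk_inv_walk[OF Q z(2)]
    by (intro qhomotopic.comp_left[OF qhomotopic.comp_right])
  then show ?case
    using Cons.IH[OF z(2)] by (auto intro: qhomotopic.trans)
qed (auto intro: qhomotopic.intros)

lemma walk_groupoid_quiver:
  assumes Q: "wf_digraph Q"
  shows "walk_groupoid (qwalk Q) (qhomotopic Q)"
proof
  show "\<exists>w'. qwalk Q b w' a \<and> qhomotopic Q a a (w' @ w) [] \<and> qhomotopic Q b b (w @ w') []"
    if "qwalk Q a w b" for a w b
    using qwalk_inv_walk[OF Q that] qhomotopic_inv_walk[OF Q that]
      qhomotopic_inv_walk[OF Q qwalk_inv_walk[OF Q that]] by auto
qed (use Q in \<open>auto simp: qwalk_append intro: qhomotopic.intros
    dest: qwalk_source qhomotopic_qwalk\<close>)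

lemma quiver_group_eq:
  assumes Q: "wf_digraph Q"
  shows "quiver_group Q = walk_groupoid.wgroup (qwalk Q) (qhomotopic Q)"
    and "Collect (qhomotopic Q x x w) = walk_groupoid.cl (qhomotopic Q) x w"
proof -
  interpret walk_groupoid "qwalk Q" "qhomotopic Q" by (rule walk_groupoid_quiver[OF Q])
  show "quiver_group Q = wgroup"
    by (auto simp: quiver_group_def wgroup_def cl_def)
  show "Collect (qhomotopic Q x x w) = cl x w" by (simp add: cl_def)
qed

section \<open>Standard sequences\<close>

lemma part_class_eq:
  assumes "partition_on A \<P>" "X \<in> \<P>" "e \<in> X"
  shows "part_class \<P> e = X"
  unfolding part_class_def
proof (rule the_equality)
  fix Y assume "Y \<in> \<P> \<and> e \<in> Y"
  then show "Y = X"
    using assms partition_onD2[OF assms(1)] by (auto dest: disjointD)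
qed (use assms in blast)

lemma part_class_mem:
  assumes "partition_on A \<P>" "e \<in> A"
  shows "part_class \<P> e \<in> \<P>" "e \<in> part_class \<P> e"
proof -
  obtain X where X: "X \<in> \<P>" "e \<in> X"
    using assms partition_onD1 by blast
  then show "part_class \<P> e \<in> \<P>" "e \<in> part_class \<P> e"
    using part_class_eq[OF assms(1)] by auto
qed

lemma Lseq_0 [simp]: "Lseq E e 0 = []"
  by (simp add: Lseq_def)

lemma Lseq_Suc: "Lseq E e (Suc n) = Lc E (act E (int n) e) # Lseq E e n"
  by (simp add: Lseq_def)

lemma length_Lseq [simp]: "length (Lseq E e n) = n"
  by (simp add: Lseq_def)

lemma Lseq_eq_iff:
  "Lseq E e n = Lseq E h m \<longleftrightarrow> n = m \<and> (\<forall>i<n. Lc E (act E (int i) e) = Lc E (act E (int i) h))"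
proof -
  have "n = m" if "Lseq E e n = Lseq E h m" using that by (metis length_Lseq)
  then show ?thesis by (auto simp: Lseq_def rev_map)
qed

section \<open>The action, the classes and paths of standard sequences\<close>

context fbc
begin

lemma act_closed [simp]: "e \<in> elts E \<Longrightarrow> act E n e \<in> elts E"
  using element_image by simp

lemma act_zero [simp]: "e \<in> elts E \<Longrightarrow> act E 0 e = e"
  using id_eq_one by (metis one_integer_group restrict_apply')

lemma act_act [simp]: "e \<in> elts E \<Longrightarrow> act E m (act E n e) = act E (m + n) e"
  using composition_rule[of e m n] by simp

lemma deg_act [simp]: "e \<in> elts E \<Longrightarrow> deg E (act E n e) = deg E e"
  using f3[of e "act E n e"] by (force simp: orbit_def)

lemma Pc_mem: "e \<in> elts E \<Longrightarrow> Pc E e \<in> Ppart E" "e \<in> elts E \<Longrightarrow> e \<in> Pc E e"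
  unfolding Pc_def using part_class_mem[OF P_partition] by auto

lemma Lc_mem: "e \<in> elts E \<Longrightarrow> Lc E e \<in> Lpart E" "e \<in> elts E \<Longrightarrow> e \<in> Lc E e"
  unfolding Lc_def using part_class_mem[OF L_partition] by auto

lemma Pc_eq: "\<lbrakk>X \<in> Ppart E; e \<in> X\<rbrakk> \<Longrightarrow> Pc E e = X"
  unfolding Pc_def using part_class_eq[OF P_partition] .

lemma Lc_eq: "\<lbrakk>X \<in> Lpart E; e \<in> X\<rbrakk> \<Longrightarrow> Lc E e = X"
  unfolding Lc_def using part_class_eq[OF L_partition] .

lemma Ppart_elts: "\<lbrakk>X \<in> Ppart E; e \<in> X\<rbrakk> \<Longrightarrow> e \<in> elts E"
  using partition_onD1[OF P_partition] by auto

lemma Lpart_elts: "\<lbrakk>X \<in> Lpart E; e \<in> X\<rbrakk> \<Longrightarrow> e \<in> elts E"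
  using partition_onD1[OF L_partition] by auto

lemma Ppart_nonempty: "X \<in> Ppart E \<Longrightarrow> \<exists>e. e \<in> X"
  using partition_onD3[OF P_partition] by (metis ex_in_conv)

lemma Lpart_nonempty: "X \<in> Lpart E \<Longrightarrow> \<exists>e. e \<in> X"
  using partition_onD3[OF L_partition] by (metis ex_in_conv)

lemma Pc_eq_if_Lc_eq: "\<lbrakk>e \<in> elts E; h \<in> elts E; Lc E e = Lc E h\<rbrakk> \<Longrightarrow> Pc E e = Pc E h"
  using Lc_mem(2)[of e] f1[of h] Pc_mem(1)[of h] Pc_eq[of "Pc E h" e] by auto

lemma fbc_quiver_simps [simp]: "verts (fbc_quiver E) = Ppart E" "arcs (fbc_quiver E) = Lpart E"
  by (simp_all add: fbc_quiver_def)

lemma tail_Lc [simp]: "e \<in> elts E \<Longrightarrow> tail (fbc_quiver E) (Lc E e) = Pc E e"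
  unfolding fbc_quiver_def
  by (auto intro!: the_equality)
    (metis Lc_eq Lc_mem Lpart_elts Pc_eq_if_Lc_eq)+

lemma head_Lc [simp]: "e \<in> elts E \<Longrightarrow> head (fbc_quiver E) (Lc E e) = Pc E (act E 1 e)"
  unfolding fbc_quiver_def
  by (auto intro!: the_equality)
    (metis Lc_eq Lc_mem Lpart_elts f2)+

lemma Lpart_cases:
  assumes "l \<in> Lpart E"
  obtains e where "e \<in> elts E" "l = Lc E e"
  using assms Lc_eq Lpart_elts Lpart_nonempty by metis

lemma wf_fbc_quiver: "wf_digraph (fbc_quiver E)"
  by (unfold_locales) (auto elim!: Lpart_cases simp: Pc_mem)

lemma Lseq_add: "e \<in> elts E \<Longrightarrow> Lseq E e (m + n) = Lseq E (act E (int n) e) m @ Lseq E e n"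
  by (induction m) (auto simp: Lseq_Suc)

lemma Lseq_append_split:
  assumes "e \<in> elts E" "Lseq E e n = a @ b"
  shows "b = Lseq E e (length b)" "a = Lseq E (act E (int (length b)) e) (length a)"
    "n = length a + length b"
proof -
  show n: "n = length a + length b"
    using arg_cong[OF assms(2), of length] by simp
  have "Lseq E (act E (int (length b)) e) (length a) @ Lseq E e (length b) = a @ b"
    using assms Lseq_add[of e "length a" "length b"] n by simp
  then show "b = Lseq E e (length b)" "a = Lseq E (act E (int (length b)) e) (length a)"
    by (auto simp: append_eq_append_conv)
qed

lemma qpath_Lseq:
  "e \<in> elts E \<Longrightarrow> qpath (fbc_quiver E) (Pc E e) (Lseq E e n) (Pc E (act E (int n) e))"
  by (induction n) (auto simp: Lseq_Suc Pc_mem Lc_mem ac_simps)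

lemma qpath_Lseq_target:
  "\<lbrakk>e \<in> elts E; qpath (fbc_quiver E) x (Lseq E e n) y; x = Pc E e\<rbrakk> \<Longrightarrow> y = Pc E (act E (int n) e)"
  by (cases n) (auto simp: Lseq_Suc ac_simps)

text \<open>Shifting each element by its own degree preserves and reflects \<open>P\<close>- and
  \<open>L\<close>-classes, by (f4) and (f5). The degree is constant on orbits, so the shift
  commutes with the action and (f5) applies to each term.\<close>

lemma Lpath_shift:
  assumes "e \<in> elts E" "h \<in> elts E"
  shows "Lpath E (act E (int (deg E e)) e, n) = Lpath E (act E (int (deg E h)) h, m)
    \<longleftrightarrow> Lpath E (e, n) = Lpath E (h, m)"
proof -
  have "Lc E (act E (int i) (act E (int (deg E e)) e)) = Lc E (act E (int i) (act E (int (deg E h)) h))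
      \<longleftrightarrow> Lc E (act E (int i) e) = Lc E (act E (int i) h)" for i
    using f5[of "act E (int i) e" "act E (int i) h"] assms by (simp add: add.commute)
  moreover have "Pc E (act E (int (deg E e)) e) = Pc E (act E (int (deg E h)) h) \<longleftrightarrow> Pc E e = Pc E h"
    by (rule f4[OF assms, symmetric])
  ultimately show ?thesis
    unfolding Lpath.simps prod.inject Lseq_eq_iff by simp
qed

text \<open>A nontrivial path determines its target by its last arrow, a trivial one by its
  source.\<close>

lemma Pc_target_eq:
  assumes "e \<in> elts E" "h \<in> elts E" "Lpath E (e, n) = Lpath E (h, m)"
  shows "Pc E (act E (int n) e) = Pc E (act E (int m) h)"
proof -
  have "qpath (fbc_quiver E) (Pc E e) (Lseq E h m) (Pc E (act E (int n) e))"
    using qpath_Lseq[OF assms(1), of n] assms(3) by simp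
  then show ?thesis
    by (rule qpath_Lseq_target[OF assms(2)]) (use assms(3) in simp)
qed

end

text \<open>By (f4) and (f5), the two alternatives in (f7) are equivalent.\<close>

lemma (in fs_bc) exchange:
  assumes "p \<in> std_seqs E" "q \<in> std_seqs E" "r \<in> std_seqs E"
    and "seq_equiv E p q" "seq_equiv E (lhat E r) (lhat E q)"
  shows "\<exists>s\<in>std_seqs E. seq_equiv E s r \<and> seq_equiv E (lhat E s) (lhat E p)"
proof -
  obtain e n e' n' h m where p: "p = (e, n)" and q: "q = (e', n')" and r: "r = (h, m)"
    by (metis surj_pair)
  have std: "e \<in> elts E" "n \<le> deg E e" "e' \<in> elts E" "n' \<le> deg E e'" "h \<in> elts E" "m \<le> deg E h"
    using assms(1-3) by (auto simp: std_seqs_def p q r)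
  from f7[OF assms(1,2,4)] show ?thesis
  proof
    assume eq: "seq_class E (rhat E ` seq_class E {lhat E p}) = seq_class E (rhat E ` seq_class E {lhat E q})"
    have "lhat E r \<in> seq_class E {lhat E q}"
      using assms(5) std by (auto simp: seq_class_def r std_seqs_def)
    \<comment> \<open>The two hats are mutually inverse on standard sequences; the witness below is
      likewise \<open>rhat E t\<close>, whose left hat is \<open>t\<close>.\<close>
    moreover have "rhat E (lhat E r) = r"
      using std by (simp add: r of_nat_diff)
    ultimately have "r \<in> seq_class E (rhat E ` seq_class E {lhat E q})"
      using assms(3) by (force simp: seq_class_def[of _ "rhat E ` _"] seq_equiv_def)
    then obtain t where t: "t \<in> std_seqs E" "seq_equiv E t (lhat E p)" "seq_equiv E r (rhat E t)"
      unfolding eq[symmetric] by (auto simp: seq_class_def)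
    obtain x k where x: "t = (x, k)" "x \<in> elts E" "k \<le> deg E x"
      using t(1) by (auto simp: std_seqs_def)
    have "rhat E t \<in> std_seqs E" "lhat E (rhat E t) = t"
      using x by (auto simp: std_seqs_def of_nat_diff)
    then show ?thesis
      using t by (intro bexI[of _ "rhat E t"]) (auto simp: seq_equiv_def)
  next
    assume eq: "seq_class E (lhat E ` seq_class E {rhat E p}) = seq_class E (lhat E ` seq_class E {rhat E q})"
    have shift: "lhat E (x, k) = (act E (int (deg E x)) (fst (rhat E (x, k))), snd (rhat E (x, k)))"
      "fst (rhat E (x, k)) \<in> elts E" "deg E (fst (rhat E (x, k))) = deg E x"
      if "x \<in> elts E" "k \<le> deg E x" for x k
      using that by (auto simp: of_nat_diff)
    \<comment> \<open>The left hat of a sequence is its right hat shifted by the degree, so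
      \<open>Lpath_shift\<close> converts the hypothesis on left hats into one on right
      hats.\<close>
    have "seq_equiv E (rhat E r) (rhat E q)"
      using assms(5) Lpath_shift[OF shift(2)[OF std(5,6)] shift(2)[OF std(3,4)],
          of "snd (rhat E r)" "snd (rhat E q)"]
      unfolding seq_equiv_def q r shift(1)[OF std(5,6)] shift(1)[OF std(3,4)]
        shift(3)[OF std(5,6)] shift(3)[OF std(3,4)] prod.collapse by blast
    moreover have "rhat E r \<in> std_seqs E" and lr: "lhat E (rhat E r) = r"
      using std by (auto simp: r std_seqs_def of_nat_diff)
    ultimately have "rhat E r \<in> seq_class E {rhat E q}"
      by (simp add: seq_class_def)
    then have "r \<in> seq_class E (lhat E ` seq_class E {rhat E q})"
      using assms(3) lr by (force simp: seq_class_def[of _ "lhat E ` _"] seq_equiv_def)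
    then obtain t where t: "t \<in> std_seqs E" "seq_equiv E t (rhat E p)" "seq_equiv E r (lhat E t)"
      unfolding eq[symmetric] by (auto simp: seq_class_def)
    obtain x k where x: "t = (x, k)" "x \<in> elts E" "k \<le> deg E x"
      using t(1) by (auto simp: std_seqs_def)
    have s: "lhat E t \<in> std_seqs E" "lhat E (lhat E t) = (act E (int (deg E x)) x, k)"
      using x by (auto simp: std_seqs_def of_nat_diff)
    have "seq_equiv E (lhat E (lhat E t)) (lhat E p)"
      using t(2) Lpath_shift[OF x(2) shift(2)[OF std(1,2)], of k "snd (rhat E p)"]
      unfolding seq_equiv_def p x(1) s(2)[unfolded x(1)] shift(1)[OF std(1,2)] shift(3)[OF std(1,2)] prod.collapse
      by blast
    then show ?thesis
      using t s(1) by (intro bexI[of _ "lhat E t"]) (auto simp: seq_equiv_def)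
  qed
qed

section \<open>The ideal of a fractional Brauer configuration\<close>

text \<open>The generators are split into pairs of paths and zero paths, so that congruence and
  vanishing become combinatorial notions independent of the field.\<close>

inductive fR1_pair :: "'e frac_conf \<Rightarrow> 'e set \<Rightarrow> 'e set \<Rightarrow> 'e set list \<Rightarrow> 'e set list \<Rightarrow> bool"
  for E :: "'e frac_conf" where
  "\<lbrakk>e \<in> elts E; h \<in> elts E; Pc E e = Pc E h; j \<le> deg E e; j \<le> deg E h;
    \<forall>i\<in>{1..j}. Lc E (act E (int (deg E e - i)) e) = Lc E (act E (int (deg E h - i)) h)\<rbrakk> \<Longrightarrow>
    fR1_pair E (Pc E e) (Pc E (act E (int (deg E e - j)) e))
      (Lseq E e (deg E e - j)) (Lseq E h (deg E h - j))"

inductive zero_path :: "'e frac_conf \<Rightarrow> 'e set \<Rightarrow> 'e set \<Rightarrow> 'e set list \<Rightarrow> bool"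
  for E :: "'e frac_conf" where
  "\<lbrakk>qpath (fbc_quiver E) x p y; length p > 1;
    (\<Inter>m<length p. act E (int m) ` (p ! m)) = {}\<rbrakk> \<Longrightarrow> zero_path E x y p"
| "\<lbrakk>e \<in> elts E; n > deg E e\<rbrakk> \<Longrightarrow> zero_path E (Pc E e) (Pc E (act E (int n) e)) (Lseq E e n)"

lemma fbc_rel_iff:
  "fbc_rel E x y f \<longleftrightarrow>
    (\<exists>p q. fR1_pair E x y p q \<and> f = Poly_Mapping.single p 1 - Poly_Mapping.single q 1)
    \<or> (\<exists>p. zero_path E x y p \<and> f = Poly_Mapping.single p 1)"
proof
  assume "fbc_rel E x y f"
  then show "(\<exists>p q. fR1_pair E x y p q \<and> f = Poly_Mapping.single p 1 - Poly_Mapping.single q 1)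
    \<or> (\<exists>p. zero_path E x y p \<and> f = Poly_Mapping.single p 1)"
    by cases (blast intro: fR1_pair.intros zero_path.intros)+
next
  have "fbc_rel E x y (Poly_Mapping.single p 1 - Poly_Mapping.single q 1)" if "fR1_pair E x y p q" for p q
    using that
  proof cases
    case (1 e h j)
    show ?thesis unfolding 1(1-4) by (rule fbc_rel.fR1) (use 1 in blast)+
  qed
  moreover have "fbc_rel E x y (Poly_Mapping.single p 1)" if "zero_path E x y p" for p
    using that by cases (auto intro!: fbc_rel.fR2 fbc_rel.fR3)
  ultimately show "(\<exists>p q. fR1_pair E x y p q \<and> f = Poly_Mapping.single p 1 - Poly_Mapping.single q 1)
    \<or> (\<exists>p. zero_path E x y p \<and> f = Poly_Mapping.single p 1) \<Longrightarrow> fbc_rel E x y f"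
    by blast
qed

text \<open>Endpoints are carried along because the empty list does not determine its vertex. Since
  (fR1) pairs are symmetric, the reflexive transitive closure \<open>path_cong\<close> is already
  symmetric.\<close>

definition pstep :: "'e frac_conf \<Rightarrow> 'e set \<Rightarrow> 'e set \<Rightarrow> 'e set list \<Rightarrow> 'e set list \<Rightarrow> bool" where
  "pstep E x y u v \<longleftrightarrow> (\<exists>a b p q x' y'. u = a @ p @ b \<and> v = a @ q @ b \<and> fR1_pair E x' y' p q \<and>
     qpath (fbc_quiver E) x b x' \<and> qpath (fbc_quiver E) y' a y)"

abbreviation path_cong :: "'e frac_conf \<Rightarrow> 'e set \<Rightarrow> 'e set \<Rightarrow> 'e set list \<Rightarrow> 'e set list \<Rightarrow> bool" where
  "path_cong E x y \<equiv> (pstep E x y)\<^sup>*\<^sup>*"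

definition zero_factor :: "'e frac_conf \<Rightarrow> 'e set \<Rightarrow> 'e set \<Rightarrow> 'e set list \<Rightarrow> bool" where
  "zero_factor E x y u \<longleftrightarrow> (\<exists>a b p x' y'. u = a @ p @ b \<and> zero_path E x' y' p \<and>
     qpath (fbc_quiver E) x b x' \<and> qpath (fbc_quiver E) y' a y)"

definition nonzero_path :: "'e frac_conf \<Rightarrow> 'e set \<Rightarrow> 'e set \<Rightarrow> 'e set list \<Rightarrow> bool" where
  "nonzero_path E x y u \<longleftrightarrow> (\<forall>v. path_cong E x y u v \<longrightarrow> \<not> zero_factor E x y v)"

section \<open>Congruent paths, zero factors and membership in the ideal\<close>

context fbc
begin

text \<open>The point is that both paths have the same target: for \<open>j = 0\<close> by (f4),
  otherwise because the arrows that follow them, those at \<open>i = j\<close>, coincide.\<close>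

lemma fR1_pair_sym:
  assumes "fR1_pair E x y p q"
  shows "fR1_pair E x y q p"
  using assms
proof cases
  case (1 e h j)
  have "Pc E (act E (int (deg E e - j)) e) = Pc E (act E (int (deg E h - j)) h)"
  proof (cases "j = 0")
    case True
    then show ?thesis using 1 f4[of e h] by simp
  next
    case False
    then show ?thesis using 1 by (intro Pc_eq_if_Lc_eq) auto
  qed
  then show ?thesis
    using 1 fR1_pair.intros[of h E e j] by simp
qed

lemma fR1_pair_qpath:
  assumes "fR1_pair E x y p q"
  shows "qpath (fbc_quiver E) x p y"
  using assms
proof cases
  case (1 e h j)
  show ?thesis unfolding 1(1-4) by (rule qpath_Lseq) (rule 1)
qed

lemma pstep_sym: "pstep E x y u v \<Longrightarrow> pstep E x y v u"
  unfolding pstep_def using fR1_pair_sym by blast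

lemma path_cong_sym: "path_cong E x y u v \<Longrightarrow> path_cong E x y v u"
  by (induction rule: rtranclp_induct) (auto intro: converse_rtranclp_into_rtranclp pstep_sym)

lemma pstep_qpath:
  assumes "pstep E x y u v"
  shows "qpath (fbc_quiver E) x v y"
proof -
  obtain a b p q x' y' where "v = a @ q @ b" "fR1_pair E x' y' p q"
    "qpath (fbc_quiver E) x b x'" "qpath (fbc_quiver E) y' a y"
    using assms unfolding pstep_def by blast
  moreover have "qpath (fbc_quiver E) x' q y'"
    by (rule fR1_pair_qpath[OF fR1_pair_sym]) fact
  ultimately show ?thesis
    by (auto simp: qpath_append[OF wf_fbc_quiver])
qed

lemma path_cong_qpath:
  "\<lbrakk>path_cong E x y u v; qpath (fbc_quiver E) x u y\<rbrakk> \<Longrightarrow> qpath (fbc_quiver E) x v y"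
  by (induction rule: rtranclp_induct) (auto intro: pstep_qpath)

lemma pstep_ends:
  assumes "pstep E x y u v"
  shows "qpath (fbc_quiver E) x [] x" "qpath (fbc_quiver E) y [] y"
  using assms qpath_source qpath_target[OF wf_fbc_quiver] unfolding pstep_def by fastforce+

lemma zero_factor_ends:
  assumes "zero_factor E x y u"
  shows "qpath (fbc_quiver E) x [] x" "qpath (fbc_quiver E) y [] y"
  using assms qpath_source qpath_target[OF wf_fbc_quiver] unfolding zero_factor_def by fastforce+

lemma fR1_pair_pstep:
  assumes "fR1_pair E x y p q"
  shows "pstep E x y p q"
proof -
  have "qpath (fbc_quiver E) x [] x" "qpath (fbc_quiver E) y [] y"
    using qpath_source[OF fR1_pair_qpath[OF assms]] qpath_target[OF wf_fbc_quiver fR1_pair_qpath[OF assms]]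
    by simp_all
  then show ?thesis
    using assms unfolding pstep_def by (metis append_Nil append_Nil2)
qed

lemma pstep_append:
  assumes "pstep E y z u v" "qpath (fbc_quiver E) x b y" "qpath (fbc_quiver E) z a w"
  shows "pstep E x w (a @ u @ b) (a @ v @ b)"
proof -
  obtain a' b' p q x' y' where *: "u = a' @ p @ b'" "v = a' @ q @ b'" "fR1_pair E x' y' p q"
    "qpath (fbc_quiver E) y b' x'" "qpath (fbc_quiver E) y' a' z"
    using assms(1) unfolding pstep_def by blast
  then show ?thesis
    unfolding pstep_def
    by (intro exI[of _ "a @ a'"] exI[of _ "b' @ b"] exI[of _ p] exI[of _ q] exI[of _ x'] exI[of _ y'])
      (use assms(2,3) in \<open>auto simp: qpath_append[OF wf_fbc_quiver]\<close>)
qed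

lemma path_cong_append:
  assumes "path_cong E y z u v" "qpath (fbc_quiver E) x b y" "qpath (fbc_quiver E) z a w"
  shows "path_cong E x w (a @ u @ b) (a @ v @ b)"
  using assms(1)
  by (induction rule: rtranclp_induct)
    (auto intro: rtranclp.rtrancl_into_rtrancl pstep_append[OF _ assms(2,3)])

lemma zero_factor_append:
  assumes "zero_factor E y z u" "qpath (fbc_quiver E) x b y" "qpath (fbc_quiver E) z a w"
  shows "zero_factor E x w (a @ u @ b)"
proof -
  obtain a' b' p x' y' where *: "u = a' @ p @ b'" "zero_path E x' y' p"
    "qpath (fbc_quiver E) y b' x'" "qpath (fbc_quiver E) y' a' z"
    using assms(1) unfolding zero_factor_def by blast
  then show ?thesis
    unfolding zero_factor_def
    by (intro exI[of _ "a @ a'"] exI[of _ "b' @ b"] exI[of _ p] exI[of _ x'] exI[of _ y'])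
      (use assms(2,3) in \<open>auto simp: qpath_append[OF wf_fbc_quiver]\<close>)
qed

lemma zero_path_qpath: "zero_path E x y p \<Longrightarrow> qpath (fbc_quiver E) x p y"
  by (induction rule: zero_path.induct) (auto simp: qpath_Lseq)

lemma fbc_rel_khom: "fbc_rel E x y f \<Longrightarrow> f \<in> khom (fbc_quiver E) x y"
  unfolding fbc_rel_iff khom_def
  by (auto dest!: subsetD[OF keys_diff] split: if_splits
      intro: fR1_pair_qpath fR1_pair_qpath[OF fR1_pair_sym] zero_path_qpath)

lemma fbc_ideal_khom: "f \<in> fbc_ideal E x y \<Longrightarrow> f \<in> khom (fbc_quiver E) x y"
  unfolding fbc_ideal_def gen_ideal_def
  using in_gen_ideal_khom[OF wf_fbc_quiver fbc_rel_khom] by blast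

text \<open>Induction over the ideal with \<open>C\<close> varying. An (fR1) difference has both
  terms in \<open>C\<close> or neither, a zero path is not in \<open>C\<close>, and composition with
  a path replaces \<open>C\<close> by a set that inherits both properties.\<close>

lemma coeff_sum_fbc_ideal:
  fixes f :: "'e set list \<Rightarrow>\<^sub>0 'k::field"
  assumes "f \<in> fbc_ideal E x y"
    and "\<And>u v. pstep E x y u v \<Longrightarrow> u \<in> C \<Longrightarrow> v \<in> C" "\<And>u. u \<in> C \<Longrightarrow> \<not> zero_factor E x y u"
  shows "coeff_sum C f = 0"
proof -
  have Nil: "qpath (fbc_quiver E) x [] x" "qpath (fbc_quiver E) y [] y" if "qpath (fbc_quiver E) x p y" for x y p
    using qpath_source[OF that] qpath_target[OF wf_fbc_quiver that] by auto
  have "in_gen_ideal (fbc_quiver E) (fbc_rel E) x y f"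
    using assms(1) by (simp add: fbc_ideal_def gen_ideal_def)
  then show ?thesis
    using assms(2,3)
  proof (induction arbitrary: C)
    case (gen x y f)
    from gen.hyps consider p q where "fR1_pair E x y p q" "f = Poly_Mapping.single p 1 - Poly_Mapping.single q 1"
      | p where "zero_path E x y p" "f = Poly_Mapping.single p 1"
      unfolding fbc_rel_iff by blast
    then show ?case
    proof cases
      case 1
      have "pstep E x y p q" by (rule fR1_pair_pstep[OF 1(1)])
      then have "p \<in> C \<longleftrightarrow> q \<in> C" using gen.prems(1) pstep_sym by blast
      then show ?thesis using 1(2) by (simp add: coeff_sum_diff)
    next
      case 2
      have "zero_factor E x y p"
        unfolding zero_factor_def using 2(1) Nil[OF zero_path_qpath[OF 2(1)]]
        by (metis append_Nil append_Nil2)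
      then show ?thesis using 2(2) gen.prems(2) by auto
    qed
  next
    case (add x y f h)
    then show ?case by (simp add: coeff_sum_add)
  next
    case (comp_left x y f h z)
    have "coeff_sum {v. u @ v \<in> C} f = 0" if "u \<in> Poly_Mapping.keys h" for u
    proof (rule comp_left.IH)
      have u: "qpath (fbc_quiver E) y u z" using that comp_left.hyps by (simp add: khom_def)
      show "v' \<in> {v. u @ v \<in> C}" if "pstep E x y v v'" "v \<in> {v. u @ v \<in> C}" for v v'
        using pstep_append[OF that(1) pstep_ends(1)[OF that(1)] u] comp_left.prems(1) that(2) by simp
      show "\<not> zero_factor E x y v" if "v \<in> {v. u @ v \<in> C}" for v
        using zero_factor_append[OF _ zero_factor_ends(1) u] comp_left.prems(2) that by fastforce
    qed
    then show ?case by (simp add: coeff_sum_kcomp_left)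
  next
    case (comp_right y z f h x)
    have "coeff_sum {u. u @ v \<in> C} f = 0" if "v \<in> Poly_Mapping.keys h" for v
    proof (rule comp_right.IH)
      have v: "qpath (fbc_quiver E) x v y" using that comp_right.hyps by (simp add: khom_def)
      show "u' \<in> {u. u @ v \<in> C}" if "pstep E y z u u'" "u \<in> {u. u @ v \<in> C}" for u u'
        using pstep_append[OF that(1) v pstep_ends(2)[OF that(1)]] comp_right.prems(1) that(2) by simp
      show "\<not> zero_factor E y z u" if "u \<in> {u. u @ v \<in> C}" for u
        using zero_factor_append[OF _ v zero_factor_ends(2)] comp_right.prems(2) that by fastforce
    qed
    then show ?case by (simp add: coeff_sum_kcomp_right)
  qed simp
qed

lemma fbc_ideal_add: "\<lbrakk>f \<in> fbc_ideal E x y; h \<in> fbc_ideal E x y\<rbrakk> \<Longrightarrow> f + h \<in> fbc_ideal E x y"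
  by (simp add: fbc_ideal_def gen_ideal_def in_gen_ideal.add)

lemma fbc_ideal_zero: "\<lbrakk>x \<in> Ppart E; y \<in> Ppart E\<rbrakk> \<Longrightarrow> 0 \<in> fbc_ideal E x y"
  by (simp add: fbc_ideal_def gen_ideal_def in_gen_ideal.zero)

lemma fbc_ideal_sum:
  assumes "x \<in> Ppart E" "y \<in> Ppart E" "\<And>i. i \<in> A \<Longrightarrow> f i \<in> fbc_ideal E x y"
  shows "(\<Sum>i\<in>A. f i) \<in> fbc_ideal E x y"
  using assms(3)
  by (induction A rule: infinite_finite_induct) (auto intro: fbc_ideal_add fbc_ideal_zero assms)

lemma fbc_ideal_comp:
  assumes "f \<in> fbc_ideal E y z" "qpath (fbc_quiver E) x b y" "qpath (fbc_quiver E) z a w"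
  shows "kcomp (Poly_Mapping.single a c) (kcomp f (Poly_Mapping.single b 1)) \<in> fbc_ideal E x w"
  using assms unfolding fbc_ideal_def gen_ideal_def
  by (auto intro!: in_gen_ideal.comp_left[OF in_gen_ideal.comp_right] single_in_khom)

lemma path_cong_fbc_ideal:
  fixes c :: "'k::field"
  assumes "path_cong E x y u v" "x \<in> Ppart E" "y \<in> Ppart E"
  shows "Poly_Mapping.single u c - Poly_Mapping.single v c \<in> fbc_ideal E x y"
  using assms(1)
proof (induction rule: rtranclp_induct)
  case base
  then show ?case using assms by (simp add: fbc_ideal_zero)
next
  case (step v w)
  obtain a b p q x' y' where *: "v = a @ p @ b" "w = a @ q @ b" "fR1_pair E x' y' p q"
    "qpath (fbc_quiver E) x b x'" "qpath (fbc_quiver E) y' a y"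
    using step(2) unfolding pstep_def by blast
  have "Poly_Mapping.single p 1 - Poly_Mapping.single q (1 :: 'k) \<in> fbc_ideal E x' y'"
    unfolding fbc_ideal_def gen_ideal_def
    using *(3) by (auto intro!: in_gen_ideal.gen intro: fbc_rel_iff[THEN iffD2])
  from fbc_ideal_comp[OF this *(4,5), of c]
  have "Poly_Mapping.single v c - Poly_Mapping.single w c \<in> fbc_ideal E x y"
    by (simp add: * kcomp_diff_left kcomp_diff_right kcomp_single)
  from fbc_ideal_add[OF step.IH this] show ?case by simp
qed

lemma zero_factor_fbc_ideal:
  fixes c :: "'k::field"
  assumes "zero_factor E x y u"
  shows "Poly_Mapping.single u c \<in> fbc_ideal E x y"
proof -
  obtain a b p x' y' where *: "u = a @ p @ b" "zero_path E x' y' p"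
    "qpath (fbc_quiver E) x b x'" "qpath (fbc_quiver E) y' a y"
    using assms unfolding zero_factor_def by blast
  have "Poly_Mapping.single p (1 :: 'k) \<in> fbc_ideal E x' y'"
    unfolding fbc_ideal_def gen_ideal_def
    using *(2) by (auto intro!: in_gen_ideal.gen simp: fbc_rel_iff)
  from fbc_ideal_comp[OF this *(3,4), of c] show ?thesis
    by (simp add: * kcomp_single)
qed

text \<open>If the class of \<open>u\<close> had a member with a zero factor, the term at
  \<open>u\<close> alone would lie in \<open>I\<close>, against minimality. So the coefficients over
  the class sum to zero, and the part of \<open>\<rho>\<close> on it is a combination of differences
  \<open>w - u\<close>, hence in \<open>I\<close>; by minimality it is all of \<open>\<rho>\<close>.
  Taking for \<open>I\<close> the part of \<open>fbc_ideal\<close> supported on a subquiver covers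
  \<open>Q_E\<close> and \<open>Q'_E\<close> together.\<close>

lemma minimal_relation_path_cong:
  fixes \<rho> :: "'e set list \<Rightarrow>\<^sub>0 'k::field"
  assumes I: "\<And>f. f \<in> I x y \<longleftrightarrow> f \<in> khom Q' x y \<and> f \<in> fbc_ideal E x y"
    and "minimal_relation I x y \<rho>" "u \<in> Poly_Mapping.keys \<rho>" "v \<in> Poly_Mapping.keys \<rho>"
  shows "path_cong E x y u v"
proof -
  have \<rho>: "\<rho> \<in> khom Q' x y" "\<rho> \<in> fbc_ideal E x y" "card (Poly_Mapping.keys \<rho>) \<ge> 2"
    and min: "\<And>K. K \<noteq> {} \<Longrightarrow> K \<subset> Poly_Mapping.keys \<rho> \<Longrightarrow> kpart K \<rho> \<notin> I x y"
    using assms(2) I by (auto simp: minimal_relation_def)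
  have "qpath (fbc_quiver E) x u y"
    using fbc_ideal_khom[OF \<rho>(2)] assms(3) by (simp add: khom_def)
  then have xy: "x \<in> Ppart E" "y \<in> Ppart E"
    using qpath_source qpath_target[OF wf_fbc_quiver] by fastforce+
  have kpart_khom: "kpart K \<rho> \<in> khom Q' x y" if "K \<subseteq> Poly_Mapping.keys \<rho>" for K
    using that \<rho>(1) unfolding kpart_def khom_def
    by (auto dest!: subsetD[OF keys_sum] split: if_splits)
  define C where "C = {w. path_cong E x y u w}"
  define K where "K = C \<inter> Poly_Mapping.keys \<rho>"
  have "\<not> zero_factor E x y w" if "w \<in> C" for w
  proof
    assume "zero_factor E x y w"
    from zero_factor_fbc_ideal[OF this] that
    have "Poly_Mapping.single u (Poly_Mapping.lookup \<rho> u) \<in> fbc_ideal E x y"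
      using fbc_ideal_add[OF path_cong_fbc_ideal[OF _ xy]] unfolding C_def
      by (metis diff_add_cancel mem_Collect_eq)
    then have "kpart {u} \<rho> \<in> I x y"
      using kpart_khom[of "{u}"] assms(3) I by (simp add: kpart_def)
    moreover have "{u} \<noteq> Poly_Mapping.keys \<rho>"
    proof
      assume "{u} = Poly_Mapping.keys \<rho>"
      from arg_cong[OF this, of card] show False using \<rho>(3) by simp
    qed
    ultimately show False using min[of "{u}"] assms(3) by blast
  qed
  then have "coeff_sum C \<rho> = 0"
    by (intro coeff_sum_fbc_ideal[OF \<rho>(2)]) (auto simp: C_def)
  then have sum: "(\<Sum>w\<in>K. Poly_Mapping.lookup \<rho> w) = 0"
    by (simp add: coeff_sum_def K_def sum.If_cases Int_commute)
  have single_sum: "Poly_Mapping.single u (\<Sum>w\<in>K. Poly_Mapping.lookup \<rho> w)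
      = (\<Sum>w\<in>K. Poly_Mapping.single u (Poly_Mapping.lookup \<rho> w))"
    by (induction K rule: infinite_finite_induct) (auto simp: single_add)
  have "(\<Sum>w\<in>K. Poly_Mapping.single w (Poly_Mapping.lookup \<rho> w) - Poly_Mapping.single u (Poly_Mapping.lookup \<rho> w))
      \<in> fbc_ideal E x y"
    by (intro fbc_ideal_sum path_cong_fbc_ideal xy) (auto simp: K_def C_def intro: path_cong_sym)
  also have "(\<Sum>w\<in>K. Poly_Mapping.single w (Poly_Mapping.lookup \<rho> w) - Poly_Mapping.single u (Poly_Mapping.lookup \<rho> w))
      = kpart K \<rho>"
    using single_sum by (simp add: sum_subtractf kpart_def sum)
  finally have "kpart K \<rho> \<in> I x y"
    using kpart_khom[of K] I by (simp add: K_def)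
  moreover have "u \<in> K" using assms(3) by (simp add: K_def C_def)
  ultimately have "K = Poly_Mapping.keys \<rho>" using min[of K] by (auto simp: K_def)
  then show ?thesis using assms(4) by (auto simp: K_def C_def)
qed

text \<open>The witness is \<open>u - v\<close>. The functional of the class of \<open>u\<close>
  vanishes on \<open>I\<close>, but has the values \<open>1\<close> and \<open>- 1\<close> on the
  two terms.\<close>

lemma nonzero_path_minimal_relation:
  fixes I :: "('e set, 'e set, 'k::field) cat_ideal"
  assumes I: "\<And>f. f \<in> I x y \<longleftrightarrow> f \<in> khom Q' x y \<and> f \<in> fbc_ideal E x y"
    and u: "nonzero_path E x y u" and "path_cong E x y u v" "u \<noteq> v"
    and Q': "qpath Q' x u y" "qpath Q' x v y" "qpath (fbc_quiver E) x u y"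
  shows "\<exists>\<rho>. minimal_relation I x y \<rho> \<and> u \<in> Poly_Mapping.keys \<rho> \<and> v \<in> Poly_Mapping.keys \<rho>"
proof -
  let ?C = "{w. path_cong E x y u w}"
  have zero: "coeff_sum ?C f = 0" if "f \<in> I x y" for f
    using that u I by (intro coeff_sum_fbc_ideal[of f x y]) (auto simp: nonzero_path_def)
  have xy: "x \<in> Ppart E" "y \<in> Ppart E"
    using Q'(3) qpath_source qpath_target[OF wf_fbc_quiver] by fastforce+
  have "Poly_Mapping.single u 1 - Poly_Mapping.single v (1::'k) \<in> I x y"
    using path_cong_fbc_ideal[OF assms(3) xy] Q' I
    by (auto simp: khom_def dest!: subsetD[OF keys_diff] split: if_splits)
  moreover have "Poly_Mapping.single u (1::'k) \<notin> I x y"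
    using zero[of "Poly_Mapping.single u 1"] by auto
  moreover have "Poly_Mapping.single v (- 1::'k) \<notin> I x y"
    using zero[of "Poly_Mapping.single v (- 1)"] assms(3) by auto
  ultimately have "minimal_relation I x y (Poly_Mapping.single u 1 - Poly_Mapping.single v 1)"
    "Poly_Mapping.keys (Poly_Mapping.single u 1 - Poly_Mapping.single v (1 :: 'k)) = {u, v}"
    using minimal_relation_single_diff[of u v I x y] assms(4) by blast+
  then show ?thesis by (metis insertCI)
qed

end

section \<open>Standard paths are nonzero\<close>

context fs_bc
begin

text \<open>In the full path \<open>a p b\<close>, with \<open>m\<close> the length of
  \<open>b\<close> and \<open>f = g^m e\<close>, the path \<open>p\<close> belongs to the standard
  sequence \<open>(f, n)\<close> and also to one side of an (fR1) pair. \<open>exchange\<close>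
  gives a sequence \<open>(z, l)\<close> with path \<open>q\<close> and the same complement as
  \<open>(f, n)\<close>. This complement runs beyond the end of the full path: it is
  \<open>a\<close> followed by \<open>b\<close> shifted by the degree. Shifting back by (f5) places
  \<open>b\<close> just before \<open>z\<close>, so \<open>a q b\<close> is the full path at
  \<open>h = g^(-m) z\<close>.\<close>

lemma pstep_full:
  assumes e: "e \<in> elts E" and "pstep E (Pc E e) y (Lseq E e (deg E e)) v"
  shows "\<exists>h\<in>elts E. Pc E h = Pc E e \<and> v = Lseq E h (deg E h)"
proof -
  obtain a b p q x' y' where u: "Lseq E e (deg E e) = a @ p @ b" and v: "v = a @ q @ b"
    and pq: "fR1_pair E x' y' p q" and b: "qpath (fbc_quiver E) (Pc E e) b x'"
    using assms(2) unfolding pstep_def by blast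
  define m n where "m = length b" and "n = length p"
  have b_eq: "b = Lseq E e m" and p_eq: "p = Lseq E (act E (int m) e) n"
    and a_eq: "a = Lseq E (act E (int (n + m)) e) (length a)" and len: "deg E e = length a + n + m"
  proof -
    have u': "Lseq E e (deg E e) = (a @ p) @ b" using u by simp
    show "b = Lseq E e m" unfolding m_def by (rule Lseq_append_split(1)[OF e u'])
    show "p = Lseq E (act E (int m) e) n" unfolding m_def n_def
      by (rule Lseq_append_split(1)[OF _ Lseq_append_split(2)[OF e u', symmetric]]) (simp add: e)
    show "a = Lseq E (act E (int (n + m)) e) (length a)" "deg E e = length a + n + m"
      using Lseq_append_split(2,3)[OF e u] by (simp_all only: m_def n_def length_append add.assoc)
  qed
  define f where "f = act E (int m) e"
  have f: "f \<in> elts E" "deg E f = deg E e" "p = Lseq E f n"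
    using e p_eq by (simp_all add: f_def)
  have x': "x' = Pc E f"
    using b qpath_Lseq_target[OF e, of "Pc E e" m x'] b_eq by (simp add: f_def)
  from pq obtain e' h' j where pq': "e' \<in> elts E" "h' \<in> elts E" "Pc E e' = Pc E h'" "x' = Pc E e'"
    "j \<le> deg E e'" "j \<le> deg E h'" "p = Lseq E e' (deg E e' - j)" "q = Lseq E h' (deg E h' - j)"
    "\<And>i. i \<in> {1..j} \<Longrightarrow> Lc E (act E (int (deg E e' - i)) e') = Lc E (act E (int (deg E h' - i)) h')"
    by cases auto
  let ?e = "(e', deg E e' - j)" and ?h = "(h', deg E h' - j)" and ?f = "(f, n)"
  have n: "n = deg E e' - j" using pq'(7) by (simp add: n_def)
  have std: "?f \<in> std_seqs E" "?e \<in> std_seqs E" "?h \<in> std_seqs E"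
    using f pq' len by (auto simp: std_seqs_def)
  have "seq_equiv E ?f ?e"
    using f pq' x' by (simp add: seq_equiv_def n)
  moreover have "seq_equiv E (lhat E ?h) (lhat E ?e)"
  proof -
    \<comment> \<open>(fR1) counts the omitted arrows from the end, so position \<open>i\<close> of
      the complement is index \<open>j - i\<close> there.\<close>
    have "Lc E (act E (int i + int (deg E h' - j)) h') = Lc E (act E (int i + int (deg E e' - j)) e')" if "i < j" for i
      using pq'(9)[of "j - i"] that pq'(5,6) by (simp add: of_nat_diff algebra_simps)
    then have "Lseq E (act E (int (deg E h' - j)) h') j = Lseq E (act E (int (deg E e' - j)) e') j"
      using pq' by (simp add: Lseq_eq_iff)
    moreover have "Pc E (act E (int (deg E h' - j)) h') = Pc E (act E (int (deg E e' - j)) e')"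
    proof (cases "j = 0")
      case True
      then show ?thesis using pq' f4[of e' h'] by simp
    next
      case False
      then show ?thesis using pq'(1,2,5,6) pq'(9)[of j] by (intro Pc_eq_if_Lc_eq) auto
    qed
    ultimately show ?thesis
      using pq'(5,6) by (simp add: seq_equiv_def)
  qed
  ultimately obtain s where s: "s \<in> std_seqs E" "seq_equiv E s ?h" "seq_equiv E (lhat E s) (lhat E ?f)"
    using exchange[OF std] by blast
  obtain z l where z: "s = (z, l)" "z \<in> elts E" "l \<le> deg E z"
    using s(1) by (auto simp: std_seqs_def)
  have q_eq: "q = Lseq E z l" and Pz: "Pc E z = Pc E f"
    using s(2) pq'(8,3,4) x' by (auto simp: seq_equiv_def z)
  have rest: "Lseq E (act E (int l) z) (deg E z - l) = Lseq E (act E (int n) f) (deg E f - n)"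
    using s(3) by (simp add: seq_equiv_def z)
  have am: "deg E f - n = m + length a" "deg E z - l = m + length a"
    using len f(2) arg_cong[OF rest, of length] by simp_all
  have shift: "act E (int (length a)) (act E (int n) f) = act E (int (deg E e)) e"
    using e len by (simp add: f_def algebra_simps)
  have "Lseq E (act E (int (length a)) (act E (int l) z)) m @ Lseq E (act E (int l) z) (length a)
      = Lseq E (act E (int (length a)) (act E (int n) f)) m @ Lseq E (act E (int n) f) (length a)"
    using rest unfolding am Lseq_add[OF act_closed[OF z(2)]] Lseq_add[OF act_closed[OF f(1)]] .
  then have eqs: "Lseq E (act E (int (length a)) (act E (int l) z)) m = Lseq E (act E (int (length a)) (act E (int n) f)) m"
    "Lseq E (act E (int l) z) (length a) = Lseq E (act E (int n) f) (length a)"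
    by simp_all
  have nf: "act E (int n) f = act E (int (n + m)) e" using e by (simp add: f_def)
  have a_z: "a = Lseq E (act E (int l) z) (length a)"
    unfolding eqs(2) nf by (rule a_eq)
  have m_z: "Lseq E (act E (int (length a)) (act E (int l) z)) m = Lseq E (act E (int (deg E e)) e) m"
    using eqs(1) unfolding shift .
  define h where "h = act E (- int m) z"
  have h: "h \<in> elts E" "deg E h = deg E z" "act E (int m) h = z" using z by (simp_all add: h_def)
  have deg_z: "deg E z = l + (length a + m)" using am(2) z(3) by linarith
  have b_h: "b = Lseq E h m"
  proof -
    have "Lc E (act E (int i) e) = Lc E (act E (int i) h)" if "i < m" for i
    proof -
      have "Lc E (act E (int i) (act E (int (length a)) (act E (int l) z))) = Lc E (act E (int i) (act E (int (deg E e)) e))"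
        using m_z that unfolding Lseq_eq_iff by blast
      moreover have "act E (int i) (act E (int (length a)) (act E (int l) z)) = act E (int (deg E h)) (act E (int i) h)"
        using z by (simp add: h_def deg_z algebra_simps)
      moreover have "act E (int i) (act E (int (deg E e)) e) = act E (int (deg E e)) (act E (int i) e)"
        using e by (simp add: algebra_simps)
      ultimately show ?thesis
        using f5[of "act E (int i) e" "act E (int i) h"] e h(1) by simp
    qed
    then show ?thesis unfolding b_eq Lseq_eq_iff by blast
  qed
  have "v = Lseq E (act E (int l) z) (length a) @ Lseq E z l @ Lseq E h m"
    unfolding v using a_z q_eq b_h by simp
  also have "\<dots> = Lseq E h (deg E h)"
  proof -
    have "deg E h = (length a + l) + m" using h(2) deg_z by simp
    then show ?thesis
      using Lseq_add[OF h(1), of "length a + l" m] Lseq_add[OF z(2), of "length a" l]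
      unfolding h(3) by simp
  qed
  finally have "v = Lseq E h (deg E h)" .
  \<comment> \<open>If \<open>b\<close> is trivial there is no arrow to compare; then
    \<open>h = z\<close> and \<open>f = e\<close>, and the common source of \<open>p\<close> and
    \<open>q\<close> decides.\<close>
  moreover have "Pc E h = Pc E e"
  proof (cases "m = 0")
    case True
    then show ?thesis using z(2) e Pz by (simp add: f_def h_def)
  next
    case False
    then have "Lc E (act E (int 0) e) = Lc E (act E (int 0) h)"
      using HOL.trans[OF b_eq[symmetric] b_h] unfolding Lseq_eq_iff by blast
    then show ?thesis using Pc_eq_if_Lc_eq[OF e h(1)] e h(1) by simp
  qed
  ultimately show ?thesis using h(1) by blast
qed

lemma path_cong_full:
  assumes "path_cong E (Pc E e) y (Lseq E e (deg E e)) v" "e \<in> elts E"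
  shows "\<exists>h\<in>elts E. Pc E h = Pc E e \<and> v = Lseq E h (deg E h)"
  using assms
proof (induction rule: rtranclp_induct)
  case (step v w)
  then obtain h where "h \<in> elts E" "Pc E h = Pc E e" "v = Lseq E h (deg E h)" by blast
  then show ?case using pstep_full[of h y w] step(2) by metis
qed blast

text \<open>A factor \<open>L(g^(n-1) f) ... L(f)\<close> is no (fR2) path, since
  \<open>g^(n-1) f\<close> lies in every set of the intersection. An (fR3) factor would contain a
  full sequence strictly shorter than this one, against (f6).\<close>

lemma full_not_zero_factor:
  assumes e: "e \<in> elts E"
  shows "\<not> zero_factor E x y (Lseq E e (deg E e))"
proof
  assume "zero_factor E x y (Lseq E e (deg E e))"
  then obtain a b p x' y' where u: "Lseq E e (deg E e) = a @ p @ b" and p: "zero_path E x' y' p"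
    unfolding zero_factor_def by blast
  define f where "f = act E (int (length b)) e"
  have f: "f \<in> elts E" "p = Lseq E f (length p)" and len: "length p \<le> deg E e"
  proof -
    have u': "Lseq E e (deg E e) = (a @ p) @ b" using u by simp
    show f: "f \<in> elts E" by (simp add: f_def e)
    show "p = Lseq E f (length p)"
      by (rule Lseq_append_split(1)[OF f Lseq_append_split(2)[OF e u', symmetric, folded f_def]])
    show "length p \<le> deg E e" using Lseq_append_split(3)[OF e u'] by simp
  qed
  from p show False
  proof cases
    case 1
    have "act E (int (length p - 1)) f \<in> (\<Inter>m<length p. act E (int m) ` (p ! m))"
    proof
      fix m assume m: "m \<in> {..<length p}"
      then have "p ! m = Lc E (act E (int (length p - 1 - m)) f)"
        by (subst f(2)) (auto simp: Lseq_def rev_nth)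
      moreover have "act E (int (length p - 1)) f = act E (int m) (act E (int (length p - 1 - m)) f)"
        using f(1) m by (simp add: of_nat_diff)
      ultimately show "act E (int (length p - 1)) f \<in> act E (int m) ` (p ! m)"
        using Lc_mem(2)[of "act E (int (length p - 1 - m)) f"] f(1) by (metis act_closed imageI)
    qed
    then show False using 1 by blast
  next
    case (2 h n)
    have "Lseq E h n = Lseq E (act E (int (deg E h)) h) (n - deg E h) @ Lseq E h (deg E h)"
      using Lseq_add[of h "n - deg E h" "deg E h"] 2 by simp
    then have "Lseq E e (deg E e)
        = (a @ Lseq E (act E (int (deg E h)) h) (n - deg E h)) @ Lseq E h (deg E h) @ b"
      using u 2 by simp
    then have "sublist (Lseq E h (deg E h)) (Lseq E e (deg E e))"
      unfolding sublist_def by blast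
    moreover have "Lseq E h (deg E h) \<noteq> Lseq E e (deg E e)"
      using 2 len by (auto simp: Lseq_eq_iff)
    ultimately show False using f6[of h e] 2 e by (simp add: strict_sublist_def)
  qed
qed

text \<open>Composing with the complement \<open>a\<close> gives full paths, to which
  \<open>path_cong_full\<close> and \<open>full_not_zero_factor\<close> apply; \<open>v\<close> is
  then the right-hand part of a full path. The length bound is used again to terminate the rewriting
  of reduced arrows.\<close>

lemma path_cong_standard:
  assumes e: "e \<in> elts E" "n \<le> deg E e" and y: "y = Pc E (act E (int n) e)"
    and "path_cong E (Pc E e) y (Lseq E e n) v"
  shows "\<exists>h\<in>elts E. Pc E h = Pc E e \<and> length v \<le> deg E h \<and> v = Lseq E h (length v)"
    and "\<not> zero_factor E (Pc E e) y v"
proof -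
  define a where "a = Lseq E (act E (int n) e) (deg E e - n)"
  define w where "w = Pc E (act E (int (deg E e)) e)"
  have full: "Lseq E e (deg E e) = a @ Lseq E e n"
    using Lseq_add[OF e(1), of "deg E e - n" n] e(2) by (simp add: a_def)
  have a: "qpath (fbc_quiver E) y a w"
    using qpath_Lseq[of "act E (int n) e" "deg E e - n"] e by (simp add: a_def y w_def of_nat_diff)
  have x: "qpath (fbc_quiver E) (Pc E e) [] (Pc E e)" using e Pc_mem by simp
  have "path_cong E (Pc E e) w (a @ Lseq E e n) (a @ v)"
    using path_cong_append[OF assms(4) x a] by simp
  then obtain h where h: "h \<in> elts E" "Pc E h = Pc E e" "a @ v = Lseq E h (deg E h)"
    using path_cong_full[OF _ e(1)] full by metis
  then show "\<exists>h\<in>elts E. Pc E h = Pc E e \<and> length v \<le> deg E h \<and> v = Lseq E h (length v)"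
    using Lseq_append_split[OF h(1) h(3)[symmetric]] by (intro bexI[of _ h]) auto
  show "\<not> zero_factor E (Pc E e) y v"
    using full_not_zero_factor[OF h(1)] zero_factor_append[OF _ x a, of v] h(3) by auto
qed

lemma nonzero_standard:
  "\<lbrakk>e \<in> elts E; n \<le> deg E e\<rbrakk> \<Longrightarrow> nonzero_path E (Pc E e) (Pc E (act E (int n) e)) (Lseq E e n)"
  unfolding nonzero_path_def using path_cong_standard(2) by blast

end

section \<open>Walks of a fractional Brauer configuration\<close>

fun flip :: "'e \<times> dir \<times> 'e \<Rightarrow> 'e \<times> dir \<times> 'e" where
  "flip (y, Fwd, x) = (x, Bwd, y)"
| "flip (y, Bwd, x) = (x, Fwd, y)"
| "flip (y, Tau, x) = (x, Tau, y)"

definition finv :: "('e \<times> dir \<times> 'e) list \<Rightarrow> ('e \<times> dir \<times> 'e) list" where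
  "finv w = rev (map flip w)"

lemma finv_simps [simp]:
  "finv [] = []" "finv (s # w) = finv w @ [flip s]" "finv (u @ v) = finv v @ finv u"
  by (simp_all add: finv_def)

lemma flip_flip [simp]: "flip (flip s) = s"
  by (cases s rule: flip.cases) auto

lemma finv_finv [simp]: "finv (finv w) = w"
  by (simp add: finv_def rev_map comp_def)

definition rep :: "'e set \<Rightarrow> 'e" where
  "rep X = (SOME e. e \<in> X)"

definition arrow_walk :: "'e frac_conf \<Rightarrow> 'e set \<Rightarrow> ('e \<times> dir \<times> 'e) list" where
  "arrow_walk E l = [(rep (Pc E (act E 1 (rep l))), Tau, act E 1 (rep l)),
     (act E 1 (rep l), Fwd, rep l), (rep l, Tau, rep (Pc E (rep l)))]"

fun letter_walk :: "'e frac_conf \<Rightarrow> 'e set letter \<Rightarrow> ('e \<times> dir \<times> 'e) list" where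
  "letter_walk E (Arr l) = arrow_walk E l"
| "letter_walk E (Inv l) = finv (arrow_walk E l)"

definition walk_of :: "'e frac_conf \<Rightarrow> 'e set letter list \<Rightarrow> ('e \<times> dir \<times> 'e) list" where
  "walk_of E w = concat (map (letter_walk E) w)"

lemma walk_of_simps [simp]:
  "walk_of E [] = []" "walk_of E (a # w) = letter_walk E a @ walk_of E w"
  "walk_of E (u @ v) = walk_of E u @ walk_of E v"
  by (simp_all add: walk_of_def)

lemma walk_of_inv_walk [simp]: "walk_of E (inv_walk w) = finv (walk_of E w)"
proof (induction w)
  case (Cons a w)
  then show ?case by (cases a) auto
qed simp

lemma gwalk_0 [simp]: "gwalk E e 0 = []"
  by (simp add: gwalk_def)

lemma gwalk_Suc: "gwalk E e (Suc n) = (act E (int n + 1) e, Fwd, act E (int n) e) # gwalk E e n"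
  by (simp add: gwalk_def)

context fbc
begin

lemma fstep_elts: "fstep E (y, \<delta>, x) \<Longrightarrow> x \<in> elts E \<and> y \<in> elts E"
  by (cases \<delta>) auto

lemma fwalk_elts: "fwalk E a w b \<Longrightarrow> a \<in> elts E \<and> b \<in> elts E"
proof (induction w arbitrary: b)
  case (Cons s w)
  then show ?case using fstep_elts by (cases s) auto
qed simp

lemma fwalk_append: "fwalk E a (u @ v) c \<longleftrightarrow> (\<exists>b. fwalk E a v b \<and> fwalk E b u c)"
proof (induction u arbitrary: c)
  case Nil
  then show ?case using fwalk_elts by auto
next
  case (Cons s u)
  then show ?case by (cases s) auto
qed

lemma fstep_flip: "fstep E (y, \<delta>, x) \<Longrightarrow> fwalk E y [flip (y, \<delta>, x)] x"
  by (cases \<delta>) auto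

lemma fwalk_finv: "fwalk E a w b \<Longrightarrow> fwalk E b (finv w) a"
proof (induction w arbitrary: b)
  case (Cons s w)
  obtain y \<delta> x where s: "s = (y, \<delta>, x)" by (metis prod_cases3)
  then show ?case using Cons fstep_flip[of y \<delta> x] by (auto simp: fwalk_append simp del: flip.simps)
qed simp

lemma fhomotopic_flip:
  assumes "fstep E (y, \<delta>, x)"
  shows "fhomotopic E x x [flip (y, \<delta>, x), (y, \<delta>, x)] []"
proof (cases \<delta>)
  case Fwd
  then show ?thesis using assms fhomotopic.h1_left by auto
next
  case Bwd
  then show ?thesis using assms fhomotopic.h1_right by auto
next
  case Tau
  \<comment> \<open>(h1) does not cancel a pair of inverse \<open>Tau\<close> steps directly; (h2)
    merges them into \<open>(x|\<tau>|x)\<close>, which (h1) removes.\<close>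
  then have "fhomotopic E x x [(x, Tau, y), (y, Tau, x)] [(x, Tau, x)]"
    using assms by (intro fhomotopic.h2) auto
  then show ?thesis
    using fhomotopic.trans[OF _ fhomotopic.h1_tau] assms Tau by auto
qed

lemma fhomotopic_finv:
  assumes "fwalk E a w b"
  shows "fhomotopic E a a (finv w @ w) []"
  using assms
proof (induction w arbitrary: b)
  case (Cons s w)
  obtain y \<delta> x where s: "s = (y, \<delta>, x)" by (metis prod_cases3)
  have w: "fstep E (y, \<delta>, x)" "fwalk E a w x" using Cons.prems by (auto simp: s)
  have "fhomotopic E a a (finv w @ [flip (y, \<delta>, x), (y, \<delta>, x)] @ w) (finv w @ [] @ w)"
    by (rule fhomotopic.h5_left[OF fhomotopic.h5_right[OF fhomotopic_flip[OF w(1)] w(2)] fwalk_finv[OF w(2)]])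
  then show ?case
    using Cons.IH[OF w(2)] by (auto simp: s intro: fhomotopic.trans)
qed (auto intro: fhomotopic.refl)

lemma fwalk_gwalk: "e \<in> elts E \<Longrightarrow> fwalk E e (gwalk E e n) (act E (int n) e)"
  by (induction n) (auto simp: gwalk_Suc ac_simps)

lemma fhomotopic_fwalk:
  assumes "fhomotopic E a b u v"
  shows "fwalk E a u b \<and> fwalk E a v b"
  using assms
proof induction
  case (h3 e h e' h')
  then show ?case
    using f4[of e h] fwalk_gwalk[of e "deg E e"] fwalk_gwalk[of h "deg E h"] by (auto simp: fwalk_append)
next
  case (h4 e h e' h')
  then show ?case
    using f2[of e h] Pc_eq_if_Lc_eq[of e h] by auto
qed (auto simp: fwalk_append)

end

sublocale fbc \<subseteq> walks: walk_groupoid "fwalk E" "fhomotopic E"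
proof
  show "\<exists>w'. fwalk E b w' a \<and> fhomotopic E a a (w' @ w) [] \<and> fhomotopic E b b (w @ w') []"
    if "fwalk E a w b" for a w b
    using fwalk_finv[OF that] fhomotopic_finv[OF that] fhomotopic_finv[OF fwalk_finv[OF that]] by auto
qed (auto simp: fwalk_append intro: fhomotopic.refl fhomotopic.sym fhomotopic.trans
    fhomotopic.h5_left fhomotopic.h5_right dest: fwalk_elts fhomotopic_fwalk)

section \<open>From walks of the quiver to walks of \<open>E\<close>\<close>

context fbc
begin

lemma fbc_fund_group_eq: "fbc_fund_group E = walks.wgroup"
  by (auto simp: fbc_fund_group_def walks.wgroup_def walks.cl_def)

lemma fhomotopic_finv_cong: "fhomotopic E a b u v \<Longrightarrow> fhomotopic E b a (finv u) (finv v)"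
  using walks.hom_inverse[of a b u v "finv u" "finv v"] fhomotopic_fwalk[of a b u v]
    fwalk_finv fhomotopic_finv[of a v b] fhomotopic_finv[OF fwalk_finv, of a u b] by simp

lemma rep_Ppart:
  assumes "X \<in> Ppart E"
  shows "rep X \<in> elts E" "Pc E (rep X) = X"
proof -
  have "rep X \<in> X" unfolding rep_def using Ppart_nonempty[OF assms] by (rule someI_ex)
  then show "rep X \<in> elts E" "Pc E (rep X) = X"
    using assms Ppart_elts Pc_eq by auto
qed

lemma rep_Lpart:
  assumes "l \<in> Lpart E"
  shows "rep l \<in> elts E" "Lc E (rep l) = l"
proof -
  have "rep l \<in> l" unfolding rep_def using Lpart_nonempty[OF assms] by (rule someI_ex)
  then show "rep l \<in> elts E" "Lc E (rep l) = l"
    using assms Lpart_elts Lc_eq by auto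
qed

lemma rep_Pc: "e \<in> elts E \<Longrightarrow> rep (Pc E e) \<in> elts E" "e \<in> elts E \<Longrightarrow> Pc E (rep (Pc E e)) = Pc E e"
  using rep_Ppart Pc_mem by auto

lemma tail_rep: "l \<in> Lpart E \<Longrightarrow> tail (fbc_quiver E) l = Pc E (rep l)"
  using rep_Lpart[of l] tail_Lc[of "rep l"] by simp

lemma head_rep: "l \<in> Lpart E \<Longrightarrow> head (fbc_quiver E) l = Pc E (act E 1 (rep l))"
  using rep_Lpart[of l] head_Lc[of "rep l"] by simp

lemma fwalk_arrow_walk:
  "l \<in> Lpart E \<Longrightarrow>
    fwalk E (rep (tail (fbc_quiver E) l)) (arrow_walk E l) (rep (head (fbc_quiver E) l))"
  using rep_Lpart[of l] by (simp add: arrow_walk_def tail_rep head_rep rep_Pc)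

lemma fwalk_walk_of:
  "qwalk (fbc_quiver E) x w y \<Longrightarrow> fwalk E (rep x) (walk_of E w) (rep y)"
proof (induction w arbitrary: y)
  case Nil
  then show ?case using rep_Ppart[of x] by auto
next
  case (Cons a w)
  then show ?case
    using fwalk_arrow_walk fwalk_finv[OF fwalk_arrow_walk]
    by (cases a) (auto simp: fwalk_append)
qed

lemma fhomotopic_walk_of:
  assumes "qhomotopic (fbc_quiver E) x y u v"
  shows "fhomotopic E (rep x) (rep y) (walk_of E u) (walk_of E v)"
  using assms
proof induction
  case (refl x u y)
  then show ?case by (intro fhomotopic.refl fwalk_walk_of)
next
  case (cancel_left a)
  then show ?case using fhomotopic_finv[OF fwalk_arrow_walk[of a]] by simp
next
  case (cancel_right a)
  then show ?case using fhomotopic_finv[OF fwalk_finv[OF fwalk_arrow_walk[of a]]] by simp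
qed (auto intro: fhomotopic.sym fhomotopic.trans fhomotopic.h5_left fhomotopic.h5_right fwalk_walk_of)

text \<open>The representative chosen for an arrow is immaterial: (h4) slides the \<open>Fwd\<close>
  step from the chosen element to any \<open>f\<close> of the same \<open>L\<close>-class, and (h2)
  absorbs the extra \<open>Tau\<close> steps.\<close>

lemma arrow_walk_hom:
  assumes f: "f \<in> elts E"
  shows "fhomotopic E (rep (Pc E f)) (rep (Pc E (act E 1 f))) (arrow_walk E (Lc E f))
    [(rep (Pc E (act E 1 f)), Tau, act E 1 f), (act E 1 f, Fwd, f), (f, Tau, rep (Pc E f))]"
proof -
  define c where "c = rep (Lc E f)"
  let ?R = "rep (Pc E f)" and ?R' = "rep (Pc E (act E 1 f))"
  let ?gf = "act E 1 f" and ?gc = "act E 1 c"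
  have c: "c \<in> elts E" "Lc E f = Lc E c"
    using rep_Lpart[OF Lc_mem(1)[OF f]] by (simp_all add: c_def)
  have P: "Pc E c = Pc E f" "Pc E ?gc = Pc E ?gf"
    using Pc_eq_if_Lc_eq[OF f c] f2[OF f c] by simp_all
  have R: "?R \<in> elts E" "?R' \<in> elts E" "Pc E ?R = Pc E f" "Pc E ?R' = Pc E ?gf"
    using f rep_Pc by simp_all
  have elts: "?gf \<in> elts E" "?gc \<in> elts E" using f c by simp_all
  have tau1: "fhomotopic E ?R c [(c, Tau, f), (f, Tau, ?R)] [(c, Tau, ?R)]"
    by (rule fhomotopic.h2) (simp_all only: f c(1) P R)
  have tau2: "fhomotopic E ?gf ?R' [(?R', Tau, ?gc), (?gc, Tau, ?gf)] [(?R', Tau, ?gf)]"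
    by (rule fhomotopic.h2) (simp_all only: elts P R)
  have w1: "fwalk E c [(?R', Tau, ?gc), (?gc, Fwd, c)] ?R'" "fwalk E ?gc [(?R', Tau, ?gc)] ?R'"
    using elts P R c(1) by auto
  have w2: "fwalk E ?R [(?gf, Fwd, f), (f, Tau, ?R)] ?gf" "fwalk E ?R [(f, Tau, ?R)] f"
    using elts P R f by auto
  have aw: "arrow_walk E (Lc E f) = [(?R', Tau, ?gc), (?gc, Fwd, c), (c, Tau, ?R)]"
    by (simp add: arrow_walk_def c_def[symmetric] P)
  have "fhomotopic E ?R ?R' ([(?R', Tau, ?gc), (?gc, Fwd, c)] @ [(c, Tau, ?R)])
      ([(?R', Tau, ?gc), (?gc, Fwd, c)] @ [(c, Tau, f), (f, Tau, ?R)])"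
    using walks.hom_left[OF fhomotopic.sym[OF tau1] w1(1)] by simp
  also have "fhomotopic E ?R ?R' \<dots> ([(?R', Tau, ?gc)] @ [(?gc, Tau, ?gf), (?gf, Fwd, f)] @ [(f, Tau, ?R)])"
    using walks.hom_context[OF fhomotopic.sym[OF fhomotopic.h4[OF f c(1) c(2) HOL.refl HOL.refl]] w2(2) w1(2)]
    by simp
  also have "fhomotopic E ?R ?R' \<dots> ([(?R', Tau, ?gf)] @ [(?gf, Fwd, f), (f, Tau, ?R)])"
    using walks.hom_right[OF tau2 w2(1)] by simp
  finally show ?thesis unfolding aw by simp
qed

lemma tau_cancel:
  assumes "e \<in> elts E" "h \<in> elts E" "Pc E e = Pc E h"
  shows "fhomotopic E e e [(e, Tau, h), (h, Tau, e)] []"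
  using fhomotopic_flip[of h Tau e] assms by simp

text \<open>Between consecutive arrows the walk goes to the representative of the vertex and back;
  these detours cancel and only the two outer \<open>Tau\<close> steps survive.\<close>

lemma walk_of_Lseq:
  assumes e: "e \<in> elts E"
  shows "fhomotopic E (rep (Pc E e)) (rep (Pc E (act E (int n) e))) (walk_of E (map Arr (Lseq E e n)))
    ([(rep (Pc E (act E (int n) e)), Tau, act E (int n) e)] @ gwalk E e n @ [(e, Tau, rep (Pc E e))])"
proof (induction n)
  case 0
  show ?case
    using fhomotopic.sym[OF tau_cancel[of "rep (Pc E e)" e]] e rep_Pc by simp
next
  case (Suc n)
  define f where "f = act E (int n) e"
  let ?R = "rep (Pc E f)" and ?R' = "rep (Pc E (act E 1 f))" and ?S = "rep (Pc E e)"
  have f: "f \<in> elts E" using e by (simp add: f_def)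
  have R: "?R \<in> elts E" "?R' \<in> elts E" "Pc E ?R = Pc E f" "Pc E ?R' = Pc E (act E 1 f)"
    "?S \<in> elts E" "Pc E ?S = Pc E e"
    by (simp_all only: rep_Pc[OF f] rep_Pc[OF e] rep_Pc[OF act_closed[OF f]])
  have g: "act E (int (Suc n)) e = act E 1 f" "act E (int n + 1) e = act E 1 f"
    using e by (simp_all add: f_def ac_simps)
  have w: "fwalk E ?S (gwalk E e n @ [(e, Tau, ?S)]) f"
    "fwalk E f [(?R', Tau, act E 1 f), (act E 1 f, Fwd, f)] ?R'"
    unfolding fwalk_append using fwalk_gwalk[OF e, of n] e f R by (auto simp: f_def[symmetric])
  have "fhomotopic E ?S ?R' (walk_of E (map Arr (Lseq E e (Suc n))))
    ([(?R', Tau, act E 1 f), (act E 1 f, Fwd, f), (f, Tau, ?R)] @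
      [(?R, Tau, f)] @ gwalk E e n @ [(e, Tau, ?S)])"
    using walks.hom_append[OF Suc[folded f_def] arrow_walk_hom[OF f]]
    by (simp add: Lseq_Suc f_def)
  also have "fhomotopic E ?S ?R' \<dots>
    ([(?R', Tau, act E 1 f), (act E 1 f, Fwd, f)] @ gwalk E e n @ [(e, Tau, ?S)])"
    using walks.hom_cancel_middle[OF tau_cancel[OF f R(1) R(3)[symmetric]] w] by simp
  finally show ?case
    unfolding gwalk_Suc g by (simp add: f_def)
qed

text \<open>This is (h3) between the \<open>Tau\<close> steps to the chosen representatives; (f4)
  supplies the common target.\<close>

lemma walk_of_full:
  assumes "e \<in> elts E" "h \<in> elts E" "Pc E e = Pc E h"
  shows "fhomotopic E (rep (Pc E e)) (rep (Pc E (act E (int (deg E e)) e)))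
    (walk_of E (map Arr (Lseq E e (deg E e)))) (walk_of E (map Arr (Lseq E h (deg E h))))"
proof -
  let ?e' = "act E (int (deg E e)) e" and ?h' = "act E (int (deg E h)) h"
  let ?R = "rep (Pc E e)" and ?R' = "rep (Pc E ?e')"
  have P': "Pc E ?h' = Pc E ?e'" using f4[OF assms(1,2)] assms(3) by simp
  have R: "?R \<in> elts E" "?R' \<in> elts E" "Pc E ?R = Pc E e" "Pc E ?R' = Pc E ?e'"
    using assms rep_Pc by simp_all
  have elts: "?e' \<in> elts E" "?h' \<in> elts E" using assms by simp_all
  have tau1: "fhomotopic E ?e' ?R' [(?R', Tau, ?h'), (?h', Tau, ?e')] [(?R', Tau, ?e')]"
    by (rule fhomotopic.h2) (simp_all only: elts R P')
  have tau2: "fhomotopic E ?R h [(h, Tau, e), (e, Tau, ?R)] [(h, Tau, ?R)]"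
    by (rule fhomotopic.h2) (simp_all only: assms(1,2) assms(3)[symmetric] R)
  have w1: "fwalk E ?R (gwalk E e (deg E e) @ [(e, Tau, ?R)]) ?e'"
    unfolding fwalk_append using fwalk_gwalk[OF assms(1)] assms(1) R by auto
  have w2: "fwalk E h ([(?R', Tau, ?h')] @ gwalk E h (deg E h)) ?R'"
    unfolding fwalk_append using fwalk_gwalk[OF assms(2)] R P' elts by auto
  have w3: "fwalk E ?R [(e, Tau, ?R)] e" "fwalk E ?h' [(?R', Tau, ?h')] ?R'"
    using R P' elts assms by auto
  have "fhomotopic E ?R ?R' (walk_of E (map Arr (Lseq E e (deg E e))))
      ([(?R', Tau, ?e')] @ gwalk E e (deg E e) @ [(e, Tau, ?R)])"
    by (rule walk_of_Lseq[OF assms(1)])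
  also have "fhomotopic E ?R ?R' \<dots> ([(?R', Tau, ?h'), (?h', Tau, ?e')] @ gwalk E e (deg E e) @ [(e, Tau, ?R)])"
    using walks.hom_right[OF fhomotopic.sym[OF tau1] w1] by simp
  also have "fhomotopic E ?R ?R' \<dots> ([(?R', Tau, ?h')] @ (gwalk E h (deg E h) @ [(h, Tau, e)]) @ [(e, Tau, ?R)])"
    using walks.hom_context[OF fhomotopic.h3[OF assms HOL.refl HOL.refl] w3] by simp
  also have "fhomotopic E ?R ?R' \<dots> ([(?R', Tau, ?h')] @ gwalk E h (deg E h) @ [(h, Tau, ?R)])"
    using walks.hom_left[OF tau2 w2] by simp
  also have "fhomotopic E ?R ?R' \<dots> (walk_of E (map Arr (Lseq E h (deg E h))))"
    using fhomotopic.sym[OF walk_of_Lseq[OF assms(2), of "deg E h"]] P' assms(3) by simp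
  finally show ?thesis .
qed

text \<open>The common left factor of two full standard sequences is cancelled from (h3).\<close>

lemma walk_of_fR1_pair:
  assumes "fR1_pair E x y p q"
  shows "fhomotopic E (rep x) (rep y) (walk_of E (map Arr p)) (walk_of E (map Arr q))"
proof -
  have pq: "qpath (fbc_quiver E) x p y" "qpath (fbc_quiver E) x q y"
    using assms by (auto intro: fR1_pair_qpath fR1_pair_qpath[OF fR1_pair_sym])
  from assms show ?thesis
  proof cases
    case (1 e h j)
    let ?e = "act E (int (deg E e - j)) e" and ?h = "act E (int (deg E h - j)) h"
    define s where "s = Lseq E ?e j"
    have "Lseq E ?h j = s"
      unfolding s_def Lseq_eq_iff
    proof (intro conjI allI impI)
      fix i assume i: "i < j"
      have "Lc E (act E (int (deg E e - (j - i))) e) = Lc E (act E (int (deg E h - (j - i))) h)"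
        using 1(10) i by (auto dest: bspec[of _ _ "j - i"])
      moreover have "int (deg E e - (j - i)) = int i + int (deg E e - j)"
        "int (deg E h - (j - i)) = int i + int (deg E h - j)" using 1 i by linarith+
      ultimately show "Lc E (act E (int i) ?h) = Lc E (act E (int i) ?e)"
        by (simp only: act_act[OF 1(5)] act_act[OF 1(6)])
    qed simp
    then have full: "Lseq E e (deg E e) = s @ p" "Lseq E h (deg E h) = s @ q"
      using Lseq_add[of e j "deg E e - j"] Lseq_add[of h j "deg E h - j"] 1
      by (simp_all add: s_def)
    have s: "qpath (fbc_quiver E) y s (Pc E (act E (int (deg E e)) e))"
      using qpath_Lseq[of ?e j] 1 by (simp add: s_def)
    have "fhomotopic E (rep x) (rep (Pc E (act E (int (deg E e)) e)))
        (walk_of E (map Arr s) @ walk_of E (map Arr p)) (walk_of E (map Arr s) @ walk_of E (map Arr q))"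
      using walk_of_full[of e h] 1 full by simp
    then show ?thesis
      by (rule walks.hom_left_cancel) (use pq s in \<open>simp_all add: fwalk_walk_of qwalk_Arr\<close>)
  qed
qed

text \<open>Covers zero paths as well. It makes relators trivial and compares an arrow with its
  factorisation through a subquiver.\<close>

lemma walk_of_path_cong:
  assumes "path_cong E x y u v" "qpath (fbc_quiver E) x u y"
  shows "fhomotopic E (rep x) (rep y) (walk_of E (map Arr u)) (walk_of E (map Arr v))"
  using assms(1)
proof (induction rule: rtranclp_induct)
  case base
  then show ?case using assms(2) by (intro fhomotopic.refl fwalk_walk_of) (simp add: qwalk_Arr)
next
  case (step v w)
  obtain a b p q x' y' where *: "v = a @ p @ b" "w = a @ q @ b" "fR1_pair E x' y' p q"
    "qpath (fbc_quiver E) x b x'" "qpath (fbc_quiver E) y' a y"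
    using step(2) unfolding pstep_def by blast
  have "fhomotopic E (rep x) (rep y) (walk_of E (map Arr v)) (walk_of E (map Arr w))"
    using walks.hom_context[OF walk_of_fR1_pair[OF *(3)]] *(4,5)
    by (simp add: * fwalk_walk_of qwalk_Arr)
  then show ?case using step.IH by (rule fhomotopic.trans[rotated])
qed

end

section \<open>Subquivers through which every arrow factors\<close>

context fbc
begin

lemma fbc_quiver'_simps [simp]:
  "verts (fbc_quiver' E N) = Ppart E" "arcs (fbc_quiver' E N) = N"
  "tail (fbc_quiver' E N) = tail (fbc_quiver E)" "head (fbc_quiver' E N) = head (fbc_quiver E)"
  by (simp_all add: fbc_quiver'_def)

lemma wf_fbc_quiver': "N \<subseteq> Lpart E \<Longrightarrow> wf_digraph (fbc_quiver' E N)"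
  using wf_fbc_quiver by (auto simp: wf_digraph_def)

lemma qpath_fbc_quiver'_mono:
  "\<lbrakk>N \<subseteq> Lpart E; qpath (fbc_quiver' E N) x u y\<rbrakk> \<Longrightarrow> qpath (fbc_quiver E) x u y"
  by (induction u arbitrary: y) auto

text \<open>The conditions on \<open>\<phi>\<close> concern only the letters of \<open>u\<close>,
  because one application knows replacements for nonreduced arrows only.\<close>

lemma path_cong_concat:
  assumes N: "N \<subseteq> Lpart E" and "qpath (fbc_quiver E) x u y"
    and "\<And>l. l \<in> set u \<Longrightarrow> qpath (fbc_quiver' E N) (tail (fbc_quiver E) l) (\<phi> l) (head (fbc_quiver E) l)"
    and "\<And>l. l \<in> set u \<Longrightarrow> path_cong E (tail (fbc_quiver E) l) (head (fbc_quiver E) l) [l] (\<phi> l)"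
  shows "qpath (fbc_quiver' E N) x (concat (map \<phi> u)) y \<and> path_cong E x y u (concat (map \<phi> u))"
  using assms(2-4)
proof (induction u arbitrary: y)
  case (Cons l u)
  let ?t = "tail (fbc_quiver E) l" and ?u = "concat (map \<phi> u)"
  have l: "l \<in> Lpart E" "head (fbc_quiver E) l = y" "qpath (fbc_quiver E) x u ?t"
    using Cons.prems(1) by simp_all
  have IH: "qpath (fbc_quiver' E N) x ?u ?t" "path_cong E x ?t u ?u"
    using Cons.IH[OF l(3)] Cons.prems(2,3) by simp_all
  have x: "qpath (fbc_quiver E) x [] x" "qpath (fbc_quiver E) y [] y"
    using qpath_source[OF l(3)] qpath_target[OF wf_fbc_quiver Cons.prems(1)] by simp_all
  have "qpath (fbc_quiver E) ?t [l] y"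
    using l qpath_target[OF wf_fbc_quiver l(3)] by simp
  from path_cong_append[OF IH(2) x(1) this]
  have "path_cong E x y (l # u) ([l] @ ?u)" by simp
  also have "path_cong E x y ([l] @ ?u) (\<phi> l @ ?u)"
    using path_cong_append[OF Cons.prems(3)[of l] qpath_fbc_quiver'_mono[OF N IH(1)], of "[]" y] l(2) x(2)
    by simp
  finally have "path_cong E x y (l # u) (\<phi> l @ ?u)" .
  then show ?case
    using Cons.prems(2)[of l] IH(1) l(2) by (auto simp: qpath_append[OF wf_fbc_quiver'[OF N]])
qed simp

end

text \<open>\<open>\<phi> l\<close> factors the arrow \<open>l\<close> of \<open>Q_E\<close> through
  the subquiver up to congruence. For \<open>l\<close> in \<open>N\<close> it may still differ from
  \<open>[l]\<close>, so substituting \<open>\<phi>\<close> can change a walk of the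
  subquiver.\<close>

locale fbc_subquiver = fs_bc E for E :: "'e frac_conf" +
  fixes N :: "'e set set" and \<phi> :: "'e set \<Rightarrow> 'e set list"
  assumes N_subset: "N \<subseteq> Lpart E"
    and qpath_\<phi>: "l \<in> Lpart E \<Longrightarrow>
      qpath (fbc_quiver' E N) (tail (fbc_quiver E) l) (\<phi> l) (head (fbc_quiver E) l)"
    and path_cong_\<phi>: "l \<in> Lpart E \<Longrightarrow>
      path_cong E (tail (fbc_quiver E) l) (head (fbc_quiver E) l) [l] (\<phi> l)"
begin

abbreviation "Q' \<equiv> fbc_quiver' E N"

lemma wf_Q': "wf_digraph Q'"
  by (rule wf_fbc_quiver'[OF N_subset])

lemmas qpath_mono = qpath_fbc_quiver'_mono[OF N_subset]

lemma qwalk_mono: "qwalk Q' x w y \<Longrightarrow> qwalk (fbc_quiver E) x w y"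
proof (induction w arbitrary: y)
  case (Cons a w)
  then show ?case using N_subset by (cases a) auto
qed simp

lemma qhomotopic_mono: "qhomotopic Q' x y u v \<Longrightarrow> qhomotopic (fbc_quiver E) x y u v"
proof (induction rule: qhomotopic.induct)
  case (cancel_left a)
  then show ?case using N_subset qhomotopic.cancel_left[of a "fbc_quiver E"] by auto
next
  case (cancel_right a)
  then show ?case using N_subset qhomotopic.cancel_right[of a "fbc_quiver E"] by auto
qed (auto intro: qwalk_mono qhomotopic.refl qhomotopic.sym qhomotopic.trans
    qhomotopic.comp_left qhomotopic.comp_right)

sublocale q: walk_groupoid "qwalk Q'" "qhomotopic Q'"
  by (rule walk_groupoid_quiver[OF wf_Q'])

lemma concat_\<phi>:
  assumes "qpath (fbc_quiver E) x u y"
  shows "qpath Q' x (concat (map \<phi> u)) y \<and> path_cong E x y u (concat (map \<phi> u))"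
proof -
  have "set u \<subseteq> Lpart E"
    using assms by (induction u arbitrary: y) auto
  then show ?thesis
    by (intro path_cong_concat[OF N_subset assms] qpath_\<phi> path_cong_\<phi>) auto
qed

section \<open>From walks of \<open>E\<close> back to walks of the subquiver\<close>

fun step_word :: "'e \<times> dir \<times> 'e \<Rightarrow> 'e set letter list" where
  "step_word (y, Fwd, x) = map Arr (\<phi> (Lc E x))"
| "step_word (y, Bwd, x) = inv_walk (map Arr (\<phi> (Lc E y)))"
| "step_word (y, Tau, x) = []"

definition word :: "('e \<times> dir \<times> 'e) list \<Rightarrow> 'e set letter list" where
  "word w = concat (map step_word w)"

lemma word_simps [simp]:
  "word [] = []" "word (s # w) = step_word s @ word w" "word (u @ v) = word u @ word v"
  by (simp_all add: word_def)

lemma qwalk_\<phi>: "e \<in> elts E \<Longrightarrow> qwalk Q' (Pc E e) (map Arr (\<phi> (Lc E e))) (Pc E (act E 1 e))"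
  using qpath_\<phi>[of "Lc E e"] by (simp add: qwalk_Arr Lc_mem)

lemma qwalk_step_word:
  assumes "fstep E (y, \<delta>, x)"
  shows "qwalk Q' (Pc E x) (step_word (y, \<delta>, x)) (Pc E y)"
proof (cases \<delta>)
  case Fwd
  then show ?thesis using assms qwalk_\<phi>[of x] by simp
next
  case Bwd
  then show ?thesis using assms qwalk_inv_walk[OF wf_Q' qwalk_\<phi>[of y]] by simp
next
  case Tau
  then show ?thesis using assms Pc_mem by simp
qed

lemma qwalk_word: "fwalk E a w b \<Longrightarrow> qwalk Q' (Pc E a) (word w) (Pc E b)"
proof (induction w arbitrary: b)
  case Nil
  then show ?case using Pc_mem by auto
next
  case (Cons s w)
  obtain y \<delta> x where s: "s = (y, \<delta>, x)" by (metis prod_cases3)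
  then show ?case
    using Cons qwalk_step_word[of y \<delta> x] by (auto simp: qwalk_append[OF wf_Q'] simp del: step_word.simps)
qed

lemma word_gwalk: "e \<in> elts E \<Longrightarrow> word (gwalk E e n) = map Arr (concat (map \<phi> (Lseq E e n)))"
  by (induction n) (simp_all add: gwalk_Suc Lseq_Suc)

text \<open>The \<open>Tau\<close> steps dropped by \<open>word\<close> return as detours through
  representatives, so \<open>w\<close> is recovered up to \<open>Tau\<close> steps at its ends. This
  gives surjectivity of the map to the group of \<open>E\<close>.\<close>

lemma walk_of_word:
  assumes "fwalk E a w b"
  shows "fhomotopic E (rep (Pc E a)) (rep (Pc E b)) (walk_of E (word w))
    ([(rep (Pc E b), Tau, b)] @ w @ [(a, Tau, rep (Pc E a))])"
  using assms
proof (induction w arbitrary: b)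
  case Nil
  then have a: "a \<in> elts E" "b = a" by auto
  show ?case using fhomotopic.sym[OF tau_cancel[OF rep_Pc(1)[OF a(1)] a(1) rep_Pc(2)[OF a(1)]]] a(2) by simp
next
  case (Cons s w)
  obtain y \<delta> x where s: "s = (y, \<delta>, x)" by (metis prod_cases3)
  have st: "fstep E (y, \<delta>, x)" "y = b" "fwalk E a w x" using Cons.prems by (auto simp: s)
  have elts: "x \<in> elts E" "y \<in> elts E" "a \<in> elts E" using fstep_elts[OF st(1)] fwalk_elts[OF st(3)] by simp_all
  let ?A = "rep (Pc E a)" and ?X = "rep (Pc E x)" and ?Y = "rep (Pc E y)"
  have R: "?A \<in> elts E" "?X \<in> elts E" "?Y \<in> elts E" "Pc E ?A = Pc E a" "Pc E ?X = Pc E x" "Pc E ?Y = Pc E y"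
    by (simp_all only: rep_Pc elts)
  have fwd: "fhomotopic E (rep (Pc E e)) (rep (Pc E (act E 1 e))) (walk_of E (map Arr (\<phi> (Lc E e))))
      [(rep (Pc E (act E 1 e)), Tau, act E 1 e), (act E 1 e, Fwd, e), (e, Tau, rep (Pc E e))]"
    if e: "e \<in> elts E" for e
  proof -
    have "path_cong E (Pc E e) (Pc E (act E 1 e)) [Lc E e] (\<phi> (Lc E e))"
      using path_cong_\<phi>[of "Lc E e"] e by (simp add: Lc_mem)
    then have "fhomotopic E (rep (Pc E e)) (rep (Pc E (act E 1 e)))
        (walk_of E (map Arr [Lc E e])) (walk_of E (map Arr (\<phi> (Lc E e))))"
      by (rule walk_of_path_cong) (use e in \<open>simp add: Lc_mem Pc_mem\<close>)
    from fhomotopic.trans[OF fhomotopic.sym[OF this]] show ?thesis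
      using arrow_walk_hom[OF e] by simp
  qed
  have step: "fhomotopic E ?X ?Y (walk_of E (step_word (y, \<delta>, x))) [(?Y, Tau, y), (y, \<delta>, x), (x, Tau, ?X)]"
  proof (cases \<delta>)
    case Fwd
    then show ?thesis using fwd[of x] st elts by simp
  next
    case Bwd
    then have "act E 1 y = x" using st elts by simp
    then show ?thesis
      using fhomotopic_finv_cong[OF fwd[of y]] Bwd st elts by simp
  next
    case Tau
    then have P: "Pc E y = Pc E x" using st by simp
    have "fhomotopic E ?X ?X [] [(?X, Tau, x), (x, Tau, ?X)]"
      by (rule fhomotopic.sym[OF tau_cancel]) (simp_all only: R elts)
    also have "fhomotopic E ?X ?X \<dots> ([(?X, Tau, y), (y, Tau, x)] @ [(x, Tau, ?X)])"
    proof -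
      have "fhomotopic E x ?X [(?X, Tau, y), (y, Tau, x)] [(?X, Tau, x)]"
        by (rule fhomotopic.h2) (simp_all only: elts R P)
      moreover have "fwalk E ?X [(x, Tau, ?X)] x" using elts R by simp
      ultimately show ?thesis using walks.hom_right[OF fhomotopic.sym] by fastforce
    qed
    finally show ?thesis using Tau P by simp
  qed
  have "fhomotopic E ?A ?Y (walk_of E (step_word (y, \<delta>, x)) @ walk_of E (word w))
    ([(?Y, Tau, y), (y, \<delta>, x), (x, Tau, ?X)] @ [(?X, Tau, x)] @ w @ [(a, Tau, ?A)])"
    by (rule walks.hom_append[OF Cons.IH[OF st(3)] step])
  also have "fhomotopic E ?A ?Y \<dots> ([(?Y, Tau, y), (y, \<delta>, x)] @ w @ [(a, Tau, ?A)])"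
  proof -
    have "fwalk E ?A (w @ [(a, Tau, ?A)]) x" "fwalk E x [(?Y, Tau, y), (y, \<delta>, x)] ?Y"
      unfolding fwalk_append using st elts R by auto
    from walks.hom_cancel_middle[OF tau_cancel[OF elts(1) R(2) R(5)[symmetric]] this] show ?thesis by simp
  qed
  finally show ?case using st(2) by (simp add: s)
qed

end

section \<open>The isomorphism for the ideal restricted to a subquiver\<close>

locale fbc_subquiver_ideal = fbc_subquiver E N \<phi> for E :: "'e frac_conf" and N \<phi> +
  fixes I :: "('e set, 'e set, 'k::field) cat_ideal"
  assumes I_iff: "\<lbrakk>x \<in> Ppart E; y \<in> Ppart E\<rbrakk> \<Longrightarrow>
    f \<in> I x y \<longleftrightarrow> f \<in> khom (fbc_quiver' E N) x y \<and> f \<in> fbc_ideal E x y"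
begin

text \<open>The place where relators enter: since \<open>u\<close> is nonzero, two distinct
  congruent paths occur in a common minimal relation, and the conjugates of \<open>u^(-1) v\<close>
  are then relators, hence in \<open>M\<close>.\<close>

lemma coset_cong_path_cong:
  assumes M: "subgroup M (q.wgroup o')" "relators Q' I o' \<subseteq> M"
    and uv: "qpath Q' x u y" "qpath Q' x v y" "path_cong E x y u v" "nonzero_path E x y u"
  shows "q.coset_cong o' M x y (map Arr u) (map Arr v)"
proof (cases "u = v")
  case True
  then show ?thesis using uv by (simp add: q.coset_cong_hom qhomotopic.refl qwalk_Arr)
next
  case False
  have xy: "x \<in> Ppart E" "y \<in> Ppart E"
    using qpath_source[OF uv(1)] qpath_target[OF wf_Q' uv(1)] by simp_all
  obtain \<rho> where \<rho>: "minimal_relation I x y \<rho>" "u \<in> Poly_Mapping.keys \<rho>" "v \<in> Poly_Mapping.keys \<rho>"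
    using nonzero_path_minimal_relation[of I x y Q' u v, OF I_iff[OF xy] uv(4,3) False uv(1,2) qpath_mono[OF uv(1)]]
    by blast
  have u: "qwalk Q' x (map Arr u) y" "qwalk Q' x (map Arr v) y" using uv by (simp_all add: qwalk_Arr)
  show ?thesis
  proof (rule q.coset_cong_relator[OF u qwalk_inv_walk[OF wf_Q' u(1)] _ M(1)])
    show "qhomotopic Q' y y (map Arr u @ inv_walk (map Arr u)) []"
      using qhomotopic_inv_walk[OF wf_Q' qwalk_inv_walk[OF wf_Q' u(1)]] by simp
    fix \<gamma> assume g: "qwalk Q' o' \<gamma> x"
    have "q.cl o' (inv_walk \<gamma> @ inv_walk (map Arr u) @ map Arr v @ \<gamma>) \<in> relators Q' I o'"
      unfolding relators_def q.cl_def using g uv \<rho> False by blast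
    then show "\<exists>\<gamma>'. qwalk Q' x \<gamma>' o' \<and> qhomotopic Q' x x (\<gamma> @ \<gamma>') [] \<and>
        q.cl o' (\<gamma>' @ inv_walk (map Arr u) @ map Arr v @ \<gamma>) \<in> M"
      using M(2) qwalk_inv_walk[OF wf_Q' g] qhomotopic_inv_walk[OF wf_Q' qwalk_inv_walk[OF wf_Q' g]]
      by (intro exI[of _ "inv_walk \<gamma>"]) auto
  qed
qed

lemma nonzero_path_cong: "\<lbrakk>nonzero_path E x y u; path_cong E x y u v\<rbrakk> \<Longrightarrow> nonzero_path E x y v"
  unfolding nonzero_path_def by (meson rtranclp_trans)

text \<open>Among the generating homotopies only (h3) calls on \<open>M\<close>. (h1) becomes a free
  cancellation or an empty word, (h2) an empty word, and both sides of (h4) give the same word,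
  since a \<open>Fwd\<close> step is translated through its \<open>L\<close>-class alone.\<close>

lemma coset_cong_word:
  assumes M: "subgroup M (q.wgroup o')" "relators Q' I o' \<subseteq> M"
    and "fhomotopic E a b u v"
  shows "q.coset_cong o' M (Pc E a) (Pc E b) (word u) (word v)"
  using assms(3)
proof induction
  case (refl a u b)
  then show ?case by (intro q.coset_cong_hom qhomotopic.refl qwalk_word)
next
  case (sym a b u v)
  then show ?case by (blast intro: q.coset_cong_sym)
next
  case (trans a b u v w)
  then show ?case by (blast intro: q.coset_cong_trans)
next
  case (h1_left e)
  then show ?case using qhomotopic_inv_walk[OF wf_Q' qwalk_\<phi>[of e]] by (simp add: q.coset_cong_hom)
next
  case (h1_right e)
  then show ?case
    using qhomotopic_inv_walk[OF wf_Q' qwalk_inv_walk[OF wf_Q' qwalk_\<phi>[of "act E (- 1) e"]]]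
    by (simp add: q.coset_cong_hom)
next
  case (h1_tau e)
  then show ?case by (simp add: q.coset_cong_hom qhomotopic.refl Pc_mem)
next
  case (h2 e0 e1 e2)
  then show ?case by (simp add: q.coset_cong_hom qhomotopic.refl Pc_mem)
next
  case (h3 e h e' h')
  let ?x = "Pc E e" and ?y = "Pc E (act E (int (deg E e)) e)"
  let ?u = "Lseq E e (deg E e)" and ?v = "Lseq E h (deg E h)"
  have xy: "?x = Pc E h" "?y = Pc E (act E (int (deg E h)) h)" using h3 f4[of e h] by simp_all
  \<comment> \<open>(h3) is the case \<open>j = 0\<close> of (fR1), where the condition on omitted
    arrows is empty.\<close>
  have "Lc E (act E (int (deg E e - i)) e) = Lc E (act E (int (deg E h - i)) h)" if "i \<in> {1..0}" for i :: nat
    using that by simp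
  then have "fR1_pair E ?x ?y ?u ?v"
    using fR1_pair.intros[of e E h 0] h3 by simp
  then have pstep: "pstep E ?x ?y ?u ?v" by (rule fR1_pair_pstep)
  have qu: "qpath (fbc_quiver E) ?x ?u ?y" and qv: "qpath (fbc_quiver E) ?x ?v ?y"
    using qpath_Lseq[OF h3(1), of "deg E e"] qpath_Lseq[OF h3(2), of "deg E h"] by (simp_all only: xy)
  have "path_cong E ?x ?y (concat (map \<phi> ?u)) (concat (map \<phi> ?v))"
    using path_cong_sym[OF conjunct2[OF concat_\<phi>[OF qu]]] conjunct2[OF concat_\<phi>[OF qv]] pstep
    by (meson r_into_rtranclp rtranclp_trans)
  moreover have "nonzero_path E ?x ?y (concat (map \<phi> ?u))"
    using nonzero_path_cong[OF nonzero_standard conjunct2[OF concat_\<phi>[OF qu]]] h3 by simp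
  ultimately have "q.coset_cong o' M ?x ?y (map Arr (concat (map \<phi> ?u))) (map Arr (concat (map \<phi> ?v)))"
    using concat_\<phi>[OF qu] concat_\<phi>[OF qv] by (intro coset_cong_path_cong[OF M]) auto
  then show ?case using h3 xy by (simp add: word_gwalk)
next
  case (h4 e h e' h')
  then show ?case
    using qwalk_\<phi>[of h] Pc_eq_if_Lc_eq[of e h] by (simp add: q.coset_cong_hom qhomotopic.refl)
next
  case (h5_left a b u v w c)
  then show ?case using q.coset_cong_left[OF _ qwalk_word[of b w c]] by simp
next
  case (h5_right b c u v a w)
  then show ?case using q.coset_cong_right[OF _ qwalk_word[of a w b]] by simp
qed

text \<open>The composite substitutes \<open>\<phi> l\<close> for each arrow \<open>l\<close>.
  Modulo \<open>M\<close> this changes nothing, because a single arrow is a standard path (degrees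
  are positive) and hence nonzero.\<close>

lemma coset_cong_word_walk_of:
  assumes M: "subgroup M (q.wgroup o')" "relators Q' I o' \<subseteq> M"
    and "qwalk Q' x w y"
  shows "q.coset_cong o' M x y (word (walk_of E w)) w"
  using assms(3)
proof (induction w arbitrary: y)
  case Nil
  then show ?case by (auto intro!: q.coset_cong_hom qhomotopic.refl)
next
  case (Cons s w)
  have arr: "q.coset_cong o' M (tail (fbc_quiver E) l) (head (fbc_quiver E) l) (map Arr (\<phi> l)) [Arr l]"
    and walks: "qwalk Q' (tail (fbc_quiver E) l) (map Arr (\<phi> l)) (head (fbc_quiver E) l)"
      "qwalk Q' (tail (fbc_quiver E) l) [Arr l] (head (fbc_quiver E) l)"
    and word: "word (arrow_walk E l) = map Arr (\<phi> l)" "word (finv (arrow_walk E l)) = inv_walk (map Arr (\<phi> l))"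
    if "l \<in> N" for l
  proof -
    have l: "l \<in> Lpart E" using that N_subset by blast
    let ?e = "rep l"
    have e: "?e \<in> elts E" "Lc E ?e = l" using rep_Lpart[OF l] by simp_all
    have ends: "tail (fbc_quiver E) l \<in> Ppart E" "head (fbc_quiver E) l \<in> Ppart E"
      using e Pc_mem by (simp_all add: tail_rep[OF l] head_rep[OF l])
    have "nonzero_path E (tail (fbc_quiver E) l) (head (fbc_quiver E) l) [l]"
      using nonzero_standard[OF e(1), of 1] d_pos[OF e(1)] e
      by (simp add: tail_rep[OF l] head_rep[OF l] Lseq_Suc)
    moreover have "qpath Q' (tail (fbc_quiver E) l) [l] (head (fbc_quiver E) l)"
      using that ends by simp
    ultimately show "q.coset_cong o' M (tail (fbc_quiver E) l) (head (fbc_quiver E) l) (map Arr (\<phi> l)) [Arr l]"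
      using coset_cong_path_cong[OF M, of "tail (fbc_quiver E) l" "[l]" "head (fbc_quiver E) l" "\<phi> l"]
        qpath_\<phi>[OF l] path_cong_\<phi>[OF l] by (simp add: q.coset_cong_sym)
    show "qwalk Q' (tail (fbc_quiver E) l) (map Arr (\<phi> l)) (head (fbc_quiver E) l)"
      using qpath_\<phi>[OF l] by (simp add: qwalk_Arr)
    show "qwalk Q' (tail (fbc_quiver E) l) [Arr l] (head (fbc_quiver E) l)"
      using that ends by simp
    show "word (arrow_walk E l) = map Arr (\<phi> l)" "word (finv (arrow_walk E l)) = inv_walk (map Arr (\<phi> l))"
      using e by (simp_all add: arrow_walk_def)
  qed
  obtain z where z: "qwalk Q' z [s] y" "qwalk Q' x w z"
    using Cons.prems qwalk_append[OF wf_Q', of x "[s]" w y] by auto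
  have "q.coset_cong o' M z y (word (letter_walk E s)) [s]"
  proof (cases s)
    case (Arr l)
    then show ?thesis using z arr[of l] word[of l] by simp
  next
    case (Inv l)
    then have l: "l \<in> N" using z by simp
    have "q.coset_cong o' M (head (fbc_quiver E) l) (tail (fbc_quiver E) l)
        (inv_walk (map Arr (\<phi> l))) (inv_walk [Arr l])"
      using q.coset_cong_inverse[OF arr[OF l] qwalk_inv_walk[OF wf_Q' walks(1)[OF l]]
          qwalk_inv_walk[OF wf_Q' walks(2)[OF l]] qhomotopic_inv_walk[OF wf_Q' walks(2)[OF l]]]
        qhomotopic_inv_walk[OF wf_Q' qwalk_inv_walk[OF wf_Q' walks(1)[OF l]]]
      by simp
    then show ?thesis using Inv z word(2)[OF l] by simp
  qed
  from q.coset_cong_append[OF Cons.IH[OF z(2)] this] show ?case by simp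
qed

lemma fbc_fund_group_iso:
  assumes "fbc_connected E" "e \<in> elts E" "x \<in> Ppart E"
  shows "fbc_fund_group E e \<cong> fund_group Q' I x"
proof -
  have r: "rep x \<in> elts E" "Pc E (rep x) = x" using rep_Ppart[OF assms(3)] by simp_all
  obtain c where c: "fwalk E e c (rep x)"
    using assms r(1) by (auto simp: fbc_connected_def)
  note c' = fwalk_finv[OF c]
  have cc': "fhomotopic E e e (finv c @ c) []" "fhomotopic E (rep x) (rep x) (c @ finv c) []"
    using fhomotopic_finv[OF c] fhomotopic_finv[OF c'] by simp_all
  \<comment> \<open>Conjugation by \<open>c\<close> moves the base point from the representative of
    \<open>x\<close> to the given \<open>e\<close>.\<close>
  define F where "F w = finv c @ walk_of E w @ c" for w
  have of_walk: "fwalk E (rep x) (walk_of E w) (rep x)" if "qwalk Q' x w x" for w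
    using fwalk_walk_of[OF qwalk_mono[OF that]] .
  have F_hom: "fhomotopic E e e (finv c @ u @ c) (finv c @ v @ c)" if "fhomotopic E (rep x) (rep x) u v" for u v
    by (rule walks.hom_context[OF that c c'])
  have "walks.wgroup e \<cong> q.wgroup x Mod normal_closure (q.wgroup x) (relators Q' I x)"
  proof (rule iso_quotient_normal_closure[where F = F])
    show "walk_groupoid (qwalk Q') (qhomotopic Q')" "walk_groupoid (fwalk E) (fhomotopic E)"
      by unfold_locales
    show "qwalk Q' x [] x" "fwalk E e [] e" using assms by simp_all
    show "fwalk E e (F u) e" if "qwalk Q' x u x" for u
      using of_walk[OF that] c c' by (auto simp: F_def fwalk_append)
    show "fhomotopic E e e (F u) (F v)" if "qhomotopic Q' x x u v" for u v
      unfolding F_def by (intro F_hom fhomotopic_walk_of qhomotopic_mono that)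
    show "fhomotopic E e e (F (u @ v)) (F u @ F v)" if "qwalk Q' x u x" "qwalk Q' x v x" for u v
    proof -
      have "fwalk E e (walk_of E v @ c) (rep x)" "fwalk E (rep x) (finv c @ walk_of E u) e"
        using of_walk[OF that(1)] of_walk[OF that(2)] c c' by (auto simp: fwalk_append)
      from fhomotopic.sym[OF walks.hom_cancel_middle[OF cc'(2) this]] show ?thesis
        by (simp add: F_def)
    qed
    show "\<exists>u. qwalk Q' x u x \<and> fhomotopic E e e (F u) v" if v: "fwalk E e v e" for v
    proof (intro exI conjI)
      \<comment> \<open>The preimage of \<open>v\<close> is the word of \<open>v\<close> transported
        to the base point \<open>rep x\<close>.\<close>
      let ?w = "c @ v @ finv c"
      have w: "fwalk E (rep x) ?w (rep x)" using c c' v by (auto simp: fwalk_append)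
      then show "qwalk Q' x (word ?w) x" using qwalk_word[OF w] r by simp
      have "fhomotopic E (rep x) (rep x) (walk_of E (word ?w)) ([(rep x, Tau, rep x)] @ ?w @ [(rep x, Tau, rep x)])"
        using walk_of_word[OF w] r by simp
      also have "fhomotopic E (rep x) (rep x) \<dots> ([] @ ?w @ [])"
        using walks.hom_append[OF walks.hom_append[OF fhomotopic.h1_tau[OF r(1)] fhomotopic.refl[OF w]] fhomotopic.h1_tau[OF r(1)]]
        by simp
      finally have "fhomotopic E e e (F (word ?w)) (finv c @ ?w @ c)"
        unfolding F_def by (intro F_hom) simp
      also have "fhomotopic E e e (finv c @ ?w @ c) ([] @ v @ [])"
        using walks.hom_append[OF walks.hom_append[OF cc'(1) fhomotopic.refl[OF v]] cc'(1)] by simp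
      finally show "fhomotopic E e e (F (word ?w)) v" by simp
    qed
    show "relators Q' I x \<subseteq> {walk_groupoid.cl (qhomotopic Q') x w | w. qwalk Q' x w x \<and> fhomotopic E e e (F w) []}"
    proof
      fix X assume "X \<in> relators Q' I x"
      then obtain \<gamma> u v y z \<rho> where X: "X = Collect (qhomotopic Q' x x (inv_walk \<gamma> @ inv_walk (map Arr u) @ map Arr v @ \<gamma>))"
        and g: "qwalk Q' x \<gamma> y" and uv: "qpath Q' y u z" "qpath Q' y v z"
        and \<rho>: "minimal_relation I y z \<rho>" "u \<in> Poly_Mapping.keys \<rho>" "v \<in> Poly_Mapping.keys \<rho>"
        unfolding relators_def by blast
      let ?w = "inv_walk \<gamma> @ inv_walk (map Arr u) @ map Arr v @ \<gamma>"
      let ?G = "walk_of E \<gamma>" and ?U = "walk_of E (map Arr u)" and ?V = "walk_of E (map Arr v)"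
      have yz: "y \<in> Ppart E" "z \<in> Ppart E"
        using qpath_source[OF uv(1)] qpath_target[OF wf_Q' uv(1)] by simp_all
      have "path_cong E y z u v"
        by (rule minimal_relation_path_cong[of I y z Q', OF I_iff[OF yz] \<rho>])
      then have UV: "fhomotopic E (rep y) (rep z) ?U ?V"
        by (rule walk_of_path_cong) (rule qpath_mono[OF uv(1)])
      have w: "qwalk Q' x ?w x"
        using g uv qwalk_inv_walk[OF wf_Q' g] qwalk_inv_walk[OF wf_Q' uv(1)[folded qwalk_Arr]]
        unfolding qwalk_append[OF wf_Q'] qwalk_Arr by blast
      have G: "fwalk E (rep x) ?G (rep y)" using fwalk_walk_of[OF qwalk_mono[OF g]] .
      have U: "fwalk E (rep y) ?U (rep z)" using fhomotopic_fwalk[OF UV] by simp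
      have "fhomotopic E (rep y) (rep y) (finv ?U @ ?V) (finv ?U @ ?U)"
        by (rule fhomotopic.h5_left[OF fhomotopic.sym[OF UV] fwalk_finv[OF U]])
      also have "fhomotopic E (rep y) (rep y) \<dots> []" by (rule fhomotopic_finv[OF U])
      finally have "fhomotopic E (rep x) (rep x) (finv ?G @ (finv ?U @ ?V) @ ?G) (finv ?G @ [] @ ?G)"
        by (rule walks.hom_context[OF _ G fwalk_finv[OF G]])
      also have "fhomotopic E (rep x) (rep x) (finv ?G @ [] @ ?G) []" using fhomotopic_finv[OF G] by simp
      finally have "fhomotopic E e e (F ?w) (finv c @ [] @ c)"
        unfolding F_def by (intro F_hom) simp
      then have "fhomotopic E e e (F ?w) []" using cc'(1) by (auto intro: fhomotopic.trans)
      then show "X \<in> {walk_groupoid.cl (qhomotopic Q') x w | w. qwalk Q' x w x \<and> fhomotopic E e e (F w) []}"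
        using w X by (auto simp: q.cl_def)
    qed
  next
    fix M w
    assume M: "M \<lhd> walk_groupoid.wgroup (qwalk Q') (qhomotopic Q') x" "relators Q' I x \<subseteq> M"
      and w: "qwalk Q' x w x" and F: "fhomotopic E e e (F w) []"
    have sub: "subgroup M (q.wgroup x)" using M(1) by (simp add: normal_def)
    have "fhomotopic E (rep x) (rep x) (c @ F w @ finv c) (c @ [] @ finv c)"
      by (rule walks.hom_context[OF F c' c])
    also have "fhomotopic E (rep x) (rep x) (c @ [] @ finv c) []" using cc'(2) by simp
    finally have 1: "fhomotopic E (rep x) (rep x) (c @ F w @ finv c) []" .
    have 2: "fhomotopic E (rep x) (rep x) (c @ F w @ finv c) ([] @ walk_of E w @ [])"
      using walks.hom_append[OF walks.hom_append[OF cc'(2) fhomotopic.refl[OF of_walk[OF w]]] cc'(2)]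
      by (simp add: F_def)
    have "fhomotopic E (rep x) (rep x) (walk_of E w) []"
      using fhomotopic.trans[OF fhomotopic.sym[OF 2] 1] by simp
    \<comment> \<open>The null-homotopy of \<open>walk_of E w\<close> is read back in the quiver:
      modulo \<open>M\<close>, \<open>w\<close> agrees with \<open>word (walk_of E w)\<close>, and
      this with the empty word.\<close>
    from coset_cong_word[OF sub M(2) this]
    have "q.coset_cong x M x x (word (walk_of E w)) []" using r by simp
    from q.coset_cong_trans[OF q.coset_cong_sym[OF coset_cong_word_walk_of[OF sub M(2) w]] this]
    have "q.coset_cong x M x x w []" .
    then show "walk_groupoid.cl (qhomotopic Q') x w \<in> M"
      by (rule q.coset_cong_closed[OF _ sub])
  qed
  then show ?thesis
    by (simp add: fbc_fund_group_eq fund_group_def quiver_group_eq(1)[OF wf_Q'])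
qed

end

section \<open>Non-reduced arrows\<close>

text \<open>The equivalent complements, of common length \<open>j\<close>, are the arrows omitted in
  (fR1). The sources agree by (f4), because the targets of the two full sequences do.\<close>

lemma (in fbc) R_rel_path_cong:
  assumes "R_rel E (x, u) (x', v)" "qpath (fbc_quiver E) x u y"
  shows "path_cong E x y u v"
proof -
  obtain e n h m where std: "(e, n) \<in> std_seqs E" "(h, m) \<in> std_seqs E"
    and x: "x = Pc E e" "u = Lseq E e n" "v = Lseq E h m"
    and eq: "Lpath E (lhat E (e, n)) = Lpath E (lhat E (h, m))"
    using assms(1) by (auto simp: R_rel_def seq_equiv_def)
  have e: "e \<in> elts E" "n \<le> deg E e" and h: "h \<in> elts E" "m \<le> deg E h"
    using std by (auto simp: std_seqs_def)
  define j where "j = deg E e - n"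
  have j: "deg E h - m = j" "n = deg E e - j" "m = deg E h - j" "j \<le> deg E e" "j \<le> deg E h"
    using arg_cong[OF eq, of "length \<circ> snd"] e h by (auto simp: j_def)
  have eq': "Lpath E (act E (int n) e, j) = Lpath E (act E (int m) h, j)"
    using eq j(1) by (simp add: j_def)
  have Lc: "Lc E (act E (int (deg E e - i)) e) = Lc E (act E (int (deg E h - i)) h)" if i: "i \<in> {1..j}" for i
  proof -
    have "Lc E (act E (int (j - i)) (act E (int n) e)) = Lc E (act E (int (j - i)) (act E (int m) h))"
    proof -
      have "Lseq E (act E (int n) e) j = Lseq E (act E (int m) h) j" using eq' by simp
      moreover have "j - i < j" using i by auto
      ultimately show ?thesis unfolding Lseq_eq_iff by blast
    qed
    moreover have "int (j - i) + int n = int (deg E e - i)" "int (j - i) + int m = int (deg E h - i)"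
      using i j by auto
    ultimately show ?thesis by (simp only: act_act[OF e(1)] act_act[OF h(1)])
  qed
  have "Pc E (act E (int j) (act E (int n) e)) = Pc E (act E (int j) (act E (int m) h))"
    by (rule Pc_target_eq[OF _ _ eq']) (use e h in simp_all)
  moreover have "int j + int n = int (deg E e)" "int j + int m = int (deg E h)" using j by auto
  ultimately have "Pc E e = Pc E h"
    using f4[OF e(1) h(1)] by (simp only: act_act[OF e(1)] act_act[OF h(1)])
  then have "fR1_pair E (Pc E e) (Pc E (act E (int n) e)) (Lseq E e n) (Lseq E h m)"
    unfolding j(2,3) using fR1_pair.intros[of e E h j] e h j(4,5) Lc by blast
  moreover have "y = Pc E (act E (int n) e)"
    using qpath_Lseq_target[OF e(1)] assms(2) x by blast
  ultimately show ?thesis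
    using fR1_pair_pstep x by blast
qed

context fs_bc
begin

text \<open>Rewriting a reduced arrow lengthens a path, while the class of an arrow consists of standard
  paths at the source of that arrow, whose lengths are bounded.\<close>

lemma arrow_nonreduced_path:
  assumes l: "l \<in> Lpart E"
  shows "\<exists>p. set p \<subseteq> nonreduced_arrows E \<and>
    path_cong E (tail (fbc_quiver E) l) (head (fbc_quiver E) l) [l] p"
proof -
  let ?Q = "fbc_quiver E"
  define x y where "x = tail ?Q l" and "y = head ?Q l"
  have l_path: "qpath ?Q x [l] y"
    using l wf_fbc_quiver by (auto simp: x_def y_def wf_digraph_def)
  define e where "e = rep l"
  have e: "e \<in> elts E" "x = Pc E e" "y = Pc E (act E (int 1) e)" "[l] = Lseq E e 1"
    using rep_Lpart[OF l] by (simp_all add: e_def x_def y_def tail_rep[OF l] head_rep[OF l] Lseq_Suc)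
  \<comment> \<open>A path congruent to \<open>l\<close> starts a full sequence at some element of
    \<open>P(e)\<close>, which is finite by (f1), so the maximal degree bounds its length.\<close>
  have bound: "length p < Suc (Max (deg E ` Pc E e))" if p: "path_cong E x y [l] p" for p
  proof -
    obtain h where "h \<in> elts E" "Pc E h = Pc E e" "length p \<le> deg E h"
      using path_cong_standard(1)[OF e(1) _ e(3)] p d_pos[OF e(1)] e by fastforce
    moreover have "deg E h \<le> Max (deg E ` Pc E e)" if "h \<in> Pc E e"
      using f1[OF e(1)] that by (intro Max_ge) auto
    ultimately show ?thesis using Pc_mem(2)[of h] by fastforce
  qed
  obtain p where p: "path_cong E x y [l] p"
    and max: "\<And>q. path_cong E x y [l] q \<Longrightarrow> length q \<le> length p"
    using ex_has_greatest_nat[of "path_cong E x y [l]" "[l]" length] bound by blast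
  have p_path: "qpath ?Q x p y" by (rule path_cong_qpath[OF p l_path])
  have "\<beta> \<in> nonreduced_arrows E" if \<beta>: "\<beta> \<in> set p" for \<beta>
  proof -
    obtain a b where ab: "p = a @ [\<beta>] @ b" using split_list[OF \<beta>] by auto
    then have path: "\<beta> \<in> Lpart E" "qpath ?Q x b (tail ?Q \<beta>)" "qpath ?Q (head ?Q \<beta>) a y"
      using p_path by (auto simp: qpath_append[OF wf_fbc_quiver])
    have "\<not> reduced_arrow E \<beta>"
    proof
      assume "reduced_arrow E \<beta>"
      then obtain q where q: "length q \<ge> 2" "R_rel E (tail ?Q \<beta>, [\<beta>]) (tail ?Q \<beta>, q)"
        by (auto simp: reduced_arrow_def arrow_path_def)
      have "qpath ?Q (tail ?Q \<beta>) [\<beta>] (head ?Q \<beta>)"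
        using path qpath_target[OF wf_fbc_quiver path(2)] by simp
      from path_cong_append[OF R_rel_path_cong[OF q(2) this] path(2,3)]
      have "path_cong E x y [l] (a @ q @ b)" using p ab by simp
      from max[OF this] show False using q(1) ab by simp
    qed
    then show ?thesis using path(1) by (simp add: nonreduced_arrows_def)
  qed
  then show ?thesis using p by (auto simp: x_def y_def)
qed

text \<open>The arrow is rewritten into nonreduced arrows, each of which is
  \<open>R\<close>-related, hence congruent, to its representative in \<open>N\<close>.\<close>

lemma arrow_reps_path:
  assumes N: "arrow_reps E N" and l: "l \<in> Lpart E"
  shows "\<exists>p. qpath (fbc_quiver' E N) (tail (fbc_quiver E) l) p (head (fbc_quiver E) l) \<and>
    path_cong E (tail (fbc_quiver E) l) (head (fbc_quiver E) l) [l] p"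
proof -
  let ?Q = "fbc_quiver E"
  have N_subset: "N \<subseteq> Lpart E" using N by (auto simp: arrow_reps_def nonreduced_arrows_def)
  have l_path: "qpath ?Q (tail ?Q l) [l] (head ?Q l)" if "l \<in> Lpart E" for l
    using that wf_fbc_quiver by (auto simp: wf_digraph_def)
  have "\<forall>\<alpha>. \<exists>\<beta>. \<alpha> \<in> nonreduced_arrows E \<longrightarrow> \<beta> \<in> N \<and> R_rel E (arrow_path E \<alpha>) (arrow_path E \<beta>)"
    using N unfolding arrow_reps_def by blast
  then obtain r where r: "\<And>\<alpha>. \<alpha> \<in> nonreduced_arrows E \<Longrightarrow> r \<alpha> \<in> N \<and> R_rel E (arrow_path E \<alpha>) (arrow_path E (r \<alpha>))"
    by metis
  have r_path: "path_cong E (tail ?Q \<alpha>) (head ?Q \<alpha>) [\<alpha>] [r \<alpha>]"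
    "qpath (fbc_quiver' E N) (tail ?Q \<alpha>) [r \<alpha>] (head ?Q \<alpha>)" if \<alpha>: "\<alpha> \<in> nonreduced_arrows E" for \<alpha>
  proof -
    have "\<alpha> \<in> Lpart E" using \<alpha> by (simp add: nonreduced_arrows_def)
    note path = l_path[OF this]
    show cong: "path_cong E (tail ?Q \<alpha>) (head ?Q \<alpha>) [\<alpha>] [r \<alpha>]"
    proof (rule R_rel_path_cong[OF _ path])
      show "R_rel E (tail ?Q \<alpha>, [\<alpha>]) (tail ?Q (r \<alpha>), [r \<alpha>])"
        using r[OF \<alpha>] by (simp add: arrow_path_def)
    qed
    show "qpath (fbc_quiver' E N) (tail ?Q \<alpha>) [r \<alpha>] (head ?Q \<alpha>)"
      using path_cong_qpath[OF cong path] r[OF \<alpha>] by auto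
  qed
  obtain p where p: "set p \<subseteq> nonreduced_arrows E" "path_cong E (tail ?Q l) (head ?Q l) [l] p"
    using arrow_nonreduced_path[OF l] by blast
  have "qpath (fbc_quiver' E N) (tail ?Q l) (concat (map (\<lambda>\<alpha>. [r \<alpha>]) p)) (head ?Q l) \<and>
      path_cong E (tail ?Q l) (head ?Q l) p (concat (map (\<lambda>\<alpha>. [r \<alpha>]) p))"
    using p(1) by (intro path_cong_concat[OF N_subset path_cong_qpath[OF p(2) l_path[OF l]]] r_path) auto
  then show ?thesis using p(2) by (meson rtranclp_trans)
qed

end

text \<open>The generated ideal has no separate scalar rule; the sign comes from composing with
  \<open>- 1\<close> times the identity at \<open>y\<close>.\<close>

lemma (in fbc) fbc_ideal_uminus:
  assumes "f \<in> fbc_ideal E x y" "y \<in> Ppart E"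
  shows "- f \<in> fbc_ideal E x y"
proof -
  have "kcomp (Poly_Mapping.single [] (- 1)) f \<in> fbc_ideal E x y"
    using assms unfolding fbc_ideal_def gen_ideal_def
    by (auto intro!: in_gen_ideal.comp_left[where y = y] single_in_khom)
  moreover have "kcomp (Poly_Mapping.single [] (- 1)) f = - f"
  proof -
    have "kcomp (Poly_Mapping.single [] (- 1)) f
        = - (\<Sum>v\<in>Poly_Mapping.keys f. Poly_Mapping.single v (Poly_Mapping.lookup f v))"
      by (simp add: kcomp_def single_uminus sum_negf)
    also have "(\<Sum>v\<in>Poly_Mapping.keys f. Poly_Mapping.single v (Poly_Mapping.lookup f v)) = f"
      by (rule poly_mapping_eqI) (simp add: lookup_sum lookup_single when_def in_keys_iff)
    finally show ?thesis .
  qed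
  ultimately show ?thesis by simp
qed

text \<open>The kernel is the intersection of the ideal with \<open>kQ'\<close>: the class of
  \<open>f\<close> contains \<open>f\<close>, and translation by an element of the ideal does not
  change classes.\<close>

lemma (in fbc) fbc_ideal'_iff:
  fixes f :: "'e set list \<Rightarrow>\<^sub>0 'k::field"
  assumes "N \<subseteq> Lpart E" "x \<in> Ppart E" "y \<in> Ppart E"
  shows "f \<in> fbc_ideal' E N x y \<longleftrightarrow> f \<in> khom (fbc_quiver' E N) x y \<and> f \<in> fbc_ideal E x y"
proof -
  have "quot_class (fbc_quiver E) (fbc_ideal E) x y f = quot_class (fbc_quiver E) (fbc_ideal E) x y 0
      \<longleftrightarrow> f \<in> fbc_ideal E x y" if "f \<in> khom (fbc_quiver' E N) x y"
  proof
    have "f \<in> khom (fbc_quiver E) x y"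
      using that qpath_fbc_quiver'_mono[OF assms(1)] by (auto simp: khom_def)
    then have "f \<in> quot_class (fbc_quiver E) (fbc_ideal E) x y f"
      using fbc_ideal_zero[OF assms(2,3)] by (simp add: quot_class_def)
    moreover assume "quot_class (fbc_quiver E) (fbc_ideal E) x y f = quot_class (fbc_quiver E) (fbc_ideal E) x y 0"
    ultimately have "f \<in> quot_class (fbc_quiver E) (fbc_ideal E) x y 0" by simp
    then show "f \<in> fbc_ideal E x y" by (simp add: quot_class_def)
  next
    assume f: "f \<in> fbc_ideal E x y"
    have "h - f \<in> fbc_ideal E x y \<longleftrightarrow> h \<in> fbc_ideal E x y" for h
      using fbc_ideal_add[OF f, of "h - f"] fbc_ideal_add[OF fbc_ideal_uminus[OF f assms(3)], of h]
      by auto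
    then show "quot_class (fbc_quiver E) (fbc_ideal E) x y f = quot_class (fbc_quiver E) (fbc_ideal E) x y 0"
      by (simp add: quot_class_def)
  qed
  then show ?thesis
    unfolding fbc_ideal'_def sub_kernel_def by blast
qed

theorem theorem1p5:
  fixes E :: "'e frac_conf" and e :: 'e
  assumes "fs_bc E" and "fbc_connected E" and "e \<in> elts E"
  shows "(\<forall>x \<in> verts (fbc_quiver E).
            fbc_fund_group E e \<cong>
              fund_group (fbc_quiver E) (fbc_ideal E :: ('e set, 'e set, 'k::field) cat_ideal) x)
       \<and> (\<forall>N. arrow_reps E N \<longrightarrow> (\<forall>x \<in> verts (fbc_quiver' E N).
            fbc_fund_group E e \<cong>
              fund_group (fbc_quiver' E N)
                (fbc_ideal' E N :: ('e set, 'e set, 'k::field) cat_ideal) x))"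
proof (intro conjI ballI allI impI)
  interpret fs_bc E by fact
  fix x assume x: "x \<in> verts (fbc_quiver E)"
  have Q: "fbc_quiver' E (Lpart E) = fbc_quiver E"
    by (simp add: fbc_quiver'_def fbc_quiver_def)
  \<comment> \<open>\<open>Q_E\<close> is treated as a subquiver of itself in which every arrow is
    its own factorisation.\<close>
  interpret fbc_subquiver_ideal E "Lpart E" "\<lambda>l. [l]"
    "fbc_ideal E :: ('e set, 'e set, 'k) cat_ideal"
    using wf_fbc_quiver fbc_ideal_khom by unfold_locales (auto simp: Q wf_digraph_def)
  show "fbc_fund_group E e \<cong>
      fund_group (fbc_quiver E) (fbc_ideal E :: ('e set, 'e set, 'k) cat_ideal) x"
    using fbc_fund_group_iso[OF assms(2,3)] x by (simp add: Q)
next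
  interpret fs_bc E by fact
  fix N x assume N: "arrow_reps E N" and x: "x \<in> verts (fbc_quiver' E N)"
  have N_subset: "N \<subseteq> Lpart E" using N by (auto simp: arrow_reps_def nonreduced_arrows_def)
  obtain \<phi> where "\<And>l. l \<in> Lpart E \<Longrightarrow>
      qpath (fbc_quiver' E N) (tail (fbc_quiver E) l) (\<phi> l) (head (fbc_quiver E) l) \<and>
      path_cong E (tail (fbc_quiver E) l) (head (fbc_quiver E) l) [l] (\<phi> l)"
    using arrow_reps_path[OF N] by metis
  then interpret fbc_subquiver_ideal E N \<phi> "fbc_ideal' E N :: ('e set, 'e set, 'k) cat_ideal"
    using N_subset fbc_ideal'_iff[where 'k = 'k, OF N_subset] by unfold_locales auto
  show "fbc_fund_group E e \<cong>
      fund_group (fbc_quiver' E N) (fbc_ideal' E N :: ('e set, 'e set, 'k) cat_ideal) x"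
    using fbc_fund_group_iso[OF assms(2,3)] x by simp
qed

end
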